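(* Let $n\in\mathbb{N}$, $u\in B_{p,\infty}^{\boldsymbol{k}}\cap C_b(K)$, $\boldsymbol{v}=(v_1,\dots,v_n)\in\bigl(B_{p,\infty}^{\boldsymbol{k}}\cap C_b(K)\bigr)^n$, $\Phi\in C^1(\mathbb{R})$, $\Psi\in C^1(\mathbb{R}^n)$ and suppose that $\Phi(0)=\Psi(0)=0$. Then $\Phi(u),\Psi(\boldsymbol{v})\in B_{p,\infty}^{\boldsymbol{k}}\cap C_b(K)$ and $$d\Gamma_p^{\boldsymbol{k}}\langle\Phi(u);\Psi(\boldsymbol{v})\rangle=\sum_{k=1}^n\operatorname{sgn}\bigl(\Phi'(u)\bigr)|\Phi'(u)|^{p-1}\,\partial_k\Psi(\boldsymbol{v})\,d\Gamma_p^{\boldsymbol{k}}\langle u;v_k\rangle.$$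
   Context: Setting. $p\in(1,\infty)$; $(K,d)$ is a locally compact separable metric space with at least two points; $m$ is a $\sigma$-finite Borel measure on $K$ with full topological support; $B_d(x,r)=\{y: d(x,y)<r\}$. $C_b(K)$, $C_c(K)$ are the bounded, respectively compactly supported, continuous real functions on $K$, identified with their $m$-equivalence classes. A Radon measure is a Borel measure finite on compact sets. $\boldsymbol{k}=\{k_r\}_{r>0}$ is a family of $[0,\infty]$-valued Borel functions on $K\times K$; $J_{p,r}^{\boldsymbol{k}}(f)=\int_K\int_K|f(x)-f(y)|^pk_r(x,y)\,m(dy)\,m(dx)$ for $f\in L^p(K,m)$; $B_{p,\infty}^{\boldsymbol{k}}=\{f\in L^p(K,m):\sup_{r>0}J_{p,r}^{\boldsymbol{k}}(f)<\infty\}$. Standing assumptions: (1) $(\mathrm{WM})_{p,\boldsymbol{k}}$: there is $C\in[1,\infty)$ with $\sup_{r>0}J_{p,r}^{\boldsymbol{k}}(f)\le C\liminf_{r\downarrow0}J_{p,r}^{\boldsymbol{k}}(f)$ for all $f\in B_{p,\infty}^{\boldsymbol{k}}$; (2) $\boldsymbol{k}$ is asymptotically local: there is $\{\delta(r)\}_{r>0}\subseteq(0,\infty)$ with $\lim_{r\downarrow0}\delta(r)=0$ and $\lim_{r\downarrow0}\int_K\int_{K\setminus B_d(x,\delta(r))}k_r(x,y)\,m(dy)\,m(dx)=0$; (3) $B_{p,\infty}^{\boldsymbol{k}}\cap C_c(K)$ is dense in $(C_c(K),\|\cdot\|_{\sup})$. Fix a sequence $r_n>0$, $r_n\to0$,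 such that $\mathcal{E}_p^{\boldsymbol{k}}(f):=\lim_{n\to\infty}J_{p,r_n}^{\boldsymbol{k}}(f)$ exists in $[0,\infty)$ for every $f\in B_{p,\infty}^{\boldsymbol{k}}$ (such sequences exist under (1)); $\mathcal{E}_p^{\boldsymbol{k}}(f;g):=\frac1p\frac{d}{dt}\mathcal{E}_p^{\boldsymbol{k}}(f+tg)|_{t=0}$, which exists. $p$-energy measures. For $u\in B_{p,\infty}^{\boldsymbol{k}}\cap C_b(K)$, $\Gamma_p^{\boldsymbol{k}}\langle u\rangle$ is the unique positive Radon measure on $K$ (known to exist and to be finite) with $\int_K\varphi\,d\Gamma_p^{\boldsymbol{k}}\langle u\rangle=\mathcal{E}_p^{\boldsymbol{k}}(u;u\varphi)-(\frac{p-1}{p})^{p-1}\mathcal{E}_p^{\boldsymbol{k}}(|u|^{p/(p-1)};\varphi)$ for all $\varphi\in B_{p,\infty}^{\boldsymbol{k}}\cap C_c(K)$. For $u,v\in B_{p,\infty}^{\boldsymbol{k}}\cap C_b(K)$, $\Gamma_p^{\boldsymbol{k}}\langle u;v\rangle$ is the signed Borel measure on $K$ given by $\Gamma_p^{\boldsymbol{k}}\langle u;v\rangle(A)=\frac1p\frac{d}{dt}\Gamma_p^{\boldsymbol{k}}\langle u+tv\rangle(A)|_{t=0}$, $A\in\mathcal{B}(K)$ (the derivative exists and defines a signed measure). *)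

theory Defs
  imports "HOL-Analysis.Analysis"
begin

text \<open>Elements of \<open>L\<^sup>p\<close> are represented by functions; every functional below depends on a
  function only up to \<open>m\<close>-a.e. equality. As \<open>m\<close> has full support in the setting considered,
  an \<open>m\<close>-class has at most one continuous representative.\<close>

definition Lp_functions :: "'a measure \<Rightarrow> real \<Rightarrow> ('a \<Rightarrow> real) set" where
  "Lp_functions m p = {f \<in> borel_measurable m. integrable m (\<lambda>x. \<bar>f x\<bar> powr p)}"

definition Cb :: "('a::topological_space \<Rightarrow> real) set" where
  "Cb = {f. continuous_on UNIV f \<and> bounded (range f)}"

definition Cc :: "('a::topological_space \<Rightarrow> real) set" where
  "Cc = {f. continuous_on UNIV f \<and> compact (closure {x. f x \<noteq> 0})}"

definition J_energy ::
  "'a measure \<Rightarrow> real \<Rightarrow> (real \<Rightarrow> 'a \<times> 'a \<Rightarrow> ennreal) \<Rightarrow> real \<Rightarrow> ('a \<Rightarrow> real) \<Rightarrow> ennreal" where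
  "J_energy m p k r f =
     (\<integral>\<^sup>+ x. (\<integral>\<^sup>+ y. ennreal (\<bar>f x - f y\<bar> powr p) * k r (x, y) \<partial>m) \<partial>m)"

definition B_space ::
  "'a measure \<Rightarrow> real \<Rightarrow> (real \<Rightarrow> 'a \<times> 'a \<Rightarrow> ennreal) \<Rightarrow> ('a \<Rightarrow> real) set" where
  "B_space m p k = {f \<in> Lp_functions m p. (SUP r\<in>{0<..}. J_energy m p k r f) < \<infinity>}"

definition weak_monotonicity ::
  "'a measure \<Rightarrow> real \<Rightarrow> (real \<Rightarrow> 'a \<times> 'a \<Rightarrow> ennreal) \<Rightarrow> bool" where
  "weak_monotonicity m p k \<longleftrightarrow>
     (\<exists>C::real. 1 \<le> C \<and>
       (\<forall>f \<in> B_space m p k.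
          (SUP r\<in>{0<..}. J_energy m p k r f)
            \<le> ennreal C * Liminf (at_right 0) (\<lambda>r. J_energy m p k r f)))"

definition asymptotically_local ::
  "'a::metric_space measure \<Rightarrow> (real \<Rightarrow> 'a \<times> 'a \<Rightarrow> ennreal) \<Rightarrow> bool" where
  "asymptotically_local m k \<longleftrightarrow>
     (\<exists>\<delta>::real \<Rightarrow> real. (\<forall>r>0. 0 < \<delta> r) \<and> (\<delta> \<longlongrightarrow> 0) (at_right 0) \<and>
       ((\<lambda>r. \<integral>\<^sup>+ x. (\<integral>\<^sup>+ y \<in> UNIV - ball x (\<delta> r). k r (x, y) \<partial>m) \<partial>m) \<longlongrightarrow> 0) (at_right 0))"

definition sup_dense_in :: "('a \<Rightarrow> real) set \<Rightarrow> ('a \<Rightarrow> real) set \<Rightarrow> bool" where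
  "sup_dense_in D X \<longleftrightarrow>
     D \<subseteq> X \<and> (\<forall>f\<in>X. \<forall>\<epsilon>>0. \<exists>g\<in>D. (SUP x. \<bar>f x - g x\<bar>) < \<epsilon>)"

definition p_energy ::
  "'a measure \<Rightarrow> real \<Rightarrow> (real \<Rightarrow> 'a \<times> 'a \<Rightarrow> ennreal) \<Rightarrow> (nat \<Rightarrow> real) \<Rightarrow> ('a \<Rightarrow> real) \<Rightarrow> real" where
  "p_energy m p k \<rho> f = enn2real (lim (\<lambda>n. J_energy m p k (\<rho> n) f))"

definition p_energy2 ::
  "'a measure \<Rightarrow> real \<Rightarrow> (real \<Rightarrow> 'a \<times> 'a \<Rightarrow> ennreal) \<Rightarrow> (nat \<Rightarrow> real) \<Rightarrow>
   ('a \<Rightarrow> real) \<Rightarrow> ('a \<Rightarrow> real) \<Rightarrow> real" where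
  "p_energy2 m p k \<rho> f g = 1 / p * deriv (\<lambda>t. p_energy m p k \<rho> (\<lambda>x. f x + t * g x)) 0"

definition radon_measure :: "'a::topological_space measure \<Rightarrow> bool" where
  "radon_measure M \<longleftrightarrow> sets M = sets borel \<and> (\<forall>C. compact C \<longrightarrow> emeasure M C < \<infinity>)"

definition energy_measure ::
  "'a::topological_space measure \<Rightarrow> real \<Rightarrow> (real \<Rightarrow> 'a \<times> 'a \<Rightarrow> ennreal) \<Rightarrow> (nat \<Rightarrow> real) \<Rightarrow>
   ('a \<Rightarrow> real) \<Rightarrow> 'a measure" where
  "energy_measure m p k \<rho> u =
     (THE M. radon_measure M \<and>
        (\<forall>\<phi> \<in> B_space m p k \<inter> Cc.
           (\<integral>x. \<phi> x \<partial>M) =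
             p_energy2 m p k \<rho> u (\<lambda>x. u x * \<phi> x)
             - ((p - 1) / p) powr (p - 1) *
                 p_energy2 m p k \<rho> (\<lambda>x. \<bar>u x\<bar> powr (p / (p - 1))) \<phi>))"

text \<open>Finite signed Borel measures are represented by their real-valued set functions on
  \<^term>\<open>sets borel\<close>.\<close>

definition energy_measure2 ::
  "'a::topological_space measure \<Rightarrow> real \<Rightarrow> (real \<Rightarrow> 'a \<times> 'a \<Rightarrow> ennreal) \<Rightarrow> (nat \<Rightarrow> real) \<Rightarrow>
   ('a \<Rightarrow> real) \<Rightarrow> ('a \<Rightarrow> real) \<Rightarrow> 'a set \<Rightarrow> real" where
  "energy_measure2 m p k \<rho> u v A =
     1 / p * deriv (\<lambda>t. measure (energy_measure m p k \<rho> (\<lambda>x. u x + t * v x)) A) 0"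

text \<open>For a finite signed measure \<open>\<nu>\<close>, the positive part of its Jordan decomposition is
  \<open>A \<mapsto> sup {\<nu> B | B \<subseteq> A Borel}\<close>, and the negative part is the positive part of \<open>-\<nu>\<close>. Applying
  \<^const>\<open>ennreal\<close> before taking the supremum is harmless because \<open>\<nu> {} = 0\<close>.\<close>

definition jordan_pos :: "('a::topological_space set \<Rightarrow> real) \<Rightarrow> 'a measure" where
  "jordan_pos \<nu> =
     measure_of UNIV (sets borel) (\<lambda>A. SUP B\<in>{B \<in> sets borel. B \<subseteq> A}. ennreal (\<nu> B))"

definition signed_set_integral ::
  "('a::topological_space set \<Rightarrow> real) \<Rightarrow> 'a set \<Rightarrow> ('a \<Rightarrow> real) \<Rightarrow> real" where
  "signed_set_integral \<nu> A f =
     (LINT x:A|jordan_pos \<nu>. f x) - (LINT x:A|jordan_pos (\<lambda>B. - \<nu> B). f x)"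

definition C1_function :: "('b::real_normed_vector \<Rightarrow> real) \<Rightarrow> bool" where
  "C1_function F \<longleftrightarrow>
     (\<exists>F' :: 'b \<Rightarrow> 'b \<Rightarrow>\<^sub>L real.
        (\<forall>x. (F has_derivative blinfun_apply (F' x)) (at x)) \<and> continuous_on UNIV F')"

definition partial_deriv :: "'n::finite \<Rightarrow> (real ^ 'n \<Rightarrow> real) \<Rightarrow> real ^ 'n \<Rightarrow> real" where
  "partial_deriv i F x = deriv (\<lambda>t. F (x + t *\<^sub>R axis i 1)) 0"

end

theory Submission imports Defs begin

text \<open>
  Write \<open>D f (x, y) = f x - f y\<close> (\<open>jump f\<close> below), let \<open>\<mu>\<^sub>n\<close> be the measure on the product
  space with density \<open>k (\<rho> n)\<close> relative to \<open>m \<Otimes> m\<close>, and let \<open>s\<^bsup>(p-1)\<^esup> = sgn s * |s| powr (p - 1)\<close>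
  (\<open>spow p s\<close>). Every energy in the statement is a limit of weighted integrals
  \<open>T n w f g = \<integral> w (D f)\<^bsup>(p-1)\<^esup> D g d\<mu>\<^sub>n\<close>, and the chain rule is the statement that, in the limit,
  \<open>D\<close> acts as a derivation. Three facts make this rigorous.

  Differentiation in \<open>t\<close> commutes with the limit in \<open>n\<close>. The first-order Taylor error of
  \<open>|a + t b| powr p\<close> at \<open>t = 0\<close> is at most \<open>\<epsilon> |t| (|a| powr p + |b| powr p)\<close> for small \<open>t\<close>, uniformly
  in \<open>a\<close> and \<open>b\<close>, because both sides are homogeneous of degree \<open>p\<close> (\<open>powr_uniform_derivative\<close>).
  Integrated against \<open>w \<mu>\<^sub>n\<close>, this bound is uniform in \<open>n\<close>; hence \<open>T n w f g\<close> converges as soon as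
  \<open>T n w (f + t g) (f + t g)\<close> does for all \<open>t\<close>, and its limit is the expected derivative
  (\<open>T_polarized_limit\<close>).

  The measures \<open>\<mu>\<^sub>n\<close> concentrate on the diagonal. A bounded integrand that near the diagonal is an
  arbitrarily small multiple of a function with bounded \<open>\<mu>\<^sub>n\<close>-integrals contributes nothing in the
  limit (\<open>localization\<close>). Near the diagonal and over a compact set, \<open>D (\<Phi> \<circ> u)\<close> is
  \<open>\<Phi>' (u) D u\<close> up to such an error, and similarly for \<open>\<Psi>\<close>. This gives the chain rule in either
  argument of \<open>T\<close> (\<open>T_chain_first\<close>, \<open>T_chain_second\<close>). The same argument applied to
  \<open>|u| powr (p / (p - 1))\<close> identifies the functional that defines \<open>\<Gamma>\<langle>u\<rangle>\<close> with
  \<open>lim T n (\<phi> \<circ> fst) u u\<close> (\<open>energy_functional_limit\<close>).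

  Limits of \<open>T\<close> on test functions are measures. The functional just described is positive, so the
  Riesz representation theorem (\<open>Riesz_Cc\<close>) produces \<open>\<Gamma>\<langle>u\<rangle>\<close>. The inequality
  \<open>|T n w u v| \<le> T n w u u + T n w v v\<close> produces in the same way two finite measures whose difference
  represents \<open>lim T n (\<phi> \<circ> fst) u v\<close>, and the uniform Taylor bound, transferred from test functions
  to Borel sets, shows that this difference is \<open>\<Gamma>\<langle>u; v\<rangle>\<close> (\<open>energy_measure2_representation\<close>).
  The coefficients in the chain rule are bounded and continuous, so multiplying a test function by
  them gives a test function again; the identity therefore holds for the integrals of all test
  functions, and finite signed measures are determined by those (\<open>signed_Cc_determines\<close>).
\<close>

section \<open>Compactly supported continuous functions\<close>

lemma CcI:
  fixes f :: "'a::t2_space \<Rightarrow> real"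
  assumes "continuous_on UNIV f" "compact S" "\<And>x. f x \<noteq> 0 \<Longrightarrow> x \<in> S"
  shows "f \<in> Cc"
proof -
  have "closure {x. f x \<noteq> 0} \<subseteq> S"
    using assms by (intro closure_minimal compact_imp_closed) auto
  then show ?thesis
    using assms closed_Int_compact[of "closure {x. f x \<noteq> 0}" S]
    by (auto simp: Cc_def Int_absorb2)
qed

lemma CcE:
  fixes f :: "'a::t2_space \<Rightarrow> real"
  assumes "f \<in> Cc"
  obtains S where "compact S" "\<And>x. x \<notin> S \<Longrightarrow> f x = 0"
  using assms closure_subset[of "{x. f x \<noteq> 0}"] unfolding Cc_def by blast

lemma Cc_continuous: "f \<in> Cc \<Longrightarrow> continuous_on UNIV f"
  by (simp add: Cc_def)

lemma Cc_support_subset: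
  fixes h :: "'a::t2_space \<Rightarrow> real"
  assumes "continuous_on UNIV h" "f \<in> Cc" "\<And>x. f x = 0 \<Longrightarrow> h x = 0"
  shows "h \<in> Cc"
  using assms by (metis CcE CcI)

lemma Cc_support_subset2:
  fixes h :: "'a::t2_space \<Rightarrow> real"
  assumes "continuous_on UNIV h" "f \<in> Cc" "g \<in> Cc" "\<And>x. f x = 0 \<Longrightarrow> g x = 0 \<Longrightarrow> h x = 0"
  shows "h \<in> Cc"
proof -
  obtain S T where "compact S" "\<And>x. x \<notin> S \<Longrightarrow> f x = 0" "compact T" "\<And>x. x \<notin> T \<Longrightarrow> g x = 0"
    using assms CcE by metis
  then show ?thesis
    using assms by (intro CcI[of h "S \<union> T"]) (auto intro: compact_Un)
qed

named_theorems Cc_intros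

lemma Cc_zero [Cc_intros]: "(\<lambda>x::'a::t2_space. 0) \<in> Cc"
  by (rule CcI[of _ "{}"]) auto

lemma Cc_add [Cc_intros]:
  fixes f :: "'a::t2_space \<Rightarrow> real"
  shows "f \<in> Cc \<Longrightarrow> g \<in> Cc \<Longrightarrow> (\<lambda>x. f x + g x) \<in> Cc"
  by (rule Cc_support_subset2[of _ f g]) (auto intro!: continuous_intros dest: Cc_continuous)

lemma Cc_diff [Cc_intros]:
  fixes f :: "'a::t2_space \<Rightarrow> real"
  shows "f \<in> Cc \<Longrightarrow> g \<in> Cc \<Longrightarrow> (\<lambda>x. f x - g x) \<in> Cc"
  by (rule Cc_support_subset2[of _ f g]) (auto intro!: continuous_intros dest: Cc_continuous)

lemma Cc_max [Cc_intros]: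
  fixes f :: "'a::t2_space \<Rightarrow> real"
  shows "f \<in> Cc \<Longrightarrow> g \<in> Cc \<Longrightarrow> (\<lambda>x. max (f x) (g x)) \<in> Cc"
  by (rule Cc_support_subset2[of _ f g]) (auto intro!: continuous_intros dest: Cc_continuous)

lemma Cc_min [Cc_intros]:
  fixes f :: "'a::t2_space \<Rightarrow> real"
  shows "f \<in> Cc \<Longrightarrow> g \<in> Cc \<Longrightarrow> (\<lambda>x. min (f x) (g x)) \<in> Cc"
  by (rule Cc_support_subset2[of _ f g]) (auto intro!: continuous_intros dest: Cc_continuous)

lemma Cc_mult_continuous [Cc_intros]:
  fixes f :: "'a::t2_space \<Rightarrow> real"
  shows "f \<in> Cc \<Longrightarrow> continuous_on UNIV g \<Longrightarrow> (\<lambda>x. f x * g x) \<in> Cc"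
  by (rule Cc_support_subset[of _ f]) (auto intro!: continuous_intros dest: Cc_continuous)

lemma Cc_cmult [Cc_intros]:
  fixes f :: "'a::t2_space \<Rightarrow> real"
  shows "f \<in> Cc \<Longrightarrow> (\<lambda>x. c * f x) \<in> Cc"
  by (rule Cc_support_subset[of _ f]) (auto intro!: continuous_intros dest: Cc_continuous)

lemma Cc_sum [Cc_intros]:
  fixes f :: "'i \<Rightarrow> 'a::t2_space \<Rightarrow> real"
  assumes "\<And>i. i \<in> I \<Longrightarrow> f i \<in> Cc"
  shows "(\<lambda>x. \<Sum>i\<in>I. f i x) \<in> Cc"
  using assms by (induction I rule: infinite_finite_induct) (auto intro: Cc_intros)

lemma Cc_subset_Cb: "(Cc :: ('a::t2_space \<Rightarrow> real) set) \<subseteq> Cb"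
proof
  fix f :: "'a \<Rightarrow> real" assume f: "f \<in> Cc"
  obtain S where S: "compact S" "\<And>x. x \<notin> S \<Longrightarrow> f x = 0"
    using CcE[OF f] by blast
  have "compact (f ` S)"
    using Cc_continuous[OF f] S(1) by (meson compact_continuous_image continuous_on_subset subset_UNIV)
  moreover have "range f \<subseteq> insert 0 (f ` S)"
    using S(2) by auto
  ultimately have "bounded (range f)"
    by (meson bounded_insert bounded_subset compact_imp_bounded)
  then show "f \<in> Cb"
    using Cc_continuous[OF f] by (simp add: Cb_def)
qed

lemma Cb_bound:
  assumes "f \<in> Cb"
  obtains C where "0 < C" "\<And>x. \<bar>f x\<bar> \<le> C"
  using assms unfolding Cb_def bounded_pos by auto

lemma Cb_borel: "f \<in> Cb \<Longrightarrow> f \<in> borel_measurable borel"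
  unfolding Cb_def by (auto intro: borel_measurable_continuous_onI)

lemma Cc_borel:
  fixes f :: "'a::t2_space \<Rightarrow> real"
  shows "f \<in> Cc \<Longrightarrow> f \<in> borel_measurable borel"
  using Cc_subset_Cb Cb_borel by blast

text \<open>Each point of \<open>U\<close> is the centre of a ball inside \<open>U\<close> whose closed ball is compact, and by the
  Lindeloef property countably many of these balls cover \<open>U\<close>. Truncating \<open>k\<close> times the sum of the first \<open>k\<close>
  tent functions over these balls at height 1 gives a sequence that not only increases to the
  indicator of \<open>U\<close> but also reaches it on every compact part of \<open>U\<close> after finitely many steps. Reaching the
  value 1 exactly matters below, where half-open regions under these functions have to exhaust a cylinder.\<close>
lemma open_Cc_exhaustion:
  fixes U :: "'a::{metric_space, second_countable_topology} set"
  assumes loc: "locally compact (UNIV :: 'a set)" and U: "open U"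
  obtains \<phi> :: "nat \<Rightarrow> 'a \<Rightarrow> real" where
    "\<And>k. \<phi> k \<in> Cc" "\<And>k x. 0 \<le> \<phi> k x" "\<And>k x. \<phi> k x \<le> 1" "\<And>x. incseq (\<lambda>k. \<phi> k x)"
    "\<And>k x. x \<notin> U \<Longrightarrow> \<phi> k x = 0"
    "\<And>S. compact S \<Longrightarrow> S \<subseteq> U \<Longrightarrow> \<exists>k. \<forall>x\<in>S. \<phi> k x = 1"
proof (cases "U = {}")
  case True
  then show ?thesis
    by (intro that[of "\<lambda>k x. 0"]) (auto intro: Cc_intros simp: incseq_def)
next
  case False
  have "\<exists>r>0. compact (cball x r) \<and> ball x r \<subseteq> U" if "x \<in> U" for x
  proof -
    obtain V K where VK: "open V" "compact K" "x \<in> V" "V \<subseteq> K"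
      using locallyE[OF loc, of UNIV x] by auto
    have "open (V \<inter> U)" "x \<in> V \<inter> U"
      using VK U that by auto
    then obtain r where r: "r > 0" "cball x r \<subseteq> V \<inter> U"
      unfolding open_contains_cball by blast
    then have "compact (cball x r)"
      using VK closed_Int_compact[of "cball x r" K] by (auto simp: Int_absorb2)
    then show ?thesis
      using r ball_subset_cball[of x r] by blast
  qed
  then obtain r where r: "\<And>x. x \<in> U \<Longrightarrow> r x > 0" "\<And>x. x \<in> U \<Longrightarrow> compact (cball x (r x))"
      "\<And>x. x \<in> U \<Longrightarrow> ball x (r x) \<subseteq> U"
    by metis
  obtain \<F>' where F: "\<F>' \<subseteq> (\<lambda>x. ball x (r x)) ` U" "countable \<F>'" "\<Union>\<F>' = \<Union>((\<lambda>x. ball x (r x)) ` U)"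
    using Lindelof[of "(\<lambda>x. ball x (r x)) ` U"] by blast
  obtain C0 where C0: "countable C0" "C0 \<subseteq> U" "\<F>' = (\<lambda>x. ball x (r x)) ` C0"
    using F(1,2) by (meson countable_subset_image)
  have cov: "\<exists>c\<in>C0. x \<in> ball c (r c)" if x: "x \<in> U" for x
  proof -
    have "x \<in> ball x (r x)"
      using r(1)[OF x] by simp
    then have "x \<in> \<Union>\<F>'"
      unfolding F(3) using x by blast
    then show ?thesis
      unfolding C0(3) by blast
  qed
  have "C0 \<noteq> {}"
    using cov False by auto
  define c where "c = from_nat_into C0"
  have c: "c i \<in> U" for i
    using C0(2) from_nat_into[OF \<open>C0 \<noteq> {}\<close>, of i] unfolding c_def by blast
  have c_cov: "\<exists>i. x \<in> ball (c i) (r (c i))" if x: "x \<in> U" for x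
  proof -
    obtain a where a: "a \<in> C0" "x \<in> ball a (r a)"
      using cov[OF x] by blast
    then show ?thesis
      using from_nat_into_to_nat_on[OF C0(1) a(1)] unfolding c_def by metis
  qed
  define b where "b i y = max 0 (1 - dist (c i) y / r (c i))" for i y
  have b0: "0 \<le> b i y" for i y
    by (simp add: b_def)
  have bpos: "0 < b i y \<longleftrightarrow> y \<in> ball (c i) (r (c i))" for i y
    using r(1)[OF c[of i]] by (auto simp: b_def field_simps less_max_iff_disj)
  have bCc: "b i \<in> Cc" for i
  proof (rule CcI[of _ "cball (c i) (r (c i))"])
    show "continuous_on UNIV (b i)"
      using r(1)[OF c[of i]] unfolding b_def by (intro continuous_intros) auto
    show "compact (cball (c i) (r (c i)))"
      using r(2) c by blast
    show "y \<in> cball (c i) (r (c i))" if "b i y \<noteq> 0" for y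
      using that bpos[of i y] b0[of i y] by auto
  qed
  define \<psi> where "\<psi> k y = real k * (\<Sum>i<k. b i y)" for k y
  have \<psi>0: "0 \<le> \<psi> k y" for k y
    unfolding \<psi>_def by (intro mult_nonneg_nonneg sum_nonneg b0) auto
  have \<psi>mono: "\<psi> k y \<le> \<psi> l y" if "k \<le> l" for k l y
    unfolding \<psi>_def using that by (intro mult_mono sum_mono2 sum_nonneg b0) auto
  have \<psi>Cc: "\<psi> k \<in> Cc" for k
    unfolding \<psi>_def by (intro Cc_intros bCc)
  have \<psi>out: "\<psi> k y = 0" if "y \<notin> U" for k y
  proof -
    have "b i y = 0" for i
      using that r(3)[OF c[of i]] bpos[of i y] b0[of i y] by force
    then show ?thesis by (simp add: \<psi>_def)
  qed
  have \<psi>big: "\<exists>k. 1 < \<psi> k y" if y: "y \<in> U" for y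
  proof -
    obtain i where i: "0 < b i y"
      using c_cov[OF y] bpos by blast
    obtain N where N: "1 / b i y < real N"
      using reals_Archimedean2 by blast
    define k where "k = max N (Suc i)"
    have "1 < real N * b i y"
      using N i by (simp add: field_simps)
    also have "\<dots> \<le> real k * b i y"
      using i by (intro mult_right_mono) (auto simp: k_def)
    also have "\<dots> \<le> \<psi> k y"
      unfolding \<psi>_def using b0
      by (intro mult_left_mono member_le_sum) (auto simp: k_def)
    finally show ?thesis ..
  qed
  show ?thesis
  proof (rule that[of "\<lambda>k y. min 1 (\<psi> k y)"])
    show "(\<lambda>y. min 1 (\<psi> k y)) \<in> Cc" for k
    proof (rule Cc_support_subset[OF _ \<psi>Cc[of k]])
      show "continuous_on UNIV (\<lambda>y. min 1 (\<psi> k y))"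
        by (intro continuous_intros Cc_continuous \<psi>Cc)
    qed simp
    show "0 \<le> min 1 (\<psi> k x)" "min 1 (\<psi> k x) \<le> 1" for k x
      using \<psi>0[of k x] by auto
    show "incseq (\<lambda>k. min 1 (\<psi> k x))" for x
      unfolding incseq_def by (intro allI impI min.mono \<psi>mono) auto
    show "min 1 (\<psi> k x) = 0" if "x \<notin> U" for k x
      using \<psi>out[OF that] by simp
    show "\<exists>k. \<forall>x\<in>S. min 1 (\<psi> k x) = 1" if S: "compact S" "S \<subseteq> U" for S
    proof -
      have op: "open {y. 1 < \<psi> k y}" for k
        using Cc_continuous[OF \<psi>Cc[of k]] by (intro open_Collect_less) auto
      have "S \<subseteq> (\<Union>k\<in>UNIV. {y. 1 < \<psi> k y})"
        using \<psi>big S by blast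
      then obtain C' where C': "finite C'" "S \<subseteq> (\<Union>k\<in>C'. {y. 1 < \<psi> k y})"
        using compactE_image[OF S(1), of UNIV "\<lambda>k. {y. 1 < \<psi> k y}"] op by metis
      have "min 1 (\<psi> (Max C') x) = 1" if "x \<in> S" for x
      proof -
        obtain k where "k \<in> C'" "1 < \<psi> k x"
          using C'(2) \<open>x \<in> S\<close> by auto
        then have "1 < \<psi> (Max C') x"
          using \<psi>mono[of k "Max C'" x] C'(1) by (meson Max_ge less_le_trans)
        then show ?thesis by simp
      qed
      then show ?thesis by blast
    qed
  qed
qed

lemma Cc_cutoff:
  fixes S :: "'a::{metric_space, second_countable_topology} set"
  assumes "locally compact (UNIV :: 'a set)" "compact S"
  obtains g :: "'a \<Rightarrow> real" where
    "g \<in> Cc" "\<And>x. 0 \<le> g x" "\<And>x. g x \<le> 1" "\<And>x. x \<in> S \<Longrightarrow> g x = 1"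
proof -
  obtain \<phi> :: "nat \<Rightarrow> 'a \<Rightarrow> real" where \<phi>: "\<And>k. \<phi> k \<in> Cc" "\<And>k x. 0 \<le> \<phi> k x" "\<And>k x. \<phi> k x \<le> 1"
    "\<And>S. compact S \<Longrightarrow> S \<subseteq> UNIV \<Longrightarrow> \<exists>k. \<forall>x\<in>S. \<phi> k x = 1"
    by (rule open_Cc_exhaustion[OF assms(1) open_UNIV]) blast
  obtain k where "\<forall>x\<in>S. \<phi> k x = 1"
    using \<phi>(4)[OF assms(2)] by auto
  then show ?thesis
    using \<phi>(1-3) by (intro that[of "\<phi> k"]) auto
qed

text \<open>Dini's theorem. The supports stay inside the compact support of the first function.\<close>
lemma Cc_Dini:
  fixes h :: "nat \<Rightarrow> 'a::t2_space \<Rightarrow> real"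
  assumes h: "\<And>n. h n \<in> Cc" and dec: "\<And>x. decseq (\<lambda>n. h n x)"
    and lim: "\<And>x. (\<lambda>n. h n x) \<longlonglongrightarrow> 0" and "0 < \<epsilon>"
  shows "\<exists>N. \<forall>n\<ge>N. \<forall>x. h n x < \<epsilon>"
proof -
  obtain S where S: "compact S" "\<And>x. x \<notin> S \<Longrightarrow> h 0 x = 0"
    using CcE[OF h[of 0]] by blast
  have op: "open {x. h n x < \<epsilon>}" for n
    using Cc_continuous[OF h[of n]] by (intro open_Collect_less) auto
  have ex: "\<exists>n. h n x < \<epsilon>" for x
    using order_tendstoD(2)[OF lim \<open>0 < \<epsilon>\<close>, of x] by (auto simp: eventually_sequentially)
  then have "S \<subseteq> (\<Union>n\<in>UNIV. {x. h n x < \<epsilon>})" by blast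
  then obtain C where C: "finite C" "S \<subseteq> (\<Union>n\<in>C. {x. h n x < \<epsilon>})"
    using compactE_image[OF S(1), of UNIV "\<lambda>n. {x. h n x < \<epsilon>}"] op by metis
  have "h n x < \<epsilon>" if "n \<ge> Max (insert 0 C)" for n x
  proof (cases "x \<in> S")
    case True
    then obtain k where "k \<in> C" "h k x < \<epsilon>"
      using C by auto
    moreover have "k \<le> n"
      using that C(1) \<open>k \<in> C\<close> by (meson Max_ge finite_insert insertI2 le_trans)
    ultimately show ?thesis
      using dec[of x] unfolding decseq_def by (meson le_less_trans)
  next
    case False
    then have "h n x \<le> 0"
      using dec[of x] S(2) unfolding decseq_def by (metis le0)
    then show ?thesis using \<open>0 < \<epsilon>\<close> by simp
  qed
  then show ?thesis by blast
qed

section \<open>The Riesz representation theorem\<close>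

definition positive_Cc_functional :: "(('a::topological_space \<Rightarrow> real) \<Rightarrow> real) \<Rightarrow> bool" where
  "positive_Cc_functional \<Lambda> \<longleftrightarrow>
     (\<forall>f\<in>Cc. \<forall>g\<in>Cc. \<Lambda> (\<lambda>x. f x + g x) = \<Lambda> f + \<Lambda> g) \<and>
     (\<forall>f\<in>Cc. \<forall>c. \<Lambda> (\<lambda>x. c * f x) = c * \<Lambda> f) \<and>
     (\<forall>f\<in>Cc. (\<forall>x. 0 \<le> f x) \<longrightarrow> 0 \<le> \<Lambda> f)"

context
  fixes \<Lambda> :: "('a::t2_space \<Rightarrow> real) \<Rightarrow> real"
  assumes \<Lambda>: "positive_Cc_functional \<Lambda>"
begin

lemma functional_add: "f \<in> Cc \<Longrightarrow> g \<in> Cc \<Longrightarrow> \<Lambda> (\<lambda>x. f x + g x) = \<Lambda> f + \<Lambda> g"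
  using \<Lambda> by (auto simp: positive_Cc_functional_def)

lemma functional_cmult: "f \<in> Cc \<Longrightarrow> \<Lambda> (\<lambda>x. c * f x) = c * \<Lambda> f"
  using \<Lambda> by (auto simp: positive_Cc_functional_def)

lemma functional_nonneg: "f \<in> Cc \<Longrightarrow> (\<And>x. 0 \<le> f x) \<Longrightarrow> 0 \<le> \<Lambda> f"
  using \<Lambda> by (auto simp: positive_Cc_functional_def)

lemma functional_zero: "\<Lambda> (\<lambda>x. 0) = 0"
  using functional_cmult[OF Cc_zero, of 0] by simp

lemma functional_diff:
  assumes "f \<in> Cc" "g \<in> Cc" shows "\<Lambda> (\<lambda>x. f x - g x) = \<Lambda> f - \<Lambda> g"
  using functional_add[OF Cc_diff[OF assms] assms(2)] by simp

lemma functional_mono: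
  assumes "f \<in> Cc" "g \<in> Cc" "\<And>x. f x \<le> g x" shows "\<Lambda> f \<le> \<Lambda> g"
  using functional_nonneg[OF Cc_diff[OF assms(2,1)]] functional_diff[OF assms(2,1)] assms(3) by simp

lemma functional_sum:
  assumes "\<And>i. i \<in> I \<Longrightarrow> f i \<in> Cc"
  shows "\<Lambda> (\<lambda>x. \<Sum>i\<in>I. f i x) = (\<Sum>i\<in>I. \<Lambda> (f i))"
  using assms
proof (induction I rule: infinite_finite_induct)
  case (insert i I)
  then show ?case
    using functional_add[of "f i" "\<lambda>x. \<Sum>i\<in>I. f i x"] by (simp add: Cc_sum)
qed (simp_all add: functional_zero)

end

text \<open>Monotone continuity of a positive functional. By Dini's theorem the convergence is uniform, and a
  cutoff function that is 1 on the common support turns uniform smallness into smallness of the functional.\<close>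
lemma functional_Daniell:
  fixes \<Lambda> :: "('a::{metric_space, second_countable_topology} \<Rightarrow> real) \<Rightarrow> real"
  assumes loc: "locally compact (UNIV :: 'a set)" and \<Lambda>: "positive_Cc_functional \<Lambda>"
    and h: "\<And>n. h n \<in> Cc" and dec: "\<And>x. decseq (\<lambda>n. h n x)"
    and lim: "\<And>x. (\<lambda>n. h n x) \<longlonglongrightarrow> 0"
  shows "(\<lambda>n. \<Lambda> (h n)) \<longlonglongrightarrow> 0"
proof -
  obtain S where S: "compact S" "\<And>x. x \<notin> S \<Longrightarrow> h 0 x = 0"
    using CcE[OF h[of 0]] by blast
  obtain g :: "'a \<Rightarrow> real" where g: "g \<in> Cc" "\<And>x. 0 \<le> g x" "\<And>x. x \<in> S \<Longrightarrow> g x = 1"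
    using Cc_cutoff[OF loc S(1)] by metis
  have h0: "0 \<le> h n x" for n x
    using decseq_ge[OF dec lim] .
  have hS: "h n x = 0" if "x \<notin> S" for n x
    using that S(2)[of x] h0[of n x] dec[of x] unfolding decseq_def by (metis le0 order_antisym)
  show ?thesis
  proof (rule LIMSEQ_I)
    fix e :: real assume "0 < e"
    define \<epsilon> where "\<epsilon> = e / (2 * (\<Lambda> g + 1))"
    have g0: "0 \<le> \<Lambda> g"
      using functional_nonneg[OF \<Lambda> g(1,2)] .
    then have "0 < \<epsilon>" using \<open>0 < e\<close> by (simp add: \<epsilon>_def)
    then obtain N where N: "\<And>n x. n \<ge> N \<Longrightarrow> h n x < \<epsilon>"
      using Cc_Dini[OF h dec lim] by blast
    have "norm (\<Lambda> (h n) - 0) < e" if "n \<ge> N" for n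
    proof -
      have "\<Lambda> (h n) \<le> \<Lambda> (\<lambda>x. \<epsilon> * g x)"
      proof (rule functional_mono[OF \<Lambda> h Cc_cmult[OF g(1)]])
        show "h n x \<le> \<epsilon> * g x" for x
          using N[OF that, of x] hS[of x n] g(2,3)[of x] \<open>0 < \<epsilon>\<close> by (cases "x \<in> S") auto
      qed
      also have "\<dots> = \<epsilon> * \<Lambda> g"
        using functional_cmult[OF \<Lambda> g(1)] .
      also have "\<dots> < e"
        using g0 \<open>0 < e\<close> by (simp add: \<epsilon>_def divide_simps)
      finally show ?thesis
        using functional_nonneg[OF \<Lambda> h h0, of n] by simp
    qed
    then show "\<exists>N. \<forall>n\<ge>N. norm (\<Lambda> (h n) - 0) < e" by blast
  qed
qed

text \<open>The half-open region between two graphs. Its natural measure is \<open>\<Lambda> (g - f)\<close>, and these regions,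
  unlike the sets on which a test function exceeds a level, form a semiring. That is why the measure
  representing \<open>\<Lambda>\<close> is first built on the product with the real line.\<close>
definition region_between :: "('a \<Rightarrow> real) \<times> ('a \<Rightarrow> real) \<Rightarrow> ('a \<times> real) set" where
  "region_between fg = {(x, t). fst fg x \<le> t \<and> t < snd fg x}"

definition Cc_regions :: "(('a::topological_space \<Rightarrow> real) \<times> ('a \<Rightarrow> real)) set" where
  "Cc_regions = {(f, g). f \<in> Cc \<and> g \<in> Cc \<and> (\<forall>x. f x \<le> g x)}"

lemma mem_region_between: "(x, t) \<in> region_between (f, g) \<longleftrightarrow> f x \<le> t \<and> t < g x"
  by (simp add: region_between_def)

lemma region_in_regions:
  "f \<in> Cc \<Longrightarrow> g \<in> Cc \<Longrightarrow> (\<And>x. f x \<le> g x) \<Longrightarrow> region_between (f, g) \<in> region_between ` Cc_regions"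
  by (auto simp: Cc_regions_def)

lemma semiring_regions:
  "semiring_of_sets UNIV (region_between ` (Cc_regions :: (('a::t2_space \<Rightarrow> real) \<times> _) set))"
proof
  show "region_between ` (Cc_regions :: (('a \<Rightarrow> real) \<times> _) set) \<subseteq> Pow UNIV" by simp
  have "region_between ((\<lambda>x. 0) :: 'a \<Rightarrow> real, \<lambda>x. 0) \<in> region_between ` Cc_regions"
    by (intro region_in_regions Cc_intros) auto
  moreover have "region_between ((\<lambda>x. 0) :: 'a \<Rightarrow> real, \<lambda>x. 0) = {}"
    by (auto simp: region_between_def)
  ultimately show "{} \<in> region_between ` (Cc_regions :: (('a \<Rightarrow> real) \<times> _) set)"
    by simp
next
  fix a b :: "('a \<times> real) set"
  assume "a \<in> region_between ` Cc_regions" "b \<in> region_between ` Cc_regions"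
  then obtain f g f' g' where
    a: "f \<in> Cc" "g \<in> Cc" "\<And>x. f x \<le> g x" "a = region_between (f, g)" and
    b: "f' \<in> Cc" "g' \<in> Cc" "\<And>x. f' x \<le> g' x" "b = region_between (f', g')"
    by (auto simp: Cc_regions_def)
  have "a \<inter> b = region_between (\<lambda>x. max (f x) (f' x), \<lambda>x. max (max (f x) (f' x)) (min (g x) (g' x)))"
    unfolding a b by (auto simp: mem_region_between)
  also have "\<dots> \<in> region_between ` Cc_regions"
    by (intro region_in_regions Cc_intros a b) auto
  finally show "a \<inter> b \<in> region_between ` Cc_regions" .
  define c where "c = region_between (f, \<lambda>x. max (f x) (min (g x) (f' x)))"
  define d where "d = region_between (\<lambda>x. min (g x) (max (f x) (g' x)), g)"
  have "c \<in> region_between ` Cc_regions" "d \<in> region_between ` Cc_regions"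
    unfolding c_def d_def by (intro region_in_regions Cc_intros a b; simp)+
  moreover have "c \<inter> d = {}"
  proof -
    have False if "(x, t) \<in> c" "(x, t) \<in> d" for x t
      using that a(3)[of x] b(3)[of x] unfolding c_def d_def mem_region_between
      by (auto simp: min_def max_def split: if_splits)
    then show ?thesis by auto
  qed
  moreover have "a - b = \<Union>{c, d}"
    using a(3) b(3) unfolding a b c_def d_def by (fastforce simp: mem_region_between)
  ultimately show "\<exists>C\<subseteq>region_between ` Cc_regions. finite C \<and> disjoint C \<and> a - b = \<Union>C"
    by (intro exI[of _ "{c, d}"]) (auto simp: disjoint_def)
qed

text \<open>Over a fixed point the regions are disjoint half-open intervals, so their lengths add up by
  countable additivity of Lebesgue measure.\<close>
lemma region_fibre_lengths_sums:
  assumes "\<And>n. f n x \<le> g n x" "F x \<le> G x"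
    and disj: "disjoint_family (\<lambda>n::nat. region_between (f n, g n))"
    and un: "(\<Union>n. region_between (f n, g n)) = region_between (F, G)"
  shows "(\<lambda>n. g n x - f n x) sums (G x - F x)"
proof -
  have "(\<Sum>n. emeasure lborel {f n x..<g n x}) = emeasure lborel (\<Union>n. {f n x..<g n x})"
  proof (rule suminf_emeasure)
    show "disjoint_family (\<lambda>n. {f n x..<g n x})"
      using disj unfolding disjoint_family_on_def
      by (auto simp: set_eq_iff mem_region_between)
  qed auto
  also have "(\<Union>n. {f n x..<g n x}) = {F x..<G x}"
    using un by (auto simp: set_eq_iff mem_region_between)
  finally have eq: "(\<Sum>n. ennreal (g n x - f n x)) = ennreal (G x - F x)"
    using assms by simp
  have "summable (\<lambda>n. g n x - f n x)"
    using assms eq by (intro summable_suminf_not_top) auto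
  moreover from this have "(\<Sum>n. g n x - f n x) = G x - F x"
    using suminf_ennreal2[of "\<lambda>n. g n x - f n x"] eq assms
    by (metis (no_types, lifting) diff_ge_0_iff_ge ennreal_inj suminf_nonneg)
  ultimately show ?thesis
    by (simp add: sums_iff)
qed

text \<open>Caratheodory's extension theorem. Countable additivity on the semiring of regions reduces, by the
  fibrewise identity, to a sequence of test functions decreasing to 0, on which \<open>\<Lambda>\<close> is continuous.\<close>
lemma region_measure_exists:
  fixes \<Lambda> :: "('a::{metric_space, second_countable_topology} \<Rightarrow> real) \<Rightarrow> real"
  assumes loc: "locally compact (UNIV :: 'a set)" and \<Lambda>: "positive_Cc_functional \<Lambda>"
  obtains M :: "('a \<times> real) measure" where
    "space M = UNIV"
    "\<And>f g. f \<in> Cc \<Longrightarrow> g \<in> Cc \<Longrightarrow> (\<And>x. f x \<le> g x) \<Longrightarrow> region_between (f, g) \<in> sets M"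
    "\<And>f g. f \<in> Cc \<Longrightarrow> g \<in> Cc \<Longrightarrow> (\<And>x. f x \<le> g x) \<Longrightarrow>
      emeasure M (region_between (f, g)) = ennreal (\<Lambda> g - \<Lambda> f)"
proof -
  define \<mu> where "\<mu> = (\<lambda>fg :: ('a \<Rightarrow> real) \<times> ('a \<Rightarrow> real). ennreal (\<Lambda> (snd fg) - \<Lambda> (fst fg)))"
  define M where "M = extend_measure UNIV Cc_regions region_between \<mu>"
  have add: "(\<Sum>n. \<mu> (A n)) = \<mu> j"
    if A: "A \<in> UNIV \<rightarrow> Cc_regions" "j \<in> Cc_regions" "disjoint_family (region_between \<circ> A)"
      "(\<Union>i. region_between (A i)) = region_between j" for A :: "nat \<Rightarrow> _" and j
  proof -
    define f g F G where defs: "f = (\<lambda>n. fst (A n))" "g = (\<lambda>n. snd (A n))" "F = fst j" "G = snd j"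
    have Aeq: "A = (\<lambda>n. (f n, g n))" "j = (F, G)"
      by (auto simp: defs)
    have Cc: "f n \<in> Cc" "g n \<in> Cc" "F \<in> Cc" "G \<in> Cc" and le: "f n x \<le> g n x" "F x \<le> G x" for n x
      using A(1,2) unfolding Aeq by (auto simp: Cc_regions_def Pi_iff)
    have sums: "(\<lambda>n. g n x - f n x) sums (G x - F x)" for x
      using A(3,4) le unfolding Aeq comp_def by (intro region_fibre_lengths_sums) auto
    define h where "h n = (\<lambda>x. (G x - F x) - (\<Sum>i<n. g i x - f i x))" for n
    have hCc: "h n \<in> Cc" for n
      unfolding h_def by (intro Cc_intros Cc)
    have "(\<lambda>n. \<Lambda> (h n)) \<longlonglongrightarrow> 0"
    proof (rule functional_Daniell[OF loc \<Lambda> hCc])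
      show "decseq (\<lambda>n. h n x)" for x
        using le by (auto simp: decseq_Suc_iff h_def)
      show "(\<lambda>n. h n x) \<longlonglongrightarrow> 0" for x
        using tendsto_diff[OF tendsto_const sums[of x, unfolded sums_def], of "G x - F x"]
        by (simp add: h_def)
    qed
    moreover have "\<Lambda> (h n) = (\<Lambda> G - \<Lambda> F) - (\<Sum>i<n. \<Lambda> (g i) - \<Lambda> (f i))" for n
      unfolding h_def
      by (subst functional_diff[OF \<Lambda>] functional_sum[OF \<Lambda>]; (intro Cc_intros Cc)?)+ simp
    ultimately have "(\<lambda>n. (\<Lambda> G - \<Lambda> F) - (\<Sum>i<n. \<Lambda> (g i) - \<Lambda> (f i))) \<longlonglongrightarrow> 0"
      by simp
    from tendsto_diff[OF tendsto_const this, of "\<Lambda> G - \<Lambda> F"]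
    have "(\<lambda>i. \<Lambda> (g i) - \<Lambda> (f i)) sums (\<Lambda> G - \<Lambda> F)"
      by (simp add: sums_def)
    moreover have "0 \<le> \<Lambda> (g i) - \<Lambda> (f i)" for i
      using functional_mono[OF \<Lambda> Cc(1,2) le(1)] by simp
    ultimately show ?thesis
      unfolding \<mu>_def Aeq fst_conv snd_conv by (intro suminf_ennreal_eq)
  qed
  have em: "emeasure M (region_between i) = \<mu> i" if "i \<in> Cc_regions" for i
  proof (rule extend_measure_caratheodory[OF M_def that semiring_regions])
    have fibre: "g x = f x" if "(f, g) \<in> Cc_regions" "region_between (f, g) = {}" for f g and x :: 'a
    proof -
      have "f x \<le> g x"
        using that(1) by (auto simp: Cc_regions_def)
      moreover have "\<not> f x < g x"
        using that(2) mem_region_between[of x "f x" f g] by simp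
      ultimately show ?thesis by simp
    qed
    show emp: "\<mu> i = 0" if "i \<in> Cc_regions" "region_between i = {}" for i
    proof -
      obtain f g where i: "i = (f, g)" by fastforce
      have "g = f"
        using fibre[of f g] that unfolding i by blast
      then show ?thesis by (simp add: i \<mu>_def)
    qed
    show "\<mu> i = \<mu> j" if ij: "i \<in> Cc_regions" "j \<in> Cc_regions" "region_between i = region_between j" for i j
    proof -
      define z :: "('a \<Rightarrow> real) \<times> ('a \<Rightarrow> real)" where "z = (\<lambda>x. 0, \<lambda>x. 0)"
      have z: "z \<in> Cc_regions" "region_between z = {}"
        by (auto simp: z_def Cc_regions_def region_between_def intro: Cc_intros)
      \<comment> \<open>Well-definedness is additivity applied to the first region padded with empty ones.\<close>
      have "(\<Sum>n. \<mu> (if n = 0 then i else z)) = \<mu> j"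
      proof (rule add)
        show "disjoint_family (region_between \<circ> (\<lambda>n::nat. if n = 0 then i else z))"
          using z by (auto simp: disjoint_family_on_def)
        show "(\<Union>n::nat. region_between (if n = 0 then i else z)) = region_between j"
          using z ij by (auto split: if_splits)
      qed (use z ij in auto)
      also have "(\<Sum>n. \<mu> (if n = 0 then i else z)) = \<mu> i"
        using emp[OF z] by (subst suminf_finite[of "{0}"]) auto
      finally show ?thesis .
    qed
  qed (use add in auto)
  have "sets M = sigma_sets UNIV (region_between ` Cc_regions)" "space M = UNIV"
    unfolding M_def by (rule sets_extend_measure space_extend_measure; simp)+
  then show ?thesis
    using em[of "(f, g)" for f g] 
    by (intro that[of M]) (auto simp: \<mu>_def Cc_regions_def intro!: sigma_sets.Basic)
qed

text \<open>The measure of \<open>A\<close> is the product measure of the cylinder \<open>A \<times> [0, 1)\<close>. Cylinders over open sets are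
  countable unions of regions under test functions, so all Borel cylinders are measurable; comparing
  a cylinder with the region under \<open>f\<close> gives both inequalities.\<close>
lemma functional_representing_measure:
  fixes \<Lambda> :: "('a::{metric_space, second_countable_topology} \<Rightarrow> real) \<Rightarrow> real"
  assumes loc: "locally compact (UNIV :: 'a set)" and \<Lambda>: "positive_Cc_functional \<Lambda>"
  obtains \<mu> :: "'a measure" where "sets \<mu> = sets borel"
    "\<And>f A. f \<in> Cc \<Longrightarrow> A \<in> sets borel \<Longrightarrow> (\<And>x. 0 \<le> f x) \<Longrightarrow> (\<And>x. f x \<le> indicator A x) \<Longrightarrow>
       ennreal (\<Lambda> f) \<le> emeasure \<mu> A"
    "\<And>f A. f \<in> Cc \<Longrightarrow> A \<in> sets borel \<Longrightarrow> (\<And>x. indicator A x \<le> f x) \<Longrightarrow> emeasure \<mu> A \<le> ennreal (\<Lambda> f)"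
proof -
  obtain M :: "('a \<times> real) measure" where M: "space M = UNIV"
    "\<And>f g. f \<in> Cc \<Longrightarrow> g \<in> Cc \<Longrightarrow> (\<And>x. f x \<le> g x) \<Longrightarrow> region_between (f, g) \<in> sets M"
    "\<And>f g. f \<in> Cc \<Longrightarrow> g \<in> Cc \<Longrightarrow> (\<And>x. f x \<le> g x) \<Longrightarrow>
      emeasure M (region_between (f, g)) = ennreal (\<Lambda> g - \<Lambda> f)"
    by (rule region_measure_exists[OF loc \<Lambda>]) blast
  have sub: "region_between (\<lambda>x. 0, f) \<in> sets M"
    "emeasure M (region_between (\<lambda>x. 0, f)) = ennreal (\<Lambda> f)" if "f \<in> Cc" "\<And>x. 0 \<le> f x" for f
    using M(2,3)[OF Cc_zero that] functional_zero[OF \<Lambda>] by auto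
  have open_cyl: "U \<times> {0..<1} \<in> sets M" if U: "open U" for U :: "'a set"
  proof -
    obtain \<phi> :: "nat \<Rightarrow> 'a \<Rightarrow> real" where \<phi>: "\<And>k. \<phi> k \<in> Cc" "\<And>k x. 0 \<le> \<phi> k x" "\<And>k x. \<phi> k x \<le> 1"
      "\<And>k x. x \<notin> U \<Longrightarrow> \<phi> k x = 0" "\<And>S. compact S \<Longrightarrow> S \<subseteq> U \<Longrightarrow> \<exists>k. \<forall>x\<in>S. \<phi> k x = 1"
      by (rule open_Cc_exhaustion[OF loc U]) blast
    have "U \<times> {0..<1} = (\<Union>k. region_between (\<lambda>x. 0, \<phi> k))"
    proof (intro equalityI subsetI)
      fix z assume z: "z \<in> U \<times> {0..<1::real}"
      obtain k where "\<phi> k (fst z) = 1"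
        using \<phi>(5)[of "{fst z}"] z by auto
      then show "z \<in> (\<Union>k. region_between (\<lambda>x. 0, \<phi> k))"
        using z by (auto simp: mem_region_between intro!: exI[of _ k])
    next
      fix z assume "z \<in> (\<Union>k. region_between (\<lambda>x. 0, \<phi> k))"
      then obtain k where k: "0 \<le> snd z" "snd z < \<phi> k (fst z)"
        by (auto simp: region_between_def)
      then have "fst z \<in> U"
        using \<phi>(4)[of "fst z" k] by force
      then show "z \<in> U \<times> {0..<1}"
        using k \<phi>(3)[of k "fst z"] by (cases z) auto
    qed
    also have "\<dots> \<in> sets M"
      using sub(1)[OF \<phi>(1,2)] by auto
    finally show ?thesis .
  qed
  define R where "R = restrict_space M (UNIV \<times> {0..<1})"
  have UNIV1: "UNIV \<times> {0..<1} \<in> sets M"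
    using open_cyl[OF open_UNIV] .
  have meas: "fst \<in> R \<rightarrow>\<^sub>M (borel :: 'a measure)"
  proof (rule borel_measurableI)
    fix U :: "'a set" assume "open U"
    have "fst -` U \<inter> space R = U \<times> {0..<1}"
      by (auto simp: R_def space_restrict_space M(1))
    then show "fst -` U \<inter> space R \<in> sets R"
      using open_cyl[OF \<open>open U\<close>] UNIV1 by (auto simp: R_def sets_restrict_space_iff M(1))
  qed
  define \<mu> where "\<mu> = distr R (borel :: 'a measure) fst"
  have em: "A \<times> {0..<1} \<in> sets M" "emeasure \<mu> A = emeasure M (A \<times> {0..<1})"
    if A: "A \<in> sets borel" for A
  proof -
    have eq: "fst -` A \<inter> space R = A \<times> {0..<1}"
      by (auto simp: R_def space_restrict_space M(1))
    have "A \<times> {0..<1} \<in> sets R"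
      using measurable_sets[OF meas A] eq by simp
    then show "A \<times> {0..<1} \<in> sets M"
      using UNIV1 by (simp add: R_def sets_restrict_space_iff M(1))
    have "emeasure \<mu> A = emeasure R (A \<times> {0..<1})"
      unfolding \<mu>_def using emeasure_distr[OF meas A] eq by simp
    also have "\<dots> = emeasure M (A \<times> {0..<1})"
      unfolding R_def using UNIV1 by (intro emeasure_restrict_space) (auto simp: M(1))
    finally show "emeasure \<mu> A = emeasure M (A \<times> {0..<1})" .
  qed
  show ?thesis
  proof (rule that[of \<mu>])
    show "sets \<mu> = sets borel" by (simp add: \<mu>_def)
    fix f :: "'a \<Rightarrow> real" and A assume f: "f \<in> Cc" and A: "A \<in> sets (borel :: 'a measure)"
    {
      assume f0: "\<And>x. 0 \<le> f x" and le: "\<And>x. f x \<le> indicator A x"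
      have "region_between (\<lambda>x. 0, f) \<subseteq> A \<times> {0..<1}"
      proof
        fix z assume z: "z \<in> region_between (\<lambda>x. 0, f)"
        then show "z \<in> A \<times> {0..<1}"
          using le[of "fst z"] by (cases z; cases "fst z \<in> A") (auto simp: mem_region_between)
      qed
      from emeasure_mono[OF this em(1)[OF A]] show "ennreal (\<Lambda> f) \<le> emeasure \<mu> A"
        unfolding em(2)[OF A] sub(2)[OF f f0] .
    }
    {
      assume le: "\<And>x. indicator A x \<le> f x"
      have f0: "0 \<le> f x" for x
        using le[of x] by (cases "x \<in> A") auto
      have "A \<times> {0..<1} \<subseteq> region_between (\<lambda>x. 0, f)"
      proof
        fix z assume z: "z \<in> A \<times> {0..<1::real}"
        then show "z \<in> region_between (\<lambda>x. 0, f)"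
          using le[of "fst z"] by (cases z; cases "fst z \<in> A") (auto simp: mem_region_between)
      qed
      from emeasure_mono[OF this sub(1)[OF f f0]] show "emeasure \<mu> A \<le> ennreal (\<Lambda> f)"
        unfolding em(2)[OF A] sub(2)[OF f f0] .
    }
  qed
qed

lemma radon_integrable_Cc:
  fixes f :: "'a::t2_space \<Rightarrow> real"
  assumes "radon_measure M" "f \<in> Cc"
  shows "integrable M f"
proof -
  have sets: "sets M = sets borel"
    using assms(1) by (simp add: radon_measure_def)
  obtain S where S: "compact S" "\<And>x. x \<notin> S \<Longrightarrow> f x = 0"
    using CcE[OF assms(2)] by blast
  obtain C where C: "\<And>x. \<bar>f x\<bar> \<le> C" "0 < C"
    using Cb_bound assms(2) Cc_subset_Cb by blast
  have S': "S \<in> sets M" "emeasure M S < \<infinity>"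
    using assms(1) S(1) unfolding radon_measure_def by (auto intro: borel_compact)
  show ?thesis
  proof (rule Bochner_Integration.integrable_bound)
    show "integrable M (\<lambda>x. C * indicator S x :: real)"
      using S' by (intro integrable_mult_right integrable_real_indicator) auto
    show "f \<in> borel_measurable M"
      using Cc_borel[OF assms(2)] measurable_cong_sets[OF sets refl] by blast
    show "AE x in M. norm (f x) \<le> norm (C * indicator S x :: real)"
      using C S(2) by (intro AE_I2) (auto simp: indicator_def)
  qed
qed

lemma layer_decomposition:
  fixes t :: real
  assumes "0 \<le> t" "t \<le> 1" "0 < N"
  shows "t = (\<Sum>j<N. min (1 / real N) (max 0 (t - real j / real N)))"
proof -
  have "(\<Sum>j<n. min (1 / real N) (max 0 (t - real j / real N))) = min t (real n / real N)" for n
  proof (induction n)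
    case 0
    then show ?case using assms by simp
  next
    case (Suc n)
    have "real (Suc n) / real N = real n / real N + 1 / real N"
      by (simp add: add_divide_distrib)
    moreover have "min t d + min c (max 0 (t - d)) = min t (d + c)" if "0 \<le> c" for c d
      using that assms by (auto simp: min_def max_def)
    ultimately show ?case
      using Suc by simp
  qed
  then show ?thesis using assms by simp
qed

lemma layer_bounds:
  fixes t :: real
  assumes "0 < N"
  shows "indicator {s. real (Suc j) / real N \<le> s} t \<le> real N * min (1 / real N) (max 0 (t - real j / real N))"
    and "real N * min (1 / real N) (max 0 (t - real j / real N)) \<le> indicator {s. real j / real N < s} t"
proof -
  have "real N * min (1 / real N) (max 0 (t - real j / real N)) = min 1 (max 0 (real N * t - real j))"
    using assms by (simp add: min_mult_distrib_left max_mult_distrib_left right_diff_distrib)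
  moreover have "real (Suc j) / real N \<le> t \<longleftrightarrow> real j + 1 \<le> real N * t" "real j / real N < t \<longleftrightarrow> real j < real N * t"
    using assms by (auto simp: field_simps)
  ultimately show "indicator {s. real (Suc j) / real N \<le> s} t \<le> real N * min (1 / real N) (max 0 (t - real j / real N))"
    and "real N * min (1 / real N) (max 0 (t - real j / real N)) \<le> indicator {s. real j / real N < s} t"
    by (auto simp: indicator_def)
qed

text \<open>Cut \<open>f\<close> into \<open>N\<close> horizontal layers. Both \<open>\<Lambda>\<close> and the integral of a layer lie between \<open>1/N\<close> times the
  measures of two consecutive superlevel sets of \<open>f\<close>; summing over the layers telescopes, so the two differ
  by at most \<open>1/N\<close> times the measure of the set where \<open>f\<close> is positive.\<close>
theorem Riesz_Cc:
  fixes \<Lambda> :: "('a::{metric_space, second_countable_topology} \<Rightarrow> real) \<Rightarrow> real"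
  assumes loc: "locally compact (UNIV :: 'a set)" and \<Lambda>: "positive_Cc_functional \<Lambda>"
  obtains \<mu> :: "'a measure" where "radon_measure \<mu>" "\<And>f. f \<in> Cc \<Longrightarrow> (\<integral>x. f x \<partial>\<mu>) = \<Lambda> f"
proof -
  obtain \<mu> :: "'a measure" where sets: "sets \<mu> = sets borel" and
    lower: "\<And>f A. f \<in> Cc \<Longrightarrow> A \<in> sets borel \<Longrightarrow> (\<And>x. 0 \<le> f x) \<Longrightarrow> (\<And>x. f x \<le> indicator A x) \<Longrightarrow>
       ennreal (\<Lambda> f) \<le> emeasure \<mu> A" and
    upper: "\<And>f A. f \<in> Cc \<Longrightarrow> A \<in> sets borel \<Longrightarrow> (\<And>x. indicator A x \<le> f x) \<Longrightarrow>
       emeasure \<mu> A \<le> ennreal (\<Lambda> f)"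
    by (rule functional_representing_measure[OF loc \<Lambda>]) blast
  have rad: "radon_measure \<mu>"
    unfolding radon_measure_def
  proof (intro conjI allI impI sets)
    fix S :: "'a set" assume S: "compact S"
    obtain g :: "'a \<Rightarrow> real" where g: "g \<in> Cc" "\<And>x. 0 \<le> g x" "\<And>x. x \<in> S \<Longrightarrow> g x = 1"
      using Cc_cutoff[OF loc S] by metis
    have "emeasure \<mu> S \<le> ennreal (\<Lambda> g)"
      using g S by (intro upper) (auto simp: indicator_def intro: borel_compact)
    then show "emeasure \<mu> S < \<infinity>"
      by (simp add: le_less_trans)
  qed
  have int: "integrable \<mu> f" if "f \<in> Cc" for f
    using radon_integrable_Cc[OF rad that] .
  have meas[measurable]: "f \<in> borel_measurable \<mu>" if "f \<in> Cc" for f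
    using int[OF that] by simp
  have unit: "\<Lambda> f = (\<integral>x. f x \<partial>\<mu>)" if f: "f \<in> Cc" and f01: "\<And>x. 0 \<le> f x" "\<And>x. f x \<le> 1" for f
  proof -
    obtain S where S: "compact S" "\<And>x. x \<notin> S \<Longrightarrow> f x = 0"
      using CcE[OF f] by blast
    define a where "a t = measure \<mu> {x. t < f x}" for t
    define b where "b t = measure \<mu> {x. t \<le> f x}" for t
    have fborel[measurable]: "f \<in> borel_measurable borel"
      using Cc_borel[OF f] .
    have setsab: "{x. t < f x} \<in> sets borel" "{x. t \<le> f x} \<in> sets borel" for t
      by measurable
    have fin: "emeasure \<mu> A \<noteq> \<infinity>" if "A \<subseteq> S" "A \<in> sets borel" for A
    proof -
      have "emeasure \<mu> A \<le> emeasure \<mu> S"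
        using that S(1) sets by (intro emeasure_mono) (auto intro: borel_compact)
      then show ?thesis
        using rad S(1) unfolding radon_measure_def by (metis infinity_ennreal_def less_top linorder_not_less)
    qed
    have subS: "{x. t < f x} \<subseteq> S" if "0 \<le> t" for t
      using S(2) that by force
    have subS': "{x. t \<le> f x} \<subseteq> S" if "0 < t" for t
      using S(2) that by force
    have bound: "\<bar>\<Lambda> f - (\<integral>x. f x \<partial>\<mu>)\<bar> \<le> a 0 / real N" if N: "0 < N" for N
    proof -
      define l where "l j x = min (1 / real N) (max 0 (f x - real j / real N))" for j x
      have lCc: "l j \<in> Cc" for j
      proof (rule Cc_support_subset[OF _ f])
        show "continuous_on UNIV (l j)"
          unfolding l_def by (intro continuous_intros Cc_continuous[OF f])
        show "l j x = 0" if "f x = 0" for x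
          using that by (simp add: l_def)
      qed
      have fl: "f = (\<lambda>x. \<Sum>j<N. l j x)"
        unfolding l_def using layer_decomposition[OF f01 N] by auto
      have l0: "0 \<le> l j x" for j x
        by (simp add: l_def)
      have lj: "indicator {x. real (Suc j) / real N \<le> f x} x \<le> real N * l j x"
        "real N * l j x \<le> indicator {x. real j / real N < f x} x" for j x
        using layer_bounds[OF N, where j = j and t = "f x"] by (auto simp: l_def indicator_def)
      have \<Lambda>lj: "b (real (Suc j) / real N) \<le> real N * \<Lambda> (l j)" "real N * \<Lambda> (l j) \<le> a (real j / real N)" for j
      proof -
        have "ennreal (\<Lambda> (\<lambda>x. real N * l j x)) \<le> emeasure \<mu> {x. real j / real N < f x}"
          using lj l0 by (intro lower Cc_cmult lCc setsab) auto
        also have "\<dots> = ennreal (a (real j / real N))"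
          unfolding a_def by (intro emeasure_eq_ennreal_measure) (use fin subS setsab in auto)
        finally show "real N * \<Lambda> (l j) \<le> a (real j / real N)"
          using functional_cmult[OF \<Lambda> lCc] by (simp add: a_def ennreal_le_iff)
        have "ennreal (b (real (Suc j) / real N)) = emeasure \<mu> {x. real (Suc j) / real N \<le> f x}"
          unfolding b_def by (intro emeasure_eq_ennreal_measure[symmetric]) (use fin subS' setsab N in auto)
        also have "\<dots> \<le> ennreal (\<Lambda> (\<lambda>x. real N * l j x))"
          using lj by (intro upper Cc_cmult lCc setsab) auto
        finally show "b (real (Suc j) / real N) \<le> real N * \<Lambda> (l j)"
          using functional_cmult[OF \<Lambda> lCc] functional_nonneg[OF \<Lambda> lCc l0]
          by (simp add: ennreal_le_iff)
      qed
      have Ilj: "b (real (Suc j) / real N) \<le> real N * (\<integral>x. l j x \<partial>\<mu>)"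
        "real N * (\<integral>x. l j x \<partial>\<mu>) \<le> a (real j / real N)" for j
      proof -
        have "a (real j / real N) = (\<integral>x. indicator {x. real j / real N < f x} x \<partial>\<mu>)"
          using sets by (simp add: a_def sets_eq_imp_space_eq[OF sets])
        also have "\<dots> \<ge> (\<integral>x. real N * l j x \<partial>\<mu>)"
          using lj(2) by (intro integral_mono int Cc_cmult lCc integrable_real_indicator)
            (use fin[OF subS setsab(1), of "real j / real N"] setsab sets in \<open>auto simp: less_top\<close>)
        finally show "real N * (\<integral>x. l j x \<partial>\<mu>) \<le> a (real j / real N)"
          by simp
        have "b (real (Suc j) / real N) = (\<integral>x. indicator {x. real (Suc j) / real N \<le> f x} x \<partial>\<mu>)"
          using sets by (simp add: b_def sets_eq_imp_space_eq[OF sets])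
        also have "\<dots> \<le> (\<integral>x. real N * l j x \<partial>\<mu>)"
          using lj(1) by (intro integral_mono int Cc_cmult lCc integrable_real_indicator)
            (use fin[OF subS' setsab(2), of "real (Suc j) / real N"] setsab sets N in \<open>auto simp: less_top\<close>)
        finally show "b (real (Suc j) / real N) \<le> real N * (\<integral>x. l j x \<partial>\<mu>)"
          by simp
      qed
      have ab: "a (real (Suc j) / real N) \<le> b (real (Suc j) / real N)" for j
      proof -
        have "{x. real (Suc j) / real N \<le> f x} \<in> fmeasurable \<mu>"
          using fin[OF subS' setsab(2), of "real (Suc j) / real N"] setsab sets N
          by (auto simp: fmeasurable_def less_top)
        then show ?thesis
          unfolding a_def b_def using setsab sets by (intro measure_mono_fmeasurable) auto
      qed
      have "\<Lambda> f = (\<Sum>j<N. \<Lambda> (l j))"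
        by (subst fl) (intro functional_sum[OF \<Lambda>] lCc)
      moreover have "(\<integral>x. f x \<partial>\<mu>) = (\<Sum>j<N. \<integral>x. l j x \<partial>\<mu>)"
        by (subst fl) (intro Bochner_Integration.integral_sum int lCc)
      ultimately have "\<bar>\<Lambda> f - (\<integral>x. f x \<partial>\<mu>)\<bar> \<le> (\<Sum>j<N. \<bar>\<Lambda> (l j) - (\<integral>x. l j x \<partial>\<mu>)\<bar>)"
        by (simp flip: sum_subtractf)
      also have "\<dots> \<le> (\<Sum>j<N. (a (real j / real N) - a (real (Suc j) / real N)) / real N)"
      proof (rule sum_mono)
        fix j
        have "real N * \<bar>\<Lambda> (l j) - (\<integral>x. l j x \<partial>\<mu>)\<bar> = \<bar>real N * \<Lambda> (l j) - real N * (\<integral>x. l j x \<partial>\<mu>)\<bar>"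
          using N by (simp add: abs_mult flip: right_diff_distrib)
        also have "\<dots> \<le> a (real j / real N) - a (real (Suc j) / real N)"
          using \<Lambda>lj[of j] Ilj[of j] ab[of j] by linarith
        finally show "\<bar>\<Lambda> (l j) - (\<integral>x. l j x \<partial>\<mu>)\<bar> \<le> (a (real j / real N) - a (real (Suc j) / real N)) / real N"
          using N by (simp add: field_simps)
      qed
      also have "\<dots> = (a 0 - a 1) / real N"
        using sum_lessThan_telescope'[of "\<lambda>j. a (real j / real N)" N] N
        by (simp flip: sum_divide_distrib)
      also have "\<dots> \<le> a 0 / real N"
        by (intro divide_right_mono) (auto simp: a_def)
      finally show ?thesis .
    qed
    have "(\<lambda>N. a 0 / real N) \<longlonglongrightarrow> 0"
      by (rule lim_const_over_n)
    then have "\<bar>\<Lambda> f - (\<integral>x. f x \<partial>\<mu>)\<bar> \<le> 0"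
      by (rule LIMSEQ_le_const) (use bound in \<open>auto intro!: exI[of _ 1]\<close>)
    then show ?thesis by simp
  qed
  have nonneg: "\<Lambda> f = (\<integral>x. f x \<partial>\<mu>)" if f: "f \<in> Cc" and f0: "\<And>x. 0 \<le> f x" for f
  proof -
    obtain C where C: "\<And>x. \<bar>f x\<bar> \<le> C" "0 < C"
      using Cb_bound f Cc_subset_Cb by blast
    have f_eq: "f = (\<lambda>x. C * (inverse C * f x))"
      using C(2) by auto
    have g: "(\<lambda>x. inverse C * f x) \<in> Cc"
      using Cc_cmult[OF f] .
    have "\<Lambda> (\<lambda>x. inverse C * f x) = (\<integral>x. inverse C * f x \<partial>\<mu>)"
      using C f0 by (intro unit g) (auto simp: field_simps abs_le_iff)
    moreover have "\<Lambda> f = C * \<Lambda> (\<lambda>x. inverse C * f x)"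
      by (subst f_eq) (rule functional_cmult[OF \<Lambda> g])
    ultimately show ?thesis
      using C(2) by simp
  qed
  show ?thesis
  proof (rule that[OF rad])
    fix f :: "'a \<Rightarrow> real" assume f: "f \<in> Cc"
    define g h where gh: "g = (\<lambda>x. max (f x) 0)" "h = (\<lambda>x. max (0 - f x) 0)"
    have ghCc: "g \<in> Cc" "h \<in> Cc"
      unfolding gh by (intro Cc_intros f)+
    have f_eq: "f = (\<lambda>x. g x - h x)"
      by (auto simp: gh)
    have "(\<integral>x. f x \<partial>\<mu>) = (\<integral>x. g x \<partial>\<mu>) - (\<integral>x. h x \<partial>\<mu>)"
      by (subst f_eq) (intro Bochner_Integration.integral_diff int ghCc)
    also have "\<dots> = \<Lambda> g - \<Lambda> h"
      using nonneg[of g] nonneg[of h] ghCc by (simp add: gh)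
    also have "\<dots> = \<Lambda> f"
      by (subst f_eq) (rule functional_diff[OF \<Lambda> ghCc, symmetric])
    finally show "(\<integral>x. f x \<partial>\<mu>) = \<Lambda> f" .
  qed
qed

section \<open>Finite signed measures and test functions\<close>

lemma finite_measure_integrable_bounded:
  fixes f :: "'a \<Rightarrow> real"
  assumes "finite_measure M" "f \<in> borel_measurable M" "\<And>x. \<bar>f x\<bar> \<le> C"
  shows "integrable M f"
  using assms by (intro finite_measure.integrable_const_bound[of M f C]) auto

text \<open>The sum of the \<open>h i\<close>-weighted measures is a signed measure that vanishes on open sets, by
  dominated convergence along an exhaustion, and therefore on the sigma-algebra that the open sets generate as a
  pi-system. Keeping a finite family of weighted measures avoids forming signed measures.\<close>
lemma signed_Cc_determines:
  fixes M :: "'i \<Rightarrow> 'a::{metric_space, second_countable_topology} measure"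
  assumes loc: "locally compact (UNIV :: 'a set)" and fin: "finite I"
    and M: "\<And>i. i \<in> I \<Longrightarrow> finite_measure (M i)" "\<And>i. i \<in> I \<Longrightarrow> sets (M i) = sets borel"
    and h: "\<And>i. i \<in> I \<Longrightarrow> h i \<in> borel_measurable borel" "\<And>i x. i \<in> I \<Longrightarrow> \<bar>h i x\<bar> \<le> (C :: real)"
    and eq: "\<And>\<phi>. \<phi> \<in> Cc \<Longrightarrow> (\<Sum>i\<in>I. \<integral>x. \<phi> x * h i x \<partial>M i) = 0"
    and A: "A \<in> sets borel"
  shows "(\<Sum>i\<in>I. \<integral>x. indicator A x * h i x \<partial>M i) = 0"
proof -
  define \<nu> where "\<nu> B = (\<Sum>i\<in>I. \<integral>x. indicator B x * h i x \<partial>M i)" for B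
  have meas: "f \<in> borel_measurable (M i) \<longleftrightarrow> f \<in> borel_measurable borel" if "i \<in> I" for f :: "'a \<Rightarrow> real" and i
    using measurable_cong_sets[OF M(2)[OF that] refl] by auto
  have space: "space (M i) = UNIV" if "i \<in> I" for i
    using sets_eq_imp_space_eq[OF M(2)[OF that]] by simp
  have hint: "integrable (M i) (h i)" if "i \<in> I" for i
    using finite_measure_integrable_bounded[OF M(1)[OF that]] h meas that by blast
  have int: "integrable (M i) (\<lambda>x. indicator B x * h i x)" if "i \<in> I" "B \<in> sets borel" for i B
    using that h(1) by (intro Bochner_Integration.integrable_bound[OF hint[OF that(1)]])
      (auto simp: meas indicator_def intro!: borel_measurable_times)
  have open0: "\<nu> U = 0" if U: "open U" for U
  proof -
    obtain \<phi> :: "nat \<Rightarrow> 'a \<Rightarrow> real" where \<phi>: "\<And>k. \<phi> k \<in> Cc" "\<And>k x. 0 \<le> \<phi> k x" "\<And>k x. \<phi> k x \<le> 1"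
      "\<And>x. incseq (\<lambda>k. \<phi> k x)" "\<And>k x. x \<notin> U \<Longrightarrow> \<phi> k x = 0"
      "\<And>S. compact S \<Longrightarrow> S \<subseteq> U \<Longrightarrow> \<exists>k. \<forall>x\<in>S. \<phi> k x = 1"
      by (rule open_Cc_exhaustion[OF loc U]) blast
    have lim: "(\<lambda>k. \<phi> k x) \<longlonglongrightarrow> indicator U x" for x
    proof (cases "x \<in> U")
      case True
      then obtain K where K: "\<phi> K x = 1"
        using \<phi>(6)[of "{x}"] by auto
      have "\<phi> k x = 1" if "k \<ge> K" for k
        using incseqD[OF \<phi>(4) that, of x] \<phi>(3)[of k x] K by simp
      then have "eventually (\<lambda>k. \<phi> k x = 1) sequentially"
        by (auto simp: eventually_sequentially)
      then show ?thesis
        using True by (simp add: tendsto_eventually)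
    qed (simp add: \<phi>(5))
    have "(\<lambda>k. \<integral>x. \<phi> k x * h i x \<partial>M i) \<longlonglongrightarrow> (\<integral>x. indicator U x * h i x \<partial>M i)" if i: "i \<in> I" for i
    proof (rule integral_dominated_convergence)
      show "(\<lambda>x. indicator U x * h i x) \<in> borel_measurable (M i)"
        using int[OF i, of U] U by auto
      show "(\<lambda>x. \<phi> k x * h i x) \<in> borel_measurable (M i)" for k
        using Cc_borel[OF \<phi>(1)] h(1)[OF i] i by (auto simp: meas intro!: borel_measurable_times)
      show "integrable (M i) (\<lambda>x. \<bar>h i x\<bar>)"
        using hint[OF i] by simp
      show "AE x in M i. (\<lambda>k. \<phi> k x * h i x) \<longlonglongrightarrow> indicator U x * h i x"
        using lim by (intro AE_I2 tendsto_intros)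
      show "AE x in M i. norm (\<phi> k x * h i x) \<le> \<bar>h i x\<bar>" for k
        using \<phi>(2,3) by (intro AE_I2) (auto simp: abs_mult mult_left_le_one_le)
    qed
    then have "(\<lambda>k. \<Sum>i\<in>I. \<integral>x. \<phi> k x * h i x \<partial>M i) \<longlonglongrightarrow> \<nu> U"
      unfolding \<nu>_def by (intro tendsto_sum)
    then show ?thesis
      using eq[OF \<phi>(1)] by (simp add: LIMSEQ_const_iff)
  qed
  have "\<nu> A = 0"
  proof (rule sigma_sets_induct_disjoint[of "{U. open U}" UNIV A "\<lambda>B. \<nu> B = 0"])
    show "Int_stable {U :: 'a set. open U}" "{U :: 'a set. open U} \<subseteq> Pow UNIV"
      by (auto simp: Int_stable_def)
    show "A \<in> sigma_sets UNIV {U. open U}"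
      using A by (simp add: borel_def)
    show "\<nu> {} = 0" by (simp add: \<nu>_def)
  next
    show "\<nu> U = 0" if "U \<in> {U. open U}" for U
      using that open0 by simp
  next
    fix B :: "'a set" assume B: "B \<in> sigma_sets UNIV {U. open U}" "\<nu> B = 0"
    then have Bb: "B \<in> sets borel" by (simp add: borel_def)
    have "(\<integral>x. indicator (UNIV - B) x * h i x \<partial>M i) =
        (\<integral>x. indicator UNIV x * h i x \<partial>M i) - (\<integral>x. indicator B x * h i x \<partial>M i)" if i: "i \<in> I" for i
    proof -
      have "(\<lambda>x. indicator (UNIV - B) x * h i x) = (\<lambda>x. indicator UNIV x * h i x - indicator B x * h i x)"
        by (auto simp: indicator_def fun_eq_iff)
      then show ?thesis
        using Bochner_Integration.integral_diff[OF int[OF i, of UNIV] int[OF i Bb]] by simp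
    qed
    then have "\<nu> (UNIV - B) = \<nu> UNIV - \<nu> B"
      unfolding \<nu>_def by (simp flip: sum_subtractf)
    then show "\<nu> (UNIV - B) = 0"
      using open0[OF open_UNIV] B by simp
  next
    fix B :: "nat \<Rightarrow> 'a set"
    assume B: "disjoint_family B" "range B \<subseteq> sigma_sets UNIV {U. open U}" "\<And>n. \<nu> (B n) = 0"
    then have Bb: "B n \<in> sets borel" for n by (auto simp: borel_def)
    have "(\<lambda>n. \<integral>x. indicator (B n) x * h i x \<partial>M i) sums (\<integral>x. indicator (\<Union>n. B n) x * h i x \<partial>M i)"
      if i: "i \<in> I" for i
    proof -
      have ind: "(\<Sum>n<k. indicator (B n) x * h i x) = indicator (\<Union>n<k. B n) x * h i x" for k x
        using B(1) by (subst indicator_UN_disjoint) (auto simp: disjoint_family_on_def sum_distrib_right)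
      have "(\<lambda>k. \<integral>x. indicator (\<Union>n<k. B n) x * h i x \<partial>M i) \<longlonglongrightarrow> (\<integral>x. indicator (\<Union>n. B n) x * h i x \<partial>M i)"
      proof (rule integral_dominated_convergence)
        show "(\<lambda>x. indicator (\<Union>n. B n) x * h i x) \<in> borel_measurable (M i)"
          "(\<lambda>x. indicator (\<Union>n<k. B n) x * h i x) \<in> borel_measurable (M i)" for k
          using int[OF i] Bb by auto
        show "integrable (M i) (\<lambda>x. \<bar>h i x\<bar>)"
          using hint[OF i] by simp
        show "AE x in M i. (\<lambda>k. indicator (\<Union>n<k. B n) x * h i x) \<longlonglongrightarrow> indicator (\<Union>n. B n) x * h i x"
          by (intro AE_I2 tendsto_intros LIMSEQ_indicator_UN)
        show "AE x in M i. norm (indicator (\<Union>n<k. B n) x * h i x) \<le> \<bar>h i x\<bar>" for k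
          by (intro AE_I2) (auto simp: indicator_def)
      qed
      moreover have "(\<integral>x. indicator (\<Union>n<k. B n) x * h i x \<partial>M i) = (\<Sum>n<k. \<integral>x. indicator (B n) x * h i x \<partial>M i)" for k
        unfolding ind[symmetric] by (intro Bochner_Integration.integral_sum int[OF i Bb])
      ultimately show ?thesis
        by (simp add: sums_def)
    qed
    then have "(\<lambda>n. \<Sum>i\<in>I. \<integral>x. indicator (B n) x * h i x \<partial>M i) sums \<nu> (\<Union>n. B n)"
      unfolding \<nu>_def by (intro sums_sum)
    then have "(\<lambda>n. 0) sums \<nu> (\<Union>n. B n)"
      using B(3) by (simp add: \<nu>_def)
    then show "\<nu> (\<Union>n. B n) = 0"
      using sums_unique2 sums_zero by blast
  qed
  then show ?thesis by (simp add: \<nu>_def)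
qed

lemma signed_Cc_determines_measure:
  fixes M :: "'i \<Rightarrow> 'a::{metric_space, second_countable_topology} measure" and c :: "'i \<Rightarrow> real"
  assumes loc: "locally compact (UNIV :: 'a set)" and fin: "finite I"
    and M: "\<And>i. i \<in> I \<Longrightarrow> finite_measure (M i)" "\<And>i. i \<in> I \<Longrightarrow> sets (M i) = sets borel"
    and eq: "\<And>\<phi>. \<phi> \<in> Cc \<Longrightarrow> (\<Sum>i\<in>I. c i * (\<integral>x. \<phi> x \<partial>M i)) = 0"
    and A: "A \<in> sets borel"
  shows "(\<Sum>i\<in>I. c i * measure (M i) A) = 0"
proof -
  have "(\<Sum>i\<in>I. \<integral>x. indicator A x * c i \<partial>M i) = 0"
  proof (rule signed_Cc_determines[OF loc fin M _ _ _ A])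
    show "\<bar>c i\<bar> \<le> (\<Sum>i\<in>I. \<bar>c i\<bar>)" if "i \<in> I" for i
      using that fin by (intro member_le_sum) auto
    show "(\<Sum>i\<in>I. \<integral>x. \<phi> x * c i \<partial>M i) = 0" if "\<phi> \<in> Cc" for \<phi>
      using eq[OF that] by (simp add: mult.commute)
  qed auto
  moreover have "(\<integral>x. indicator A x * c i \<partial>M i) = c i * measure (M i) A" if "i \<in> I" for i
    using sets_eq_imp_space_eq[OF M(2)[OF that]] by (simp add: mult.commute)
  ultimately show ?thesis by (simp only: cong: sum.cong)
qed

text \<open>Monotone convergence along an exhaustion of the whole space.\<close>
lemma finite_radon_measure:
  fixes M :: "'a::{metric_space, second_countable_topology} measure"
  assumes loc: "locally compact (UNIV :: 'a set)" and M: "radon_measure M"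
    and bd: "\<And>\<phi>. \<phi> \<in> Cc \<Longrightarrow> (\<And>x. 0 \<le> \<phi> x) \<Longrightarrow> (\<And>x. \<phi> x \<le> 1) \<Longrightarrow> (\<integral>x. \<phi> x \<partial>M) \<le> C"
  shows "finite_measure M"
proof
  have sets: "sets M = sets borel" using M by (simp add: radon_measure_def)
  have space: "space M = UNIV" using sets_eq_imp_space_eq[OF sets] by simp
  obtain \<phi> :: "nat \<Rightarrow> 'a \<Rightarrow> real" where \<phi>: "\<And>k. \<phi> k \<in> Cc" "\<And>k x. 0 \<le> \<phi> k x" "\<And>k x. \<phi> k x \<le> 1"
    "\<And>x. incseq (\<lambda>k. \<phi> k x)" "\<And>S. compact S \<Longrightarrow> S \<subseteq> UNIV \<Longrightarrow> \<exists>k. \<forall>x\<in>S. \<phi> k x = 1"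
    by (rule open_Cc_exhaustion[OF loc open_UNIV]) blast
  have "(\<integral>\<^sup>+x. 1 \<partial>M) \<le> (\<integral>\<^sup>+x. (SUP k. ennreal (\<phi> k x)) \<partial>M)"
  proof (rule nn_integral_mono)
    fix x
    obtain k where "\<phi> k x = 1"
      using \<phi>(5)[of "{x}"] by auto
    then show "1 \<le> (SUP k. ennreal (\<phi> k x))"
      by (intro SUP_upper2[of k]) auto
  qed
  also have "\<dots> = (SUP k. \<integral>\<^sup>+x. ennreal (\<phi> k x) \<partial>M)"
    using radon_integrable_Cc[OF M \<phi>(1)] \<phi>(4)
    by (intro nn_integral_monotone_convergence_SUP)
      (auto simp: incseq_def le_fun_def intro!: ennreal_leI)
  also have "\<dots> \<le> ennreal C"
  proof (rule SUP_least)
    fix k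
    have "(\<integral>\<^sup>+x. ennreal (\<phi> k x) \<partial>M) = ennreal (\<integral>x. \<phi> k x \<partial>M)"
      using radon_integrable_Cc[OF M \<phi>(1)] \<phi>(2) by (intro nn_integral_eq_integral) auto
    also have "\<dots> \<le> ennreal C"
      using bd[OF \<phi>(1,2,3)] by (intro ennreal_leI)
    finally show "(\<integral>\<^sup>+x. ennreal (\<phi> k x) \<partial>M) \<le> ennreal C" .
  qed
  finally have "emeasure M (space M) \<le> ennreal C" by simp
  then show "emeasure M (space M) \<noteq> \<infinity>"
    by (metis ennreal_less_top infinity_ennreal_def linorder_not_less)
qed

text \<open>By the Riesz theorem the combination is a positive measure on test functions. Uniqueness then identifies that measure with the
  combination on all Borel sets.\<close>
lemma signed_Cc_nonneg_measure:
  fixes M :: "'i \<Rightarrow> 'a::{metric_space, second_countable_topology} measure" and c :: "'i \<Rightarrow> real"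
  assumes loc: "locally compact (UNIV :: 'a set)" and fin: "finite I"
    and M: "\<And>i. i \<in> I \<Longrightarrow> finite_measure (M i)" "\<And>i. i \<in> I \<Longrightarrow> sets (M i) = sets borel"
    and nonneg: "\<And>\<phi>. \<phi> \<in> Cc \<Longrightarrow> (\<And>x. 0 \<le> \<phi> x) \<Longrightarrow> 0 \<le> (\<Sum>i\<in>I. c i * (\<integral>x. \<phi> x \<partial>M i))"
    and A: "A \<in> sets borel"
  shows "0 \<le> (\<Sum>i\<in>I. c i * measure (M i) A)"
proof -
  have rad: "radon_measure (M i)" if "i \<in> I" for i
    using M[OF that] finite_measure.emeasure_finite[OF M(1)[OF that]]
    by (auto simp: radon_measure_def less_top)
  have int: "integrable (M i) f" if "i \<in> I" "f \<in> Cc" for i f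
    using radon_integrable_Cc[OF rad] that .
  define \<Lambda> where "\<Lambda> f = (\<Sum>i\<in>I. c i * (\<integral>x. f x \<partial>M i))" for f
  have \<Lambda>: "positive_Cc_functional \<Lambda>"
    unfolding positive_Cc_functional_def \<Lambda>_def
    using nonneg by (auto simp: int algebra_simps sum.distrib sum_distrib_left)
  obtain \<mu> where \<mu>: "radon_measure \<mu>" "\<And>f. f \<in> Cc \<Longrightarrow> (\<integral>x. f x \<partial>\<mu>) = \<Lambda> f"
    by (rule Riesz_Cc[OF loc \<Lambda>]) blast
  have fin\<mu>: "finite_measure \<mu>"
  proof (rule finite_radon_measure[OF loc \<mu>(1)])
    fix \<phi> :: "'a \<Rightarrow> real" assume \<phi>: "\<phi> \<in> Cc" "\<And>x. 0 \<le> \<phi> x" "\<And>x. \<phi> x \<le> 1"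
    have "c i * (\<integral>x. \<phi> x \<partial>M i) \<le> \<bar>c i\<bar> * measure (M i) UNIV" if i: "i \<in> I" for i
    proof -
      interpret finite_measure "M i" using M(1)[OF i] .
      have "(\<integral>x. \<phi> x \<partial>M i) \<le> (\<integral>x. 1 \<partial>M i)"
        using \<phi>(3) by (intro integral_mono int[OF i \<phi>(1)]) auto
      moreover have "0 \<le> (\<integral>x. \<phi> x \<partial>M i)"
        using \<phi>(2) by (intro integral_nonneg_AE) auto
      ultimately show ?thesis
        using sets_eq_imp_space_eq[OF M(2)[OF i]] by (intro mult_mono) auto
    qed
    then show "(\<integral>x. \<phi> x \<partial>\<mu>) \<le> (\<Sum>i\<in>I. \<bar>c i\<bar> * measure (M i) UNIV)"
      unfolding \<mu>(2)[OF \<phi>(1)] \<Lambda>_def by (intro sum_mono)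
  qed
  \<comment> \<open>The Riesz measure joins the family with coefficient \<open>-1\<close>, so that the enlarged combination vanishes on test functions.\<close>
  define M' where "M' = (\<lambda>j. case j of None \<Rightarrow> \<mu> | Some i \<Rightarrow> M i)"
  define c' where "c' = (\<lambda>j. case j of None \<Rightarrow> -1 | Some i \<Rightarrow> c i)"
  have sum': "(\<Sum>j\<in>insert None (Some ` I). F (c' j) (M' j)) = F (-1) \<mu> + (\<Sum>i\<in>I. F (c i) (M i))"
    for F :: "real \<Rightarrow> 'a measure \<Rightarrow> real"
    using fin by (subst sum.insert) (auto simp: M'_def c'_def sum.reindex)
  have "(\<Sum>j\<in>insert None (Some ` I). c' j * measure (M' j) A) = 0"
  proof (rule signed_Cc_determines_measure[OF loc _ _ _ _ A])
    show "finite (insert None (Some ` I))" using fin by simp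
    show "finite_measure (M' j)" if "j \<in> insert None (Some ` I)" for j
      using that M fin\<mu> by (auto simp: M'_def)
    show "sets (M' j) = sets borel" if "j \<in> insert None (Some ` I)" for j
      using that M \<mu>(1) by (auto simp: M'_def radon_measure_def)
    show "(\<Sum>j\<in>insert None (Some ` I). c' j * (\<integral>x. \<phi> x \<partial>M' j)) = 0" if "\<phi> \<in> Cc" for \<phi>
      using sum'[of "\<lambda>c M. c * (\<integral>x. \<phi> x \<partial>M)"] \<mu>(2)[OF that] by (simp add: \<Lambda>_def)
  qed
  then have "(\<Sum>i\<in>I. c i * measure (M i) A) = measure \<mu> A"
    using sum'[of "\<lambda>c M. c * measure M A"] by simp
  then show ?thesis by simp
qed

text \<open>The integrals of test functions bound the total mass, so \<open>M\<close> inherits finiteness from \<open>N\<close>.\<close>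
lemma radon_measure_eqI:
  fixes M N :: "'a::{metric_space, second_countable_topology} measure"
  assumes loc: "locally compact (UNIV :: 'a set)" and M: "radon_measure M"
    and N: "radon_measure N" "finite_measure N"
    and eq: "\<And>\<phi>. \<phi> \<in> Cc \<Longrightarrow> (\<integral>x. \<phi> x \<partial>M) = (\<integral>x. \<phi> x \<partial>N)"
  shows "M = N"
proof -
  interpret N: finite_measure N by (rule N(2))
  interpret M: finite_measure M
  proof (rule finite_radon_measure[OF loc M])
    fix \<phi> :: "'a \<Rightarrow> real" assume \<phi>: "\<phi> \<in> Cc" "\<And>x. \<phi> x \<le> 1"
    have "(\<integral>x. \<phi> x \<partial>N) \<le> (\<integral>x. 1 \<partial>N)"
      using \<phi>(2) by (intro integral_mono radon_integrable_Cc[OF N(1) \<phi>(1)]) auto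
    then show "(\<integral>x. \<phi> x \<partial>M) \<le> measure N (space N)"
      using eq[OF \<phi>(1)] by simp
  qed
  have sets: "sets M = sets borel" "sets N = sets borel"
    using M N by (auto simp: radon_measure_def)
  show ?thesis
  proof (rule measure_eqI)
    fix A assume "A \<in> sets M"
    then have A: "A \<in> sets borel" using sets by simp
    have "(\<Sum>b\<in>UNIV. (if b then 1 else - 1) * measure (if b then M else N) A) = 0"
      by (rule signed_Cc_determines_measure[OF loc _ _ _ _ A])
        (auto simp: M.finite_measure_axioms N.finite_measure_axioms sets eq UNIV_bool)
    then show "emeasure M A = emeasure N A"
      by (simp add: UNIV_bool M.emeasure_eq_measure N.emeasure_eq_measure)
  qed (simp add: sets)
qed

section \<open>Integration against a difference of two measures\<close>

lemma nn_integral_measure_add: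
  assumes sets: "sets M = sets Q" "sets N = sets Q"
    and add: "\<And>A. A \<in> sets Q \<Longrightarrow> emeasure M A = emeasure Q A + emeasure N A"
    and g: "g \<in> borel_measurable Q"
  shows "(\<integral>\<^sup>+x. g x \<partial>M) = (\<integral>\<^sup>+x. g x \<partial>Q) + (\<integral>\<^sup>+x. g x \<partial>N)"
proof -
  have mm: "w \<in> borel_measurable M" "w \<in> borel_measurable N" if "w \<in> borel_measurable Q" for w :: "'a \<Rightarrow> ennreal"
    using that sets by (simp_all cong: measurable_cong_sets)
  note sp = sets_eq_imp_space_eq[OF sets(1)] sets_eq_imp_space_eq[OF sets(2)]
  show ?thesis
    using g
  proof (induction rule: borel_measurable_induct)
    case (cong f g)
    have "(\<integral>\<^sup>+x. f x \<partial>L) = (\<integral>\<^sup>+x. g x \<partial>L)" if "space L = space Q" for L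
      by (rule nn_integral_cong) (use that cong in simp)
    then show ?case using sp cong by simp
  next
    case (set A)
    then show ?case using add sets by simp
  next
    case (mult u c)
    then show ?case
      using mm[OF mult(2)] by (simp add: nn_integral_cmult distrib_left)
  next
    case (add u v)
    then show ?case
      using mm[OF add(1)] mm[OF add(3)] by (simp add: nn_integral_add algebra_simps)
  next
    case (seq U)
    have "(\<integral>\<^sup>+x. (SUP i. U i x) \<partial>L) = (SUP i. \<integral>\<^sup>+x. U i x \<partial>L)" if "\<And>i. U i \<in> borel_measurable L" for L
      using nn_integral_monotone_convergence_SUP[OF seq(3) that] .
    moreover have "(SUP i. (\<integral>\<^sup>+x. U i x \<partial>Q) + (\<integral>\<^sup>+x. U i x \<partial>N)) = (SUP i. \<integral>\<^sup>+x. U i x \<partial>Q) + (SUP i. \<integral>\<^sup>+x. U i x \<partial>N)"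
      using seq(3) by (intro ennreal_SUP_add) (auto simp: incseq_def le_fun_def intro!: nn_integral_mono)
    ultimately show ?case
      using seq mm[OF seq(1)] by (simp add: SUP_apply[abs_def])
  qed
qed

lemma integral_measure_add:
  fixes f :: "'a \<Rightarrow> real"
  assumes sets: "sets M = sets Q" "sets N = sets Q"
    and add: "\<And>A. A \<in> sets Q \<Longrightarrow> emeasure M A = emeasure Q A + emeasure N A"
    and f: "integrable M f" "integrable Q f" "integrable N f"
  shows "(\<integral>x. f x \<partial>M) = (\<integral>x. f x \<partial>Q) + (\<integral>x. f x \<partial>N)"
proof -
  have "enn2real (\<integral>\<^sup>+x. ennreal (g x) \<partial>M) = enn2real (\<integral>\<^sup>+x. ennreal (g x) \<partial>Q) + enn2real (\<integral>\<^sup>+x. ennreal (g x) \<partial>N)"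
    if g: "integrable Q g" "integrable N g" for g :: "'a \<Rightarrow> real"
    using integrableD(2)[OF g(1)] integrableD(2)[OF g(2)] borel_measurable_integrable[OF g(1)]
    by (subst nn_integral_measure_add[OF sets add]) (auto simp: enn2real_plus less_top)
  from this[of f] this[of "\<lambda>x. - f x"] show ?thesis
    using f by (simp add: real_lebesgue_integral_def)
qed

text \<open>For a positive set \<open>Y\<close> of a Hahn decomposition of \<open>P - N\<close>, the supremum in the definition of
  \<^const>\<open>jordan_pos\<close> is attained at \<open>A \<inter> Y\<close>: removing the part of a set outside \<open>Y\<close> can only increase \<open>\<nu>\<close>.
  So the positive part is the restriction of \<open>P\<close> to \<open>Y\<close> minus that of \<open>N\<close>.\<close>
lemma jordan_pos_difference:
  fixes P N :: "'a::topological_space measure"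
  assumes P: "finite_measure P" "sets P = sets borel" and N: "finite_measure N" "sets N = sets borel"
    and \<nu>: "\<And>B. B \<in> sets borel \<Longrightarrow> \<nu> B = measure P B - measure N B"
    and Y: "Y \<in> sets borel" "\<And>X. X \<in> sets borel \<Longrightarrow> X \<subseteq> Y \<Longrightarrow> emeasure N X \<le> emeasure P X"
      "\<And>X. X \<in> sets borel \<Longrightarrow> X \<inter> Y = {} \<Longrightarrow> emeasure P X \<le> emeasure N X"
    and f: "f \<in> borel_measurable borel" "\<And>x. \<bar>f x\<bar> \<le> (C :: real)"
  shows "integrable (jordan_pos \<nu>) f" and
    "(\<integral>x. f x \<partial>jordan_pos \<nu>) = (\<integral>x. indicator Y x * f x \<partial>P) - (\<integral>x. indicator Y x * f x \<partial>N)"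
proof -
  interpret P: finite_measure P by fact
  interpret N: finite_measure N by fact
  have space: "space P = UNIV" "space N = UNIV"
    using sets_eq_imp_space_eq[OF P(2)] sets_eq_imp_space_eq[OF N(2)] by auto
  define PY where "PY = density P (indicator Y)"
  define NY where "NY = density N (indicator Y)"
  have sets: "sets PY = sets borel" "sets NY = sets borel"
    using P N by (auto simp: PY_def NY_def)
  have emPY: "emeasure PY A = emeasure P (A \<inter> Y)" "emeasure NY A = emeasure N (A \<inter> Y)" if "A \<in> sets borel" for A
    using that P(2) N(2) Y(1) unfolding PY_def NY_def
    by (auto simp: emeasure_restricted Int_commute)
  have finPY: "finite_measure PY" "finite_measure NY"
    using emPY[of UNIV] space sets_eq_imp_space_eq[OF sets(1)] sets_eq_imp_space_eq[OF sets(2)] 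
    by (auto intro!: finite_measureI)
  define Q where "Q = diff_measure PY NY"
  have le: "emeasure NY A \<le> emeasure PY A" if "A \<in> sets PY" for A
    using that Y sets emPY by auto
  have emQ: "emeasure Q A = emeasure PY A - emeasure NY A" if "A \<in> sets borel" for A
    unfolding Q_def using that sets by (intro emeasure_diff_measure finPY le) auto
  have Qsets: "sets Q = sets borel" by (simp add: Q_def sets)
  have Qadd: "emeasure PY A = emeasure Q A + emeasure NY A" if "A \<in> sets borel" for A
    using that le[of A] sets emQ by (simp add: diff_add_cancel_ennreal)
  have emQ': "emeasure Q A = ennreal (\<nu> (A \<inter> Y))" if "A \<in> sets borel" for A
  proof -
    have "A \<inter> Y \<in> sets borel" using that Y(1) by auto
    then have "emeasure Q A = ennreal (measure P (A \<inter> Y)) - ennreal (measure N (A \<inter> Y))"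
      using emQ[OF that] emPY[OF that] by (simp add: P.emeasure_eq_measure N.emeasure_eq_measure)
    then show ?thesis
      using \<open>A \<inter> Y \<in> sets borel\<close> by (simp add: ennreal_minus \<nu>)
  qed
  have sup: "(SUP B\<in>{B \<in> sets borel. B \<subseteq> A}. ennreal (\<nu> B)) = emeasure Q A" if A: "A \<in> sets borel" for A
  proof (rule antisym)
    show "(SUP B\<in>{B \<in> sets borel. B \<subseteq> A}. ennreal (\<nu> B)) \<le> emeasure Q A"
    proof (rule SUP_least)
      fix B assume "B \<in> {B \<in> sets borel. B \<subseteq> A}"
      then have B: "B \<in> sets borel" "B \<subseteq> A" by auto
      have B': "B \<inter> Y \<in> sets borel" "B - Y \<in> sets borel" using B Y(1) by auto
      have "measure P B = measure P (B \<inter> Y) + measure P (B - Y)" "measure N B = measure N (B \<inter> Y) + measure N (B - Y)"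
        using B B' P(2) N(2) P.finite_measure_Union[of "B \<inter> Y" "B - Y"] N.finite_measure_Union[of "B \<inter> Y" "B - Y"]
        by (auto simp: Int_Diff_Un Int_Diff_disjoint)
      moreover have "measure P (B - Y) \<le> measure N (B - Y)"
        using Y(3)[of "B - Y"] B' by (auto simp: P.emeasure_eq_measure N.emeasure_eq_measure)
      ultimately have "\<nu> B \<le> \<nu> (B \<inter> Y)"
        using B B' by (simp add: \<nu>)
      then have "ennreal (\<nu> B) \<le> emeasure Q B"
        unfolding emQ'[OF B(1)] by (rule ennreal_leI)
      also have "\<dots> \<le> emeasure Q A"
        using B A Qsets by (intro emeasure_mono) auto
      finally show "ennreal (\<nu> B) \<le> emeasure Q A" .
    qed
    show "emeasure Q A \<le> (SUP B\<in>{B \<in> sets borel. B \<subseteq> A}. ennreal (\<nu> B))"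
      unfolding emQ'[OF A] using A Y(1) by (intro SUP_upper) auto
  qed
  have jp: "jordan_pos \<nu> = Q"
  proof -
    have "jordan_pos \<nu> = measure_of UNIV (sets borel) (emeasure Q)"
      unfolding jordan_pos_def using sup
      by (intro measure_of_eq) (auto simp: sets.sigma_sets_eq[of borel, simplified])
    also have "\<dots> = Q"
      using measure_of_of_measure[of Q] Qsets sets_eq_imp_space_eq[OF Qsets] by simp
    finally show ?thesis .
  qed
  have finQ: "finite_measure Q"
    using emQ'[of UNIV] sets_eq_imp_space_eq[OF Qsets] by (intro finite_measureI) auto
  have intg: "integrable L f" if "finite_measure L" "sets L = sets borel" for L
    using that f measurable_cong_sets[OF that(2) refl] by (intro finite_measure_integrable_bounded[of L f C]) auto
  show "integrable (jordan_pos \<nu>) f"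
    unfolding jp using intg[OF finQ Qsets] .
  have "(\<integral>x. f x \<partial>PY) = (\<integral>x. f x \<partial>Q) + (\<integral>x. f x \<partial>NY)"
    using Qadd sets Qsets by (intro integral_measure_add intg finPY finQ) auto
  moreover have dens: "(\<integral>x. f x \<partial>density L (indicator Y)) = (\<integral>x. indicator Y x * f x \<partial>L)"
    if L: "sets L = sets borel" for L
  proof -
    have "density L (indicator Y) = density L (\<lambda>x. ennreal (indicator Y x))"
      by (simp add: ennreal_indicator)
    moreover have "f \<in> borel_measurable L" "(indicator Y :: 'a \<Rightarrow> real) \<in> borel_measurable L"
      using f(1) Y(1) L by (auto cong: measurable_cong_sets)
    ultimately show ?thesis
      using integral_density[of f L "indicator Y"] by simp
  qed
  ultimately show "(\<integral>x. f x \<partial>jordan_pos \<nu>) = (\<integral>x. indicator Y x * f x \<partial>P) - (\<integral>x. indicator Y x * f x \<partial>N)"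
    using dens[OF P(2)] dens[OF N(2)] unfolding jp PY_def NY_def by simp
qed

text \<open>The decomposition \<open>P - N\<close> need not be minimal; the excess common to \<open>P\<close> and \<open>N\<close> cancels. The
  negative part of \<open>\<nu>\<close> is handled by exchanging \<open>P\<close> with \<open>N\<close> and \<open>Y\<close> with its complement.\<close>
lemma signed_set_integral_difference:
  fixes P N :: "'a::topological_space measure"
  assumes P: "finite_measure P" "sets P = sets borel" and N: "finite_measure N" "sets N = sets borel"
    and \<nu>: "\<And>B. B \<in> sets borel \<Longrightarrow> \<nu> B = measure P B - measure N B"
    and A: "A \<in> sets borel"
    and f: "f \<in> borel_measurable borel" "\<And>x. \<bar>f x\<bar> \<le> (C :: real)"
  shows "signed_set_integral \<nu> A f = (\<integral>x. indicator A x * f x \<partial>P) - (\<integral>x. indicator A x * f x \<partial>N)"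
proof -
  obtain Y where Y: "Y \<in> sets borel" "\<And>X. X \<in> sets borel \<Longrightarrow> X \<subseteq> Y \<Longrightarrow> emeasure N X \<le> emeasure P X"
      "\<And>X. X \<in> sets borel \<Longrightarrow> X \<inter> Y = {} \<Longrightarrow> emeasure P X \<le> emeasure N X"
    using finite_unsigned_Hahn_decomposition[OF P(1) N(1)] P(2) N(2) by auto
  define g where "g x = indicator A x * f x" for x
  have g: "g \<in> borel_measurable borel" "\<bar>g x\<bar> \<le> \<bar>C\<bar>" for x
    using f(1) A f(2)[of x] unfolding g_def by (auto simp: indicator_def)
  have pos: "(\<integral>x. g x \<partial>jordan_pos \<nu>) = (\<integral>x. indicator Y x * g x \<partial>P) - (\<integral>x. indicator Y x * g x \<partial>N)"
    by (rule jordan_pos_difference(2)[OF P N \<nu> Y g])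
  have neg: "(\<integral>x. g x \<partial>jordan_pos (\<lambda>B. - \<nu> B)) =
      (\<integral>x. indicator (- Y) x * g x \<partial>N) - (\<integral>x. indicator (- Y) x * g x \<partial>P)"
  proof (rule jordan_pos_difference(2)[OF N P _ _ _ _ g])
    show "- Y \<in> sets borel" using Y(1) by auto
    show "emeasure P X \<le> emeasure N X" if "X \<in> sets borel" "X \<subseteq> - Y" for X
      using Y(3)[of X] that by auto
    show "emeasure N X \<le> emeasure P X" if "X \<in> sets borel" "X \<inter> - Y = {}" for X
      using Y(2)[of X] that by auto
  qed (simp add: \<nu>)
  have split: "(\<integral>x. g x \<partial>L) = (\<integral>x. indicator Y x * g x \<partial>L) + (\<integral>x. indicator (- Y) x * g x \<partial>L)"
    if L: "finite_measure L" "sets L = sets borel" for L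
  proof -
    have i: "integrable L (\<lambda>x. indicator Z x * g x)" if "Z \<in> sets borel" for Z
    proof (rule finite_measure_integrable_bounded[OF L(1)])
      show "(\<lambda>x. indicator Z x * g x) \<in> borel_measurable L"
        using that g(1) L(2) by (simp cong: measurable_cong_sets)
      show "\<bar>indicator Z x * g x\<bar> \<le> \<bar>C\<bar>" for x
        using g(2)[of x] by (auto simp: indicator_def)
    qed
    have "(\<integral>x. g x \<partial>L) = (\<integral>x. indicator Y x * g x + indicator (- Y) x * g x \<partial>L)"
      by (intro Bochner_Integration.integral_cong) (auto simp: indicator_def)
    also have "\<dots> = (\<integral>x. indicator Y x * g x \<partial>L) + (\<integral>x. indicator (- Y) x * g x \<partial>L)"
      using Y(1) by (intro Bochner_Integration.integral_add i) auto
    finally show ?thesis .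
  qed
  have "signed_set_integral \<nu> A f = (\<integral>x. g x \<partial>jordan_pos \<nu>) - (\<integral>x. g x \<partial>jordan_pos (\<lambda>B. - \<nu> B))"
    unfolding signed_set_integral_def set_lebesgue_integral_def g_def by simp
  also have "\<dots> = (\<integral>x. g x \<partial>P) - (\<integral>x. g x \<partial>N)"
    unfolding pos neg split[OF P] split[OF N] by simp
  finally show ?thesis by (simp add: g_def)
qed

section \<open>The power function and its linearization\<close>

text \<open>Up to the factor \<open>p\<close>, this is the derivative of \<open>|s| powr p\<close>.\<close>
definition spow :: "real \<Rightarrow> real \<Rightarrow> real" where
  "spow p s = sgn s * \<bar>s\<bar> powr (p - 1)"

lemma spow_zero [simp]: "spow p 0 = 0"
  by (simp add: spow_def)

lemma spow_mult: "spow p (a * b) = spow p a * spow p b"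
  by (simp add: spow_def sgn_mult abs_mult powr_mult)

lemma abs_spow: "\<bar>spow p a\<bar> = \<bar>a\<bar> powr (p - 1)"
  by (cases "a = 0") (auto simp: spow_def abs_mult abs_sgn_eq)

lemma spow_mult_self: "spow p a * a = \<bar>a\<bar> powr p"
proof (cases "a = 0")
  case False
  have "spow p a * a = \<bar>a\<bar> powr (p - 1) * \<bar>a\<bar>"
    by (simp add: spow_def abs_sgn mult_ac)
  also have "\<dots> = \<bar>a\<bar> powr (p - 1) * \<bar>a\<bar> powr 1"
    using False by simp
  also have "\<dots> = \<bar>a\<bar> powr p"
    by (subst powr_add[symmetric]) simp
  finally show ?thesis .
qed simp

lemma powr_pred_mult: "0 \<le> a \<Longrightarrow> a powr (p - 1) * a = a powr (p :: real)"
  using spow_mult_self[of p a] by (cases "a = 0") (auto simp: spow_def)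

text \<open>A form of Young's inequality without the optimal constants, proved by comparing both
  factors with the larger one.\<close>
lemma spow_Young:
  assumes "1 < p"
  shows "\<bar>spow p a * b\<bar> \<le> \<bar>a\<bar> powr p + \<bar>b\<bar> powr p"
proof (cases "\<bar>b\<bar> \<le> \<bar>a\<bar>")
  case True
  have "\<bar>spow p a * b\<bar> \<le> \<bar>a\<bar> powr (p - 1) * \<bar>a\<bar>"
    using True by (simp add: abs_mult abs_spow mult_left_mono)
  also have "\<dots> = \<bar>a\<bar> powr p" by (rule powr_pred_mult) simp
  finally show ?thesis by (simp add: add_increasing2)
next
  case False
  have "\<bar>spow p a * b\<bar> \<le> \<bar>b\<bar> powr (p - 1) * \<bar>b\<bar>"
    using False assms by (auto simp: abs_mult abs_spow intro!: mult_right_mono powr_mono2)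
  also have "\<dots> = \<bar>b\<bar> powr p" by (rule powr_pred_mult) simp
  finally show ?thesis by (simp add: add_increasing)
qed

lemma DERIV_abs_powr:
  assumes "1 < p"
  shows "((\<lambda>s. \<bar>s\<bar> powr p) has_real_derivative p * spow p x) (at x)"
proof (cases x "0 :: real" rule: linorder_cases)
  case greater
  have "((\<lambda>s. s powr p) has_real_derivative p * x powr (p - 1)) (at x)"
    using greater by (rule has_real_derivative_powr)
  then have "((\<lambda>s. \<bar>s\<bar> powr p) has_real_derivative p * x powr (p - 1)) (at x)"
    by (rule has_field_derivative_transform_within[where d = x]) (use greater in \<open>auto simp: dist_real_def\<close>)
  then show ?thesis using greater by (simp add: spow_def)
next
  case less
  have "((\<lambda>s. (- s) powr p) has_real_derivative - (p * (- x) powr (p - 1))) (at x)"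
    using less by (auto intro!: derivative_eq_intros)
  then have "((\<lambda>s. \<bar>s\<bar> powr p) has_real_derivative - (p * (- x) powr (p - 1))) (at x)"
    by (rule has_field_derivative_transform_within[where d = "- x"]) (use less in \<open>auto simp: dist_real_def\<close>)
  then show ?thesis using less by (simp add: spow_def)
next
  case equal
  have "((\<lambda>h::real. \<bar>h\<bar> powr (p - 1)) \<longlongrightarrow> 0) (at 0)"
    using assms by (intro tendsto_eq_intros tendsto_zero_powrI) (auto intro!: tendsto_eq_intros)
  then have "((\<lambda>h::real. \<bar>h\<bar> powr p / h) \<longlongrightarrow> 0) (at 0)"
  proof (rule Lim_null_comparison[rotated])
    have "norm (\<bar>h\<bar> powr p / h) \<le> \<bar>h\<bar> powr (p - 1)" if "h \<noteq> 0" for h :: real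
      using powr_pred_mult[of "\<bar>h\<bar>" p] that by (simp add: field_simps)
    then show "\<forall>\<^sub>F h in at 0. norm (\<bar>h\<bar> powr p / h) \<le> \<bar>h\<bar> powr (p - 1)"
      by (auto simp: eventually_at_filter)
  qed
  then show ?thesis
    using equal assms by (simp add: DERIV_def)
qed

lemma continuous_spow:
  assumes "1 < p"
  shows "continuous_on UNIV (spow p)"
proof -
  have "isCont (spow p) x" for x
  proof (cases "x = 0")
    case True
    have "(spow p \<longlongrightarrow> 0) (at 0)"
    proof (rule Lim_null_comparison)
      show "((\<lambda>h::real. \<bar>h\<bar> powr (p - 1)) \<longlongrightarrow> 0) (at 0)"
        using assms by (intro tendsto_eq_intros tendsto_zero_powrI) (auto intro!: tendsto_eq_intros)
    qed (simp add: abs_spow)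
    then show ?thesis using True by (simp add: isCont_def)
  next
    case False
    then show ?thesis
      unfolding spow_def by (intro continuous_intros) auto
  qed
  then show ?thesis by (simp add: continuous_at_imp_continuous_on)
qed

lemma spow_uniformly_continuous:
  assumes "1 < p" "0 < \<epsilon>"
  obtains \<delta> where "0 < \<delta>"
    "\<And>x y. \<bar>x\<bar> \<le> M \<Longrightarrow> \<bar>y\<bar> \<le> M \<Longrightarrow> \<bar>x - y\<bar> \<le> \<delta> \<Longrightarrow> \<bar>spow p x - spow p y\<bar> \<le> \<epsilon>"
proof -
  have "uniformly_continuous_on {-M..M} (spow p)"
    using continuous_spow[OF assms(1)] by (intro compact_uniformly_continuous) (auto intro: continuous_on_subset)
  then obtain d where d: "0 < d" "\<And>x y. x \<in> {-M..M} \<Longrightarrow> y \<in> {-M..M} \<Longrightarrow> dist y x < d \<Longrightarrow> dist (spow p y) (spow p x) < \<epsilon>"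
    using assms(2) unfolding uniformly_continuous_on_def by metis
  show ?thesis
  proof (rule that[of "d / 2"])
    show "\<bar>spow p x - spow p y\<bar> \<le> \<epsilon>" if "\<bar>x\<bar> \<le> M" "\<bar>y\<bar> \<le> M" "\<bar>x - y\<bar> \<le> d / 2" for x y
      using d(2)[of y x] d(1) that by (auto simp: dist_real_def abs_le_iff)
  qed (use d in auto)
qed

text \<open>Both sides are homogeneous of degree \<open>p\<close> in \<open>(a, b)\<close>, so \<open>\<bar>a\<bar> \<le> 1\<close> and \<open>\<bar>b\<bar> \<le> 1\<close> may be
  assumed. There the mean value inequality and the uniform continuity of \<^const>\<open>spow\<close> on
  \<open>[-2, 2]\<close> give the bound.\<close>
lemma powr_uniform_derivative:
  assumes p: "1 < p" and \<epsilon>: "0 < \<epsilon>"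
  obtains \<delta> where "0 < \<delta>"
    "\<And>t a b. \<bar>t\<bar> \<le> \<delta> \<Longrightarrow>
       \<bar>\<bar>a + t * b\<bar> powr p - \<bar>a\<bar> powr p - t * (p * (spow p a * b))\<bar> \<le> \<epsilon> * \<bar>t\<bar> * (\<bar>a\<bar> powr p + \<bar>b\<bar> powr p)"
proof -
  have "0 < \<epsilon> / p" using assms by simp
  obtain \<delta>0 where \<delta>0: "0 < \<delta>0"
    "\<And>x y. \<bar>x\<bar> \<le> 2 \<Longrightarrow> \<bar>y\<bar> \<le> 2 \<Longrightarrow> \<bar>x - y\<bar> \<le> \<delta>0 \<Longrightarrow> \<bar>spow p x - spow p y\<bar> \<le> \<epsilon> / p"
    by (rule spow_uniformly_continuous[OF p \<open>0 < \<epsilon> / p\<close>]) blast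
  \<comment> \<open>The bound 1 keeps \<open>a + s b\<close> inside \<open>[-2, 2]\<close>.\<close>
  define \<delta> where "\<delta> = min 1 \<delta>0"
  have unit: "\<bar>\<bar>a + t * b\<bar> powr p - \<bar>a\<bar> powr p - t * (p * (spow p a * b))\<bar> \<le> \<epsilon> * \<bar>t\<bar>"
    if t: "\<bar>t\<bar> \<le> \<delta>" and ab: "\<bar>a\<bar> \<le> 1" "\<bar>b\<bar> \<le> 1" for t a b
  proof -
    define G where "G s = \<bar>a + s * b\<bar> powr p - s * (p * (spow p a * b))" for s
    have "norm (G t - G 0) \<le> \<epsilon> * norm (t - 0)"
    proof (rule field_differentiable_bound[of "{-\<delta>..\<delta>}"])
      fix s assume s: "s \<in> {-\<delta>..\<delta>}"
      have "((\<lambda>s. \<bar>a + s * b\<bar> powr p) has_real_derivative (p * spow p (a + s * b)) * b) (at s)"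
        by (rule DERIV_chain2[OF DERIV_abs_powr[OF p]]) (auto intro!: derivative_eq_intros)
      then have "(G has_real_derivative (p * spow p (a + s * b)) * b - p * (spow p a * b)) (at s)"
        unfolding G_def by (rule DERIV_diff) (auto intro!: derivative_eq_intros)
      then show "(G has_field_derivative (p * spow p (a + s * b)) * b - p * (spow p a * b)) (at s within {-\<delta>..\<delta>})"
        by (rule has_field_derivative_at_within)
      have "\<bar>s * b\<bar> \<le> \<bar>s\<bar> * 1"
        using ab by (simp only: abs_mult) (intro mult_left_mono, auto)
      then have sb: "\<bar>s * b\<bar> \<le> 1" "\<bar>s * b\<bar> \<le> \<delta>0"
        using s by (auto simp: \<delta>_def)
      have "\<bar>a + s * b\<bar> \<le> 2"
        using sb ab abs_triangle_ineq[of a "s * b"] by linarith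
      then have "\<bar>spow p (a + s * b) - spow p a\<bar> \<le> \<epsilon> / p"
        using sb ab by (intro \<delta>0(2)) auto
      then have "p * \<bar>spow p (a + s * b) - spow p a\<bar> * \<bar>b\<bar> \<le> p * (\<epsilon> / p) * 1"
        using ab p \<epsilon> by (intro mult_mono) auto
      moreover have "(p * spow p (a + s * b)) * b - p * (spow p a * b) = p * (spow p (a + s * b) - spow p a) * b"
        by (simp add: algebra_simps)
      ultimately show "norm ((p * spow p (a + s * b)) * b - p * (spow p a * b)) \<le> \<epsilon>"
        using p by (simp add: abs_mult)
    qed (use t \<delta>0 in \<open>auto simp: \<delta>_def\<close>)
    then show ?thesis by (simp add: G_def algebra_simps)
  qed
  show ?thesis
  proof (rule that[of \<delta>])
    show "0 < \<delta>" using \<delta>0 by (simp add: \<delta>_def)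
    fix t a b :: real assume t: "\<bar>t\<bar> \<le> \<delta>"
    show "\<bar>\<bar>a + t * b\<bar> powr p - \<bar>a\<bar> powr p - t * (p * (spow p a * b))\<bar> \<le> \<epsilon> * \<bar>t\<bar> * (\<bar>a\<bar> powr p + \<bar>b\<bar> powr p)"
    proof (cases "a = 0 \<and> b = 0")
      case False
      define s where "s = max \<bar>a\<bar> \<bar>b\<bar>"
      have s: "0 < s" using False by (auto simp: s_def max_def)
      define a' b' where "a' = a / s" "b' = b / s"
      have ab: "a = s * a'" "b = s * b'" "\<bar>a'\<bar> \<le> 1" "\<bar>b'\<bar> \<le> 1"
        using s by (auto simp: a'_b'_def s_def)
      have "\<bar>a + t * b\<bar> powr p - \<bar>a\<bar> powr p - t * (p * (spow p a * b)) =
          s powr p * (\<bar>a' + t * b'\<bar> powr p - \<bar>a'\<bar> powr p - t * (p * (spow p a' * b')))"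
      proof -
        have "\<bar>a + t * b\<bar> = s * \<bar>a' + t * b'\<bar>" "\<bar>a\<bar> = s * \<bar>a'\<bar>"
          using s unfolding ab(1,2) by (simp_all add: abs_mult flip: abs_mult_pos' distrib_left mult.left_commute[of s t])
        moreover have "spow p a * b = s powr p * (spow p a' * b')"
          unfolding ab(1,2) spow_mult using s spow_mult_self[of p s] by (simp add: mult_ac)
        ultimately show ?thesis
          using s by (simp add: powr_mult algebra_simps)
      qed
      then have "\<bar>\<bar>a + t * b\<bar> powr p - \<bar>a\<bar> powr p - t * (p * (spow p a * b))\<bar> =
          s powr p * \<bar>\<bar>a' + t * b'\<bar> powr p - \<bar>a'\<bar> powr p - t * (p * (spow p a' * b'))\<bar>"
        by (simp add: abs_mult)
      also have "\<dots> \<le> s powr p * (\<epsilon> * \<bar>t\<bar>)"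
        by (intro mult_left_mono unit t ab) auto
      also have "\<dots> \<le> (\<bar>a\<bar> powr p + \<bar>b\<bar> powr p) * (\<epsilon> * \<bar>t\<bar>)"
        using \<epsilon> by (intro mult_right_mono) (auto simp: s_def max_def)
      finally show ?thesis by (simp add: mult_ac)
    qed simp
  qed
qed

section \<open>Continuously differentiable functions\<close>

lemma C1_derivative:
  fixes F :: "'b::euclidean_space \<Rightarrow> real"
  assumes "C1_function F"
  obtains F' :: "'b \<Rightarrow> 'b \<Rightarrow>\<^sub>L real"
    where "\<And>x. (F has_derivative blinfun_apply (F' x)) (at x)" "continuous_on UNIV F'"
  using assms unfolding C1_function_def by blast

lemma C1_continuous:
  fixes F :: "'b::euclidean_space \<Rightarrow> real"
  assumes "C1_function F" shows "continuous_on UNIV F"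
  using assms unfolding C1_function_def by (meson has_derivative_continuous continuous_at_imp_continuous_on)

lemma C1_Lipschitz:
  fixes F :: "'b::euclidean_space \<Rightarrow> real"
  assumes "C1_function F"
  obtains L where "0 < L" "\<And>a b. norm a \<le> M \<Longrightarrow> norm b \<le> M \<Longrightarrow> \<bar>F a - F b\<bar> \<le> L * norm (a - b)"
proof -
  obtain F' :: "'b \<Rightarrow> 'b \<Rightarrow>\<^sub>L real"
    where F': "\<And>x. (F has_derivative blinfun_apply (F' x)) (at x)" "continuous_on UNIV F'"
    using C1_derivative[OF assms] by blast
  have "compact (F' ` cball 0 M)"
    using F'(2) by (intro compact_continuous_image) (auto intro: continuous_on_subset)
  then obtain L where L: "0 < L" "\<And>x. x \<in> cball 0 M \<Longrightarrow> norm (F' x) \<le> L"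
    using compact_imp_bounded[of "F' ` cball 0 M"] unfolding bounded_pos by auto
  have "norm (F a - F b) \<le> L * norm (a - b)" if "norm a \<le> M" "norm b \<le> M" for a b
  proof (rule differentiable_bound[of "cball 0 M" F "\<lambda>x. blinfun_apply (F' x)"])
    show "(F has_derivative blinfun_apply (F' x)) (at x within cball 0 M)" for x
      using F'(1) by (rule has_derivative_at_withinI)
    show "onorm (blinfun_apply (F' x)) \<le> L" if "x \<in> cball 0 M" for x
      using L(2)[OF that] by (simp add: norm_blinfun.rep_eq)
  qed (use that in auto)
  then show ?thesis using that[OF L(1)] by simp
qed

text \<open>On a ball the derivative is uniformly continuous, so on a short segment it hardly differs from its
  value at either end point.\<close>
lemma C1_uniform_linearization:
  fixes F :: "'b::euclidean_space \<Rightarrow> real"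
  assumes F': "\<And>x. (F has_derivative blinfun_apply (F' x)) (at x)" "continuous_on UNIV F'"
    and \<epsilon>: "0 < \<epsilon>"
  obtains \<eta> where "0 < \<eta>"
    "\<And>a b c. norm a \<le> M \<Longrightarrow> norm b \<le> M \<Longrightarrow> norm (a - b) < \<eta> \<Longrightarrow> c = a \<or> c = b \<Longrightarrow>
       \<bar>F a - F b - blinfun_apply (F' c) (a - b)\<bar> \<le> \<epsilon> * norm (a - b)"
proof -
  have "uniformly_continuous_on (cball 0 M) F'"
    using F'(2) by (intro compact_uniformly_continuous) (auto intro: continuous_on_subset)
  then obtain \<eta> where \<eta>: "0 < \<eta>"
    "\<And>x y. x \<in> cball 0 M \<Longrightarrow> y \<in> cball 0 M \<Longrightarrow> dist y x < \<eta> \<Longrightarrow> dist (F' y) (F' x) < \<epsilon>"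
    using \<epsilon> unfolding uniformly_continuous_on_def by metis
  have "\<bar>F a - F b - blinfun_apply (F' c) (a - b)\<bar> \<le> \<epsilon> * norm (a - b)"
    if ab: "norm a \<le> M" "norm b \<le> M" "norm (a - b) < \<eta>" "c = a \<or> c = b" for a b c
  proof -
    define S where "S = closed_segment a b"
    have S: "x \<in> cball 0 M" "dist x c < \<eta>" if "x \<in> S" for x
    proof -
      have "S \<subseteq> cball 0 M"
        unfolding S_def using ab by (intro closed_segment_subset) auto
      then show "x \<in> cball 0 M" using that by auto
      have "norm (x - c) \<le> norm (a - b)"
        using that ab(4) segment_bound[of x a b] unfolding S_def by (auto simp: norm_minus_commute)
      then show "dist x c < \<eta>" using ab by (simp add: dist_norm)
    qed
    have "norm ((F a - blinfun_apply (F' c) a) - (F b - blinfun_apply (F' c) b)) \<le> \<epsilon> * norm (a - b)"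
    proof (rule differentiable_bound[of S "\<lambda>x. F x - blinfun_apply (F' c) x" "\<lambda>x. blinfun_apply (F' x - F' c)"])
      fix x assume x: "x \<in> S"
      have "((\<lambda>x. F x - blinfun_apply (F' c) x) has_derivative (\<lambda>h. blinfun_apply (F' x) h - blinfun_apply (F' c) h)) (at x)"
        by (intro has_derivative_diff F'(1) bounded_linear_imp_has_derivative blinfun.bounded_linear_right)
      then show "((\<lambda>x. F x - blinfun_apply (F' c) x) has_derivative blinfun_apply (F' x - F' c)) (at x within S)"
        by (simp add: blinfun.diff_left[abs_def] has_derivative_at_withinI)
      have "c \<in> cball 0 M" using ab by auto
      then have "dist (F' x) (F' c) < \<epsilon>"
        using S[OF x] by (intro \<eta>(2)) auto
      then show "onorm (blinfun_apply (F' x - F' c)) \<le> \<epsilon>"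
        by (simp add: dist_norm norm_blinfun.rep_eq)
    qed (auto simp: S_def)
    then show ?thesis by (simp add: blinfun.diff_right algebra_simps)
  qed
  then show ?thesis using that[OF \<eta>(1)] by blast
qed

lemma C1_real_iff:
  fixes F :: "real \<Rightarrow> real"
  shows "C1_function F \<longleftrightarrow> (\<forall>x. (F has_real_derivative deriv F x) (at x)) \<and> continuous_on UNIV (deriv F)"
proof
  assume "C1_function F"
  then obtain F' :: "real \<Rightarrow> real \<Rightarrow>\<^sub>L real"
    where F': "\<And>x. (F has_derivative blinfun_apply (F' x)) (at x)" "continuous_on UNIV F'"
    using C1_derivative by blast
  have "blinfun_apply (F' x) = (*) (blinfun_apply (F' x) 1)" for x
  proof
    fix h show "blinfun_apply (F' x) h = blinfun_apply (F' x) 1 * h"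
      using blinfun.scaleR_right[of "F' x" h 1] by (simp add: mult.commute)
  qed
  then have D: "(F has_real_derivative blinfun_apply (F' x) 1) (at x)" for x
    using F'(1)[of x] by (simp add: has_field_derivative_def)
  then have d: "deriv F = (\<lambda>x. blinfun_apply (F' x) 1)"
    using DERIV_imp_deriv by blast
  show "(\<forall>x. (F has_real_derivative deriv F x) (at x)) \<and> continuous_on UNIV (deriv F)"
    unfolding d using D F'(2) by (auto intro!: continuous_intros)
next
  assume *: "(\<forall>x. (F has_real_derivative deriv F x) (at x)) \<and> continuous_on UNIV (deriv F)"
  show "C1_function F"
    unfolding C1_function_def
  proof (intro exI[of _ "\<lambda>x. deriv F x *\<^sub>R id_blinfun"] conjI allI)
    show "(F has_derivative blinfun_apply (deriv F x *\<^sub>R id_blinfun)) (at x)" for x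
    proof -
      have "blinfun_apply (deriv F x *\<^sub>R id_blinfun) = (*) (deriv F x)"
        by (auto simp: blinfun.scaleR_left fun_eq_iff)
      then show ?thesis using * by (simp add: has_field_derivative_def)
    qed
    show "continuous_on UNIV (\<lambda>x. deriv F x *\<^sub>R id_blinfun :: real \<Rightarrow>\<^sub>L real)"
      using * by (intro continuous_intros) auto
  qed
qed

lemma C1_abs_powr:
  assumes "1 < q"
  shows "C1_function (\<lambda>s. \<bar>s\<bar> powr q)" "deriv (\<lambda>s. \<bar>s\<bar> powr q) s = q * spow q s"
proof -
  have d: "deriv (\<lambda>s. \<bar>s\<bar> powr q) = (\<lambda>s. q * spow q s)"
    using DERIV_imp_deriv[OF DERIV_abs_powr[OF assms]] by blast
  then show "deriv (\<lambda>s. \<bar>s\<bar> powr q) s = q * spow q s" by simp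
  show "C1_function (\<lambda>s. \<bar>s\<bar> powr q)"
    unfolding C1_real_iff d using DERIV_abs_powr[OF assms] continuous_spow[OF assms]
    by (auto intro!: continuous_intros)
qed

text \<open>Writing \<open>F a - F b = z (a - b)\<close>, the quotient \<open>z\<close> is close to \<open>deriv F c\<close>, and \<^const>\<open>spow\<close> is
  multiplicative. The error is thus relative to \<open>\<bar>a - b\<bar> powr (p - 1)\<close>, which is what the energies control.\<close>
lemma spow_C1_increment:
  fixes F :: "real \<Rightarrow> real"
  assumes p: "1 < p" and F: "C1_function F" and \<epsilon>: "0 < \<epsilon>"
  obtains \<eta> where "0 < \<eta>"
    "\<And>a b c. \<bar>a\<bar> \<le> M \<Longrightarrow> \<bar>b\<bar> \<le> M \<Longrightarrow> \<bar>a - b\<bar> < \<eta> \<Longrightarrow> c = a \<or> c = b \<Longrightarrow>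
       \<bar>spow p (F a - F b) - spow p (deriv F c) * spow p (a - b)\<bar> \<le> \<epsilon> * \<bar>a - b\<bar> powr (p - 1)"
proof -
  obtain F' :: "real \<Rightarrow> real \<Rightarrow>\<^sub>L real"
    where F': "\<And>x. (F has_derivative blinfun_apply (F' x)) (at x)" "continuous_on UNIV F'"
    using C1_derivative[OF F] by blast
  have F'_eq: "blinfun_apply (F' x) h = deriv F x * h" for x h
  proof -
    have "(F has_derivative (*) (deriv F x)) (at x)"
      using F unfolding C1_real_iff has_field_derivative_def by blast
    then show ?thesis
      using has_derivative_unique[OF F'(1)[of x]] by metis
  qed
  have "compact (deriv F ` {-M..M})"
    using F unfolding C1_real_iff by (intro compact_continuous_image) (auto intro: continuous_on_subset)
  then obtain L where L: "0 < L" "\<And>x. x \<in> {-M..M} \<Longrightarrow> \<bar>deriv F x\<bar> \<le> L"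
    using compact_imp_bounded[of "deriv F ` {-M..M}"] unfolding bounded_pos by auto
  obtain \<delta> where \<delta>: "0 < \<delta>"
    "\<And>x y. \<bar>x\<bar> \<le> L + 1 \<Longrightarrow> \<bar>y\<bar> \<le> L + 1 \<Longrightarrow> \<bar>x - y\<bar> \<le> \<delta> \<Longrightarrow> \<bar>spow p x - spow p y\<bar> \<le> \<epsilon>"
    by (rule spow_uniformly_continuous[OF p \<epsilon>]) blast
  have "0 < min 1 \<delta>" using \<delta> by simp
  obtain \<eta> where \<eta>: "0 < \<eta>"
    "\<And>a b c. norm a \<le> M \<Longrightarrow> norm b \<le> M \<Longrightarrow> norm (a - b) < \<eta> \<Longrightarrow> c = a \<or> c = b \<Longrightarrow>
       \<bar>F a - F b - blinfun_apply (F' c) (a - b)\<bar> \<le> min 1 \<delta> * norm (a - b)"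
    by (rule C1_uniform_linearization[OF F' \<open>0 < min 1 \<delta>\<close>]) blast
  have "\<bar>spow p (F a - F b) - spow p (deriv F c) * spow p (a - b)\<bar> \<le> \<epsilon> * \<bar>a - b\<bar> powr (p - 1)"
    if ab: "\<bar>a\<bar> \<le> M" "\<bar>b\<bar> \<le> M" "\<bar>a - b\<bar> < \<eta>" "c = a \<or> c = b" for a b c
  proof (cases "a = b")
    case False
    define z where "z = (F a - F b) / (a - b)"
    have z: "F a - F b = z * (a - b)" using False by (simp add: z_def)
    have "\<bar>F a - F b - deriv F c * (a - b)\<bar> \<le> min 1 \<delta> * \<bar>a - b\<bar>"
      using \<eta>(2)[of a b c] ab F'_eq by auto
    then have "\<bar>z - deriv F c\<bar> * \<bar>a - b\<bar> \<le> min 1 \<delta> * \<bar>a - b\<bar>"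
      unfolding z by (simp add: left_diff_distrib flip: abs_mult)
    then have zc: "\<bar>z - deriv F c\<bar> \<le> min 1 \<delta>"
      using False by simp
    moreover have "\<bar>deriv F c\<bar> \<le> L"
      using L(2)[of c] ab by (auto simp: abs_le_iff)
    ultimately have "\<bar>spow p z - spow p (deriv F c)\<bar> \<le> \<epsilon>"
      by (intro \<delta>(2)) auto
    then show ?thesis
      unfolding z spow_mult
      by (simp add: abs_mult abs_spow mult_right_mono flip: left_diff_distrib)
  qed simp
  then show ?thesis using that[OF \<eta>(1)] by blast
qed

section \<open>Two uniformity principles\<close>

text \<open>A difference quotient of \<open>a n\<close> with small step approximates \<open>b n\<close> uniformly in \<open>n\<close> and converges
  as \<open>n\<close> grows, so \<open>b\<close> is a Cauchy sequence. Passing to the limit in the assumed bound identifies the limit of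
  \<open>b\<close> with the derivative of \<open>A\<close>.\<close>
lemma difference_quotient_limit:
  fixes a :: "nat \<Rightarrow> real \<Rightarrow> real"
  assumes lim: "\<And>t. (\<lambda>n. a n t) \<longlonglongrightarrow> A t"
    and unif: "\<And>\<epsilon>. 0 < \<epsilon> \<Longrightarrow> \<exists>\<delta>>0. \<forall>t n. \<bar>t\<bar> \<le> \<delta> \<longrightarrow> \<bar>a n t - a n 0 - t * b n\<bar> \<le> \<epsilon> * \<bar>t\<bar>"
  obtains B where "b \<longlonglongrightarrow> B" "(A has_real_derivative B) (at 0)"
proof -
  have "Cauchy b"
  proof (rule CauchyI)
    fix e :: real assume "0 < e"
    then obtain \<delta> where \<delta>: "0 < \<delta>" "\<And>t n. \<bar>t\<bar> \<le> \<delta> \<Longrightarrow> \<bar>a n t - a n 0 - t * b n\<bar> \<le> (e / 4) * \<bar>t\<bar>"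
      using unif[of "e / 4"] by auto
    define c where "c n = (a n \<delta> - a n 0) / \<delta>" for n
    have c: "\<bar>c n - b n\<bar> \<le> e / 4" for n
    proof -
      have "c n - b n = (a n \<delta> - a n 0 - \<delta> * b n) / \<delta>"
        using \<delta>(1) by (simp add: c_def field_simps)
      then have "\<bar>c n - b n\<bar> = \<bar>a n \<delta> - a n 0 - \<delta> * b n\<bar> / \<delta>"
        using \<delta>(1) by simp
      also have "\<dots> \<le> (e / 4) * \<delta> / \<delta>"
        using \<delta>(2)[of \<delta> n] \<delta>(1) by (intro divide_right_mono) auto
      finally show ?thesis using \<delta>(1) by simp
    qed
    have "c \<longlonglongrightarrow> (A \<delta> - A 0) / \<delta>"
      unfolding c_def by (intro tendsto_intros lim) (use \<delta>(1) in auto)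
    then have "Cauchy c" by (intro convergent_Cauchy convergentI)
    then obtain N where N: "\<And>m n. m \<ge> N \<Longrightarrow> n \<ge> N \<Longrightarrow> \<bar>c m - c n\<bar> < e / 4"
      using CauchyD[of c "e / 4"] \<open>0 < e\<close> by auto
    have "norm (b m - b n) < e" if "m \<ge> N" "n \<ge> N" for m n
      using N[OF that] c[of m] c[of n] \<open>0 < e\<close> unfolding real_norm_def by linarith
    then show "\<exists>M. \<forall>m\<ge>M. \<forall>n\<ge>M. norm (b m - b n) < e" by blast
  qed
  then obtain B where B: "b \<longlonglongrightarrow> B"
    using real_Cauchy_convergent convergent_def by blast
  have "(A has_real_derivative B) (at 0)"
    unfolding DERIV_def
  proof (rule LIM_I)
    fix r :: real assume "0 < r"
    then obtain \<delta> where \<delta>: "0 < \<delta>" "\<And>t n. \<bar>t\<bar> \<le> \<delta> \<Longrightarrow> \<bar>a n t - a n 0 - t * b n\<bar> \<le> (r / 2) * \<bar>t\<bar>"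
      using unif[of "r / 2"] by auto
    have "norm ((A (0 + h) - A 0) / h - B) < r" if h: "h \<noteq> 0" "norm (h - 0) < \<delta>" for h
    proof -
      have "(\<lambda>n. \<bar>a n h - a n 0 - h * b n\<bar>) \<longlonglongrightarrow> \<bar>A h - A 0 - h * B\<bar>"
        by (intro tendsto_intros lim B)
      then have "\<bar>A h - A 0 - h * B\<bar> \<le> (r / 2) * \<bar>h\<bar>"
        by (rule LIMSEQ_le_const2) (use \<delta>(2) h in auto)
      moreover have "\<bar>(A h - A 0) / h - B\<bar> = \<bar>A h - A 0 - h * B\<bar> / \<bar>h\<bar>"
        using h by (simp add: field_simps flip: abs_divide)
      ultimately have "\<bar>(A h - A 0) / h - B\<bar> \<le> r / 2"
        using h by (simp add: field_simps)
      then show ?thesis using \<open>0 < r\<close> by simp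
    qed
    then show "\<exists>s>0. \<forall>x. x \<noteq> 0 \<and> norm (x - 0) < s \<longrightarrow> norm ((A (0 + x) - A 0) / x - B) < r"
      using \<delta>(1) by blast
  qed
  then show ?thesis using that B by blast
qed

text \<open>Only one of the two points has to lie in the compact set. This is what allows functions in \<^const>\<open>Cb\<close>,
  which need not be uniformly continuous, to be linearized near the support of a test function.\<close>
lemma uniform_continuity_near_compact:
  fixes f :: "'a::metric_space \<Rightarrow> 'b::metric_space"
  assumes S: "compact S" and f: "continuous_on UNIV f" and \<epsilon>: "0 < \<epsilon>"
  obtains \<eta> where "0 < \<eta>" "\<And>x y. x \<in> S \<or> y \<in> S \<Longrightarrow> dist x y < \<eta> \<Longrightarrow> dist (f x) (f y) < \<epsilon>"
proof -
  define \<G> where "\<G> = (\<lambda>c. f -` ball c (\<epsilon> / 2)) ` UNIV"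
  have op: "\<And>G. G \<in> \<G> \<Longrightarrow> open G"
    using f by (auto simp: \<G>_def intro: open_vimage)
  have cov: "S \<subseteq> \<Union>\<G>"
  proof
    fix x assume "x \<in> S"
    have "x \<in> f -` ball (f x) (\<epsilon> / 2)" using \<epsilon> by simp
    then show "x \<in> \<Union>\<G>" unfolding \<G>_def by blast
  qed
  obtain \<eta> where \<eta>: "0 < \<eta>" "\<And>x. x \<in> S \<Longrightarrow> \<exists>G\<in>\<G>. ball x \<eta> \<subseteq> G"
    using Heine_Borel_lemma[OF S cov op] by metis
  have one: "dist (f x) (f y) < \<epsilon>" if xy: "x \<in> S" "dist x y < \<eta>" for x y
  proof -
    obtain c where "ball x \<eta> \<subseteq> f -` ball c (\<epsilon> / 2)"
      using \<eta>(2)[OF xy(1)] by (auto simp: \<G>_def)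
    moreover have "x \<in> ball x \<eta>" "y \<in> ball x \<eta>"
      using xy \<eta>(1) by auto
    ultimately have "f x \<in> ball c (\<epsilon> / 2)" "f y \<in> ball c (\<epsilon> / 2)"
      by blast+
    then show ?thesis
      using dist_triangle2[of "f x" "f y" c] by (simp add: dist_commute)
  qed
  show ?thesis
    using that[OF \<eta>(1)] one by (metis dist_commute)
qed

section \<open>Bounded Borel functions\<close>

definition bounded_borel :: "('b::topological_space \<Rightarrow> real) \<Rightarrow> bool" where
  "bounded_borel w \<longleftrightarrow> w \<in> borel_measurable borel \<and> (\<exists>C. \<forall>z. \<bar>w z\<bar> \<le> C)"

named_theorems bounded_borel_intros

lemma bounded_borelI: "w \<in> borel_measurable borel \<Longrightarrow> (\<And>z. \<bar>w z\<bar> \<le> C) \<Longrightarrow> bounded_borel w"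
  by (auto simp: bounded_borel_def)

lemma bounded_borelE:
  assumes "bounded_borel w"
  obtains C where "0 < C" "\<And>z. \<bar>w z\<bar> \<le> C" "w \<in> borel_measurable borel"
proof -
  obtain C where C: "\<And>z. \<bar>w z\<bar> \<le> C" and w: "w \<in> borel_measurable borel"
    using assms by (auto simp: bounded_borel_def)
  have "\<bar>w z\<bar> \<le> max C 1" for z
    using C[of z] by simp
  then show ?thesis
    using that[of "max C 1"] w by auto
qed

lemma bounded_borel_const [bounded_borel_intros]: "bounded_borel (\<lambda>z. c)"
  by (rule bounded_borelI[of _ "\<bar>c\<bar>"]) auto

lemma bounded_borel_mult [bounded_borel_intros]:
  assumes "bounded_borel v" "bounded_borel w" shows "bounded_borel (\<lambda>z. v z * w z)"
proof -
  obtain C where C: "0 < C" "\<And>z. \<bar>v z\<bar> \<le> C" "v \<in> borel_measurable borel"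
    using bounded_borelE[OF assms(1)] by blast
  obtain D where D: "0 < D" "\<And>z. \<bar>w z\<bar> \<le> D" "w \<in> borel_measurable borel"
    using bounded_borelE[OF assms(2)] by blast
  show ?thesis
    using C D by (intro bounded_borelI[of _ "C * D"]) (auto simp: abs_mult intro!: mult_mono)
qed

lemma bounded_borel_diff [bounded_borel_intros]:
  assumes "bounded_borel v" "bounded_borel w" shows "bounded_borel (\<lambda>z. v z - w z)"
proof -
  obtain C where C: "0 < C" "\<And>z. \<bar>v z\<bar> \<le> C" "v \<in> borel_measurable borel"
    using bounded_borelE[OF assms(1)] by blast
  obtain D where D: "0 < D" "\<And>z. \<bar>w z\<bar> \<le> D" "w \<in> borel_measurable borel"
    using bounded_borelE[OF assms(2)] by blast
  show ?thesis
  proof (rule bounded_borelI[of _ "C + D"])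
    show "\<bar>v z - w z\<bar> \<le> C + D" for z
      using C(2)[of z] D(2)[of z] by linarith
  qed (use C D in auto)
qed

lemma bounded_borel_sum [bounded_borel_intros]:
  assumes "\<And>i. i \<in> I \<Longrightarrow> bounded_borel (w i)" shows "bounded_borel (\<lambda>z. \<Sum>i\<in>I. w i z)"
  using assms
proof (induction I rule: infinite_finite_induct)
  case (insert i I)
  have "bounded_borel (\<lambda>z. w i z - (0 - (\<Sum>i\<in>I. w i z)))"
    using insert by (intro bounded_borel_intros) auto
  then show ?case using insert by simp
qed (auto intro: bounded_borel_const)

lemma bounded_borel_continuous_compose:
  fixes G :: "real \<Rightarrow> real"
  assumes G: "continuous_on UNIV G" and w: "bounded_borel w" shows "bounded_borel (\<lambda>z. G (w z))"
proof -
  obtain C where C: "0 < C" "\<And>z. \<bar>w z\<bar> \<le> C" "w \<in> borel_measurable borel"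
    using bounded_borelE[OF w] by blast
  have "compact (G ` {-C..C})"
    using G by (intro compact_continuous_image) (auto intro: continuous_on_subset)
  then obtain D where "\<forall>y\<in>G ` {-C..C}. norm y \<le> D"
    using compact_imp_bounded[of "G ` {-C..C}"] unfolding bounded_iff by blast
  then have D: "\<bar>G s\<bar> \<le> D" if "s \<in> {-C..C}" for s
    using that by auto
  show ?thesis
  proof (rule bounded_borelI)
    show "(\<lambda>z. G (w z)) \<in> borel_measurable borel"
      using measurable_compose[OF C(3) borel_measurable_continuous_onI[OF G]] .
    show "\<bar>G (w z)\<bar> \<le> D" for z
      using C(2)[of z] by (intro D) (auto simp: abs_le_iff)
  qed
qed

lemma Cb_bounded_borel: "f \<in> Cb \<Longrightarrow> bounded_borel f"
  by (metis Cb_borel Cb_bound bounded_borelI)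

lemma Cb_vector_bound:
  fixes v :: "'n::finite \<Rightarrow> 'a::topological_space \<Rightarrow> real"
  assumes v: "\<And>i. v i \<in> Cb"
  obtains M where "\<And>x. norm (\<chi> i. v i x) \<le> M"
proof -
  have "\<exists>K. \<forall>x. \<bar>v i x\<bar> \<le> K" for i
    using Cb_bound[OF v[of i]] by auto
  then obtain K where K: "\<And>i x. \<bar>v i x\<bar> \<le> K i"
    by metis
  have "norm (\<chi> i. v i x) \<le> (\<Sum>i\<in>UNIV. K i)" for x
  proof -
    have "(\<Sum>i\<in>UNIV. \<bar>v i x\<bar>) \<le> (\<Sum>i\<in>UNIV. K i)"
      using K by (intro sum_mono)
    then show ?thesis
      using norm_le_l1_cart[of "\<chi> i. v i x"] by simp
  qed
  then show ?thesis by (rule that)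
qed

lemma Cb_compose:
  fixes v :: "'n::finite \<Rightarrow> 'a::topological_space \<Rightarrow> real" and G :: "real ^ 'n \<Rightarrow> real"
  assumes G: "continuous_on UNIV G" and v: "\<And>i. v i \<in> Cb"
  shows "(\<lambda>x. G (\<chi> i. v i x)) \<in> Cb"
proof -
  obtain M where M: "\<And>x. norm (\<chi> i. v i x) \<le> M"
    by (rule Cb_vector_bound[of v, OF v]) blast
  have "compact (G ` cball 0 M)"
    using G by (intro compact_continuous_image) (auto intro: continuous_on_subset)
  then have "bounded (range (\<lambda>x. G (\<chi> i. v i x)))"
    by (rule bounded_subset[OF compact_imp_bounded]) (use M in auto)
  moreover have "continuous_on UNIV (\<lambda>x. G (\<chi> i. v i x))"
    using v by (intro continuous_on_compose2[OF G] continuous_on_vec_lambda) (auto simp: Cb_def)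
  ultimately show ?thesis by (simp add: Cb_def)
qed

lemma Cb_compose_real:
  fixes G :: "real \<Rightarrow> real"
  assumes G: "continuous_on UNIV G" and f: "f \<in> Cb"
  shows "(\<lambda>x. G (f x)) \<in> Cb"
proof -
  obtain C where C: "\<And>z. \<bar>G (f z)\<bar> \<le> C"
    using bounded_borelE[OF bounded_borel_continuous_compose[OF G Cb_bounded_borel[OF f]]] by blast
  have "continuous_on UNIV (\<lambda>x. G (f x))"
    using f by (intro continuous_on_compose2[OF G]) (auto simp: Cb_def)
  then show ?thesis
    using C by (auto simp: Cb_def bounded_iff)
qed

lemma Cb_mult: "f \<in> Cb \<Longrightarrow> g \<in> Cb \<Longrightarrow> (\<lambda>x. f x * g x) \<in> Cb"
  using bounded_borel_mult[OF Cb_bounded_borel Cb_bounded_borel, of f g]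
  by (auto simp: Cb_def bounded_iff bounded_borel_def intro: continuous_on_mult)

lemma Cb_add_cmult: "f \<in> Cb \<Longrightarrow> g \<in> Cb \<Longrightarrow> (\<lambda>x. f x + t * g x) \<in> Cb"
  using bounded_borel_diff[OF Cb_bounded_borel bounded_borel_mult[OF bounded_borel_const Cb_bounded_borel], of f g "- t"]
  by (auto simp: Cb_def bounded_iff bounded_borel_def intro!: continuous_intros)

section \<open>The space of functions of finite energy\<close>

locale p_energy_setting =
  fixes p :: real
    and m :: "'a::{metric_space, second_countable_topology} measure"
    and k :: "real \<Rightarrow> 'a \<times> 'a \<Rightarrow> ennreal"
    and \<rho> :: "nat \<Rightarrow> real"
  assumes p: "1 < p"
    and loc: "locally compact (UNIV :: 'a set)"
    and sets_m: "sets m = sets borel"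
    and sigma_finite: "sigma_finite_measure m"
    and kernel_borel: "\<And>r. 0 < r \<Longrightarrow> k r \<in> borel_measurable borel"
    and local: "asymptotically_local m k"
    and dense: "sup_dense_in (B_space m p k \<inter> Cc) Cc"
    and \<rho>_pos: "\<And>n. 0 < \<rho> n"
    and \<rho>_lim: "\<rho> \<longlonglongrightarrow> 0"
    and J_lim: "\<And>f. f \<in> B_space m p k \<Longrightarrow>
           \<exists>l::real. 0 \<le> l \<and> (\<lambda>n. J_energy m p k (\<rho> n) f) \<longlonglongrightarrow> ennreal l"
begin

abbreviation B :: "('a \<Rightarrow> real) set" where "B \<equiv> B_space m p k"

definition jump :: "('a \<Rightarrow> real) \<Rightarrow> 'a \<times> 'a \<Rightarrow> real" where
  "jump f z = f (fst z) - f (snd z)"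

definition kernel_measure :: "nat \<Rightarrow> ('a \<times> 'a) measure" where
  "kernel_measure n = density (m \<Otimes>\<^sub>M m) (k (\<rho> n))"

lemma sets_product: "sets (m \<Otimes>\<^sub>M m) = sets (borel :: ('a \<times> 'a) measure)"
  unfolding borel_prod[symmetric] by (rule sets_pair_measure_cong[OF sets_m sets_m])

lemma sets_kernel_measure [measurable_cong]: "sets (kernel_measure n) = sets borel"
  by (simp add: kernel_measure_def sets_product)

lemma measurable_product: "f \<in> borel_measurable (m \<Otimes>\<^sub>M m) \<longleftrightarrow> f \<in> borel_measurable borel"
  by (simp cong: measurable_cong_sets add: sets_product)

lemma measurable_kernel: "f \<in> borel_measurable (kernel_measure n) \<longleftrightarrow> f \<in> borel_measurable borel"
  using measurable_cong_sets[OF sets_kernel_measure refl] by auto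

lemma measurable_m: "f \<in> borel_measurable m \<longleftrightarrow> f \<in> borel_measurable borel"
  using measurable_cong_sets[OF sets_m refl] by auto

lemma B_borel: "f \<in> B \<Longrightarrow> f \<in> borel_measurable borel"
  by (auto simp: B_space_def Lp_functions_def measurable_m)

lemma borel_fst_snd:
  assumes "f \<in> borel_measurable (borel :: 'a measure)"
  shows "(\<lambda>z. f (fst z)) \<in> borel_measurable borel" "(\<lambda>z. f (snd z)) \<in> borel_measurable borel"
  by (rule measurable_compose[OF borel_measurable_continuous_onI assms], intro continuous_intros)+

lemma jump_borel:
  assumes "f \<in> borel_measurable borel" shows "jump f \<in> borel_measurable borel"
  unfolding jump_def[abs_def] using borel_fst_snd[OF assms] by (rule borel_measurable_diff)

lemma jump_powr_borel:
  assumes "f \<in> borel_measurable borel"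
  shows "(\<lambda>z. ennreal (\<bar>jump f z\<bar> powr p)) \<in> borel_measurable borel"
  using jump_borel[OF assms] by measurable

lemma iterated_integral_kernel:
  assumes r: "0 < r" and F: "F \<in> borel_measurable borel"
  shows "(\<integral>\<^sup>+x. (\<integral>\<^sup>+y. F (x, y) * k r (x, y) \<partial>m) \<partial>m) = (\<integral>\<^sup>+z. F z * k r z \<partial>(m \<Otimes>\<^sub>M m))"
proof -
  interpret sigma_finite_measure m by (rule sigma_finite)
  have "(\<lambda>z. F z * k r z) \<in> borel_measurable (m \<Otimes>\<^sub>M m)"
    unfolding measurable_product using F kernel_borel[OF r] by measurable
  from nn_integral_fst[OF this] show ?thesis by simp
qed

lemma J_energy_product:
  assumes "0 < r" "f \<in> borel_measurable borel"
  shows "J_energy m p k r f = (\<integral>\<^sup>+z. ennreal (\<bar>jump f z\<bar> powr p) * k r z \<partial>(m \<Otimes>\<^sub>M m))"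
  using iterated_integral_kernel[OF assms(1) jump_powr_borel[OF assms(2)]]
  by (simp add: J_energy_def jump_def)

lemma nn_integral_kernel_measure:
  assumes "F \<in> borel_measurable borel"
  shows "(\<integral>\<^sup>+z. F z \<partial>kernel_measure n) = (\<integral>\<^sup>+z. F z * k (\<rho> n) z \<partial>(m \<Otimes>\<^sub>M m))"
  unfolding kernel_measure_def using assms kernel_borel[OF \<rho>_pos]
  by (subst nn_integral_density) (auto simp: measurable_product mult.commute)

lemma J_energy_kernel:
  assumes "f \<in> borel_measurable borel"
  shows "J_energy m p k (\<rho> n) f = (\<integral>\<^sup>+z. ennreal (\<bar>jump f z\<bar> powr p) \<partial>kernel_measure n)"
  using J_energy_product[OF \<rho>_pos assms] jump_borel[OF assms]
  by (simp add: nn_integral_kernel_measure)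

lemma B_integrable_jump: "f \<in> B \<Longrightarrow> integrable (kernel_measure n) (\<lambda>z. \<bar>jump f z\<bar> powr p)"
proof -
  assume f: "f \<in> B"
  have "J_energy m p k (\<rho> n) f \<le> (SUP r\<in>{0<..}. J_energy m p k r f)"
    using \<rho>_pos by (intro SUP_upper) auto
  then have "(\<integral>\<^sup>+z. ennreal (\<bar>jump f z\<bar> powr p) \<partial>kernel_measure n) < \<infinity>"
    using f unfolding J_energy_kernel[OF B_borel[OF f]] by (auto simp: B_space_def intro: le_less_trans)
  then show ?thesis
    using jump_borel[OF B_borel[OF f]] by (intro integrableI_nonneg) (auto simp: measurable_kernel)
qed

lemma J_energy_integral:
  "f \<in> B \<Longrightarrow> J_energy m p k (\<rho> n) f = ennreal (\<integral>z. \<bar>jump f z\<bar> powr p \<partial>kernel_measure n)"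
  using B_integrable_jump J_energy_kernel[OF B_borel] by (simp add: nn_integral_eq_integral)

lemma jump_integral_lim:
  assumes "f \<in> B"
  shows "(\<lambda>n. \<integral>z. \<bar>jump f z\<bar> powr p \<partial>kernel_measure n) \<longlonglongrightarrow> p_energy m p k \<rho> f"
proof -
  obtain l :: real where l: "0 \<le> l" "(\<lambda>n. J_energy m p k (\<rho> n) f) \<longlonglongrightarrow> ennreal l"
    using J_lim[OF assms] by blast
  have "p_energy m p k \<rho> f = l"
    unfolding p_energy_def limI[OF l(2)] using l(1) by simp
  moreover have "(\<lambda>n. \<integral>z. \<bar>jump f z\<bar> powr p \<partial>kernel_measure n) \<longlonglongrightarrow> l"
    using l unfolding J_energy_integral[OF assms] by (subst (asm) tendsto_ennreal_iff) auto
  ultimately show ?thesis by simp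
qed

lemma jump_integral_bound:
  assumes "f \<in> B"
  obtains C where "0 < C" "\<And>n. (\<integral>z. \<bar>jump f z\<bar> powr p \<partial>kernel_measure n) \<le> C"
proof -
  obtain C where "0 < C" "\<forall>n. norm (\<integral>z. \<bar>jump f z\<bar> powr p \<partial>kernel_measure n) \<le> C"
    using convergent_imp_Bseq[OF convergentI[OF jump_integral_lim[OF assms]]] by (auto elim: BseqE)
  then show ?thesis using that[of C] by (auto simp: abs_le_iff)
qed

lemma powr_sum_le:
  fixes a :: "'i \<Rightarrow> real"
  assumes "finite I" "\<And>i. i \<in> I \<Longrightarrow> 0 \<le> a i"
  shows "(\<Sum>i\<in>I. a i) powr p \<le> (real (card I)) powr p * (\<Sum>i\<in>I. a i powr p)"
proof (cases "I = {}")
  case False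
  define M where "M = Max (a ` I)"
  obtain j where j: "j \<in> I" "M = a j"
  proof -
    have "M \<in> a ` I"
      unfolding M_def using False assms(1) by (intro Max_in) auto
    then show ?thesis using that by blast
  qed
  have "(\<Sum>i\<in>I. a i) \<le> real (card I) * M"
    using assms(1) unfolding M_def by (intro sum_bounded_above) auto
  then have "(\<Sum>i\<in>I. a i) powr p \<le> (real (card I) * M) powr p"
    using p by (intro powr_mono2 sum_nonneg assms) auto
  also have "\<dots> = (real (card I)) powr p * a j powr p"
    using j assms by (simp add: powr_mult)
  also have "\<dots> \<le> (real (card I)) powr p * (\<Sum>i\<in>I. a i powr p)"
    using j(1) assms(1) by (intro mult_left_mono member_le_sum) auto
  finally show ?thesis .
qed simp

text \<open>The pth power of a finite sum is at most a constant times the sum of the pth powers. Closure of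
  \<open>B\<close> under sums, products of bounded functions and composition with continuously differentiable
  functions are all instances.\<close>
lemma B_dominated:
  fixes f :: "'i \<Rightarrow> 'a \<Rightarrow> real"
  assumes I: "finite I" and f: "\<And>i. i \<in> I \<Longrightarrow> f i \<in> B" and h: "h \<in> borel_measurable borel"
    and C: "0 \<le> C" and le: "\<And>x. \<bar>h x\<bar> \<le> C * (\<Sum>i\<in>I. \<bar>f i x\<bar>)"
    and le_jump: "\<And>x y. \<bar>h x - h y\<bar> \<le> C * (\<Sum>i\<in>I. \<bar>f i x - f i y\<bar>)"
  shows "h \<in> B"
proof -
  define K where "K = (C * real (card I)) powr p"
  have pow: "\<bar>s\<bar> powr p \<le> K * (\<Sum>i\<in>I. \<bar>a i\<bar> powr p)" if "\<bar>s\<bar> \<le> C * (\<Sum>i\<in>I. \<bar>a i\<bar>)" for s and a :: "'i \<Rightarrow> real"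
  proof -
    have "\<bar>s\<bar> powr p \<le> (C * (\<Sum>i\<in>I. \<bar>a i\<bar>)) powr p"
      using that p by (intro powr_mono2) auto
    also have "\<dots> = C powr p * (\<Sum>i\<in>I. \<bar>a i\<bar>) powr p"
      using C by (intro powr_mult)
    also have "\<dots> \<le> C powr p * ((real (card I)) powr p * (\<Sum>i\<in>I. \<bar>a i\<bar> powr p))"
      by (intro mult_left_mono powr_sum_le I) auto
    also have "\<dots> = K * (\<Sum>i\<in>I. \<bar>a i\<bar> powr p)"
      using C by (simp add: K_def powr_mult)
    finally show ?thesis .
  qed
  have K0: "0 \<le> K" by (simp add: K_def)
  have fi: "integrable m (\<lambda>x. \<bar>f i x\<bar> powr p)" if "i \<in> I" for i
    using f[OF that] by (simp add: B_space_def Lp_functions_def)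
  have "integrable m (\<lambda>x. \<bar>h x\<bar> powr p)"
  proof (rule Bochner_Integration.integrable_bound)
    show "integrable m (\<lambda>x. K * (\<Sum>i\<in>I. \<bar>f i x\<bar> powr p))"
      by (intro integrable_mult_right Bochner_Integration.integrable_sum fi)
    show "(\<lambda>x. \<bar>h x\<bar> powr p) \<in> borel_measurable m"
      using h unfolding measurable_m by measurable
    show "AE x in m. norm (\<bar>h x\<bar> powr p) \<le> norm (K * (\<Sum>i\<in>I. \<bar>f i x\<bar> powr p))"
      using pow[OF le] K0 by (intro AE_I2) (simp add: abs_mult sum_nonneg)
  qed
  then have Lp: "h \<in> Lp_functions m p"
    using h by (simp add: Lp_functions_def measurable_m)
  have "J_energy m p k r h \<le> ennreal K * (\<Sum>i\<in>I. (SUP r\<in>{0<..}. J_energy m p k r (f i)))" if r: "0 < r" for r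
  proof -
    have meas: "(\<lambda>z. ennreal (\<bar>jump (f i) z\<bar> powr p) * k r z) \<in> borel_measurable (m \<Otimes>\<^sub>M m)" if "i \<in> I" for i
      unfolding measurable_product using kernel_borel[OF r] jump_borel[OF B_borel[OF f[OF that]]] by measurable
    have "J_energy m p k r h \<le> (\<integral>\<^sup>+z. ennreal K * (\<Sum>i\<in>I. ennreal (\<bar>jump (f i) z\<bar> powr p) * k r z) \<partial>(m \<Otimes>\<^sub>M m))"
      unfolding J_energy_product[OF r h]
    proof (rule nn_integral_mono)
      fix z
      have "\<bar>jump h z\<bar> powr p \<le> K * (\<Sum>i\<in>I. \<bar>jump (f i) z\<bar> powr p)"
        unfolding jump_def by (rule pow[OF le_jump])
      then have "ennreal (\<bar>jump h z\<bar> powr p) \<le> ennreal K * (\<Sum>i\<in>I. ennreal (\<bar>jump (f i) z\<bar> powr p))"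
        using K0 by (subst sum_ennreal) (simp_all add: ennreal_leI sum_nonneg flip: ennreal_mult)
      then have "ennreal (\<bar>jump h z\<bar> powr p) * k r z \<le> ennreal K * (\<Sum>i\<in>I. ennreal (\<bar>jump (f i) z\<bar> powr p)) * k r z"
        by (rule mult_right_mono) simp
      then show "ennreal (\<bar>jump h z\<bar> powr p) * k r z \<le> ennreal K * (\<Sum>i\<in>I. ennreal (\<bar>jump (f i) z\<bar> powr p) * k r z)"
        by (simp add: sum_distrib_right mult.assoc del: sum_ennreal)
    qed
    also have "\<dots> = ennreal K * (\<Sum>i\<in>I. J_energy m p k r (f i))"
      using J_energy_product[OF r B_borel[OF f]] meas
      by (subst nn_integral_cmult) (auto simp: nn_integral_sum)
    also have "\<dots> \<le> ennreal K * (\<Sum>i\<in>I. (SUP r\<in>{0<..}. J_energy m p k r (f i)))"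
      using r by (intro mult_left_mono sum_mono SUP_upper) auto
    finally show ?thesis .
  qed
  then have "(SUP r\<in>{0<..}. J_energy m p k r h) \<le> ennreal K * (\<Sum>i\<in>I. (SUP r\<in>{0<..}. J_energy m p k r (f i)))"
    by (intro SUP_least) auto
  also have "\<dots> < \<infinity>"
    using f I by (auto simp: B_space_def ennreal_mult_less_top less_top)
  finally show ?thesis
    using Lp by (simp add: B_space_def)
qed

lemma B_Lipschitz_compose:
  assumes f: "f \<in> B" and h: "(\<lambda>x. F (f x)) \<in> borel_measurable borel" and "0 \<le> L" "F 0 = 0"
    and L: "\<And>x y. \<bar>F (f x) - F (f y)\<bar> \<le> L * \<bar>f x - f y\<bar>" "\<And>x. \<bar>F (f x) - F 0\<bar> \<le> L * \<bar>f x\<bar>"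
  shows "(\<lambda>x. F (f x)) \<in> B"
  using assms by (auto intro: B_dominated[of "{()}" "\<lambda>_. f" _ L])

lemma B_add_cmult:
  assumes f: "f \<in> B" and g: "g \<in> B" shows "(\<lambda>x. f x + t * g x) \<in> B"
proof (rule B_dominated[of UNIV "\<lambda>b :: bool. if b then f else g" _ "1 + \<bar>t\<bar>"])
  have *: "\<bar>a + t * b\<bar> \<le> (1 + \<bar>t\<bar>) * (\<bar>a\<bar> + \<bar>b\<bar>)" for a b :: real
  proof -
    have "\<bar>a + t * b\<bar> \<le> \<bar>a\<bar> + \<bar>t\<bar> * \<bar>b\<bar>"
      by (metis abs_mult abs_triangle_ineq)
    also have "\<dots> \<le> (1 + \<bar>t\<bar>) * (\<bar>a\<bar> + \<bar>b\<bar>)"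
      by (simp add: algebra_simps)
    finally show ?thesis .
  qed
  show "\<bar>f x + t * g x\<bar> \<le> (1 + \<bar>t\<bar>) * (\<Sum>i\<in>UNIV. \<bar>(if i then f else g) x\<bar>)" for x
    using *[of "f x" "g x"] by (simp add: UNIV_bool add.commute)
  show "\<bar>(f x + t * g x) - (f y + t * g y)\<bar> \<le> (1 + \<bar>t\<bar>) * (\<Sum>i\<in>UNIV. \<bar>(if i then f else g) x - (if i then f else g) y\<bar>)" for x y
    using *[of "f x - f y" "g x - g y"] by (simp add: UNIV_bool algebra_simps)
qed (use f g B_borel in auto)

lemma B_mult:
  assumes f: "f \<in> B" "f \<in> Cb" and g: "g \<in> B" "g \<in> Cb" shows "(\<lambda>x. f x * g x) \<in> B"
proof -
  obtain K where K: "0 < K" "\<And>x. \<bar>f x\<bar> \<le> K" using Cb_bound[OF f(2)] by blast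
  obtain L where L: "0 < L" "\<And>x. \<bar>g x\<bar> \<le> L" using Cb_bound[OF g(2)] by blast
  show ?thesis
  proof (rule B_dominated[of UNIV "\<lambda>b :: bool. if b then f else g" _ "K + L"])
    fix x y
    have "\<bar>f x * g x\<bar> \<le> K * \<bar>g x\<bar>"
      using K by (simp add: abs_mult mult_right_mono)
    also have "\<dots> \<le> (K + L) * (\<bar>f x\<bar> + \<bar>g x\<bar>)"
      using K L by (simp add: algebra_simps)
    finally show "\<bar>f x * g x\<bar> \<le> (K + L) * (\<Sum>i\<in>UNIV. \<bar>(if i then f else g) x\<bar>)"
      by (simp add: UNIV_bool add.commute)
    have "f x * g x - f y * g y = f x * (g x - g y) + (f x - f y) * g y"
      by (simp add: algebra_simps)
    then have "\<bar>f x * g x - f y * g y\<bar> \<le> \<bar>f x\<bar> * \<bar>g x - g y\<bar> + \<bar>f x - f y\<bar> * \<bar>g y\<bar>"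
      by (metis abs_mult abs_triangle_ineq)
    also have "\<dots> \<le> K * \<bar>g x - g y\<bar> + \<bar>f x - f y\<bar> * L"
      using K L by (intro add_mono mult_right_mono mult_left_mono) auto
    also have "\<dots> \<le> (K + L) * (\<bar>f x - f y\<bar> + \<bar>g x - g y\<bar>)"
      using K L by (simp add: algebra_simps)
    finally show "\<bar>f x * g x - f y * g y\<bar> \<le> (K + L) * (\<Sum>i\<in>UNIV. \<bar>(if i then f else g) x - (if i then f else g) y\<bar>)"
      by (simp add: UNIV_bool add.commute)
  qed (use f g K L B_borel in auto)
qed

lemma B_C1_compose:
  fixes v :: "'n::finite \<Rightarrow> 'a \<Rightarrow> real" and \<Psi> :: "real ^ 'n \<Rightarrow> real"
  assumes v: "\<And>i. v i \<in> B \<inter> Cb" and \<Psi>: "C1_function \<Psi>" "\<Psi> 0 = 0"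
  shows "(\<lambda>x. \<Psi> (\<chi> i. v i x)) \<in> B \<inter> Cb"
proof
  have vCb: "v i \<in> Cb" for i using v by simp
  show Cb: "(\<lambda>x. \<Psi> (\<chi> i. v i x)) \<in> Cb"
    by (rule Cb_compose[OF C1_continuous[OF \<Psi>(1)] vCb])
  obtain M where M: "\<And>x. norm (\<chi> i. v i x) \<le> M"
    by (rule Cb_vector_bound[of v, OF vCb]) blast
  have M0: "0 \<le> M"
    using M norm_ge_zero order_trans by blast
  obtain L where L: "0 < L" "\<And>a b. norm a \<le> M \<Longrightarrow> norm b \<le> M \<Longrightarrow> \<bar>\<Psi> a - \<Psi> b\<bar> \<le> L * norm (a - b)"
    by (rule C1_Lipschitz[OF \<Psi>(1)]) blast
  have L1: "\<bar>\<Psi> a - \<Psi> b\<bar> \<le> L * (\<Sum>i\<in>UNIV. \<bar>a $ i - b $ i\<bar>)" if "norm a \<le> M" "norm b \<le> M" for a b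
  proof -
    have "L * norm (a - b) \<le> L * (\<Sum>i\<in>UNIV. \<bar>(a - b) $ i\<bar>)"
      using L(1) norm_le_l1_cart[of "a - b"] by (intro mult_left_mono) auto
    then show ?thesis using L(2)[OF that] by simp
  qed
  show "(\<lambda>x. \<Psi> (\<chi> i. v i x)) \<in> B"
  proof (rule B_dominated[of UNIV v _ L])
    show "\<bar>\<Psi> (\<chi> i. v i x)\<bar> \<le> L * (\<Sum>i\<in>UNIV. \<bar>v i x\<bar>)" for x
      using L1[OF M, of 0 x] M0 by (simp add: \<Psi>(2))
    show "\<bar>\<Psi> (\<chi> i. v i x) - \<Psi> (\<chi> i. v i y)\<bar> \<le> L * (\<Sum>i\<in>UNIV. \<bar>v i x - v i y\<bar>)" for x y
      using L1[OF M M, of x y] by simp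
  qed (use v L(1) Cb_borel[OF Cb] in auto)
qed

lemma B_C1_compose_real:
  assumes f: "f \<in> B \<inter> Cb" and F: "C1_function F" "F 0 = 0"
  shows "(\<lambda>x. F (f x)) \<in> B \<inter> Cb"
proof
  have fCb: "f \<in> Cb" using f by simp
  show Cb: "(\<lambda>x. F (f x)) \<in> Cb"
    by (rule Cb_compose_real[OF C1_continuous[OF F(1)] fCb])
  obtain M where M: "0 < M" "\<And>x. \<bar>f x\<bar> \<le> M"
    using Cb_bound[OF fCb] by blast
  obtain L where L: "0 < L" "\<And>a b. norm a \<le> M \<Longrightarrow> norm b \<le> M \<Longrightarrow> \<bar>F a - F b\<bar> \<le> L * norm (a - b)"
    by (rule C1_Lipschitz[OF F(1)]) blast
  show "(\<lambda>x. F (f x)) \<in> B"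
  proof (rule B_Lipschitz_compose[where F = F and f = f and L = L])
    show "\<bar>F (f x) - F (f y)\<bar> \<le> L * \<bar>f x - f y\<bar>" for x y
      using L(2)[of "f x" "f y"] M(2) by simp
    show "\<bar>F (f x) - F 0\<bar> \<le> L * \<bar>f x\<bar>" for x
      using L(2)[of "f x" 0] M by simp
  qed (use f F L(1) Cb_borel[OF Cb] in auto)
qed


lemma bounded_borel_fst_snd:
  fixes f :: "'a \<Rightarrow> real"
  assumes "bounded_borel f"
  shows "bounded_borel (\<lambda>z :: 'a \<times> 'a. f (fst z))" "bounded_borel (\<lambda>z :: 'a \<times> 'a. f (snd z))"
  using assms borel_fst_snd[of f] unfolding bounded_borel_def by auto

lemma bounded_borel_jump [bounded_borel_intros]:
  "f \<in> Cb \<Longrightarrow> bounded_borel (jump f)"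
  unfolding jump_def[abs_def] by (intro bounded_borel_diff bounded_borel_fst_snd Cb_bounded_borel)

lemma bounded_borel_spow [bounded_borel_intros]:
  "bounded_borel w \<Longrightarrow> bounded_borel (\<lambda>z. spow p (w z))"
  by (rule bounded_borel_continuous_compose[OF continuous_spow[OF p]])

section \<open>Weighted energies and their derivatives\<close>

definition T :: "nat \<Rightarrow> ('a \<times> 'a \<Rightarrow> real) \<Rightarrow> ('a \<Rightarrow> real) \<Rightarrow> ('a \<Rightarrow> real) \<Rightarrow> real" where
  "T n w f g = (\<integral>z. w z * (spow p (jump f z) * jump g z) \<partial>kernel_measure n)"

lemma T_integrable:
  assumes w: "bounded_borel w" and f: "f \<in> B" and g: "g \<in> B"
  shows "integrable (kernel_measure n) (\<lambda>z. w z * (spow p (jump f z) * jump g z))"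
proof -
  obtain C where C: "0 < C" "\<And>z. \<bar>w z\<bar> \<le> C" "w \<in> borel_measurable borel"
    using bounded_borelE[OF w] by blast
  show ?thesis
  proof (rule Bochner_Integration.integrable_bound)
    show "integrable (kernel_measure n) (\<lambda>z. C * (\<bar>jump f z\<bar> powr p + \<bar>jump g z\<bar> powr p))"
      by (intro integrable_mult_right Bochner_Integration.integrable_add B_integrable_jump f g)
    have "spow p \<in> borel_measurable borel"
      using continuous_spow[OF p] by (rule borel_measurable_continuous_onI)
    then show "(\<lambda>z. w z * (spow p (jump f z) * jump g z)) \<in> borel_measurable (kernel_measure n)"
      unfolding measurable_kernel using C(3) jump_borel[OF B_borel] f g by measurable
    show "AE z in kernel_measure n. norm (w z * (spow p (jump f z) * jump g z)) \<le> norm (C * (\<bar>jump f z\<bar> powr p + \<bar>jump g z\<bar> powr p))"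
    proof (rule AE_I2)
      fix z
      have "\<bar>w z\<bar> * \<bar>spow p (jump f z) * jump g z\<bar> \<le> C * (\<bar>jump f z\<bar> powr p + \<bar>jump g z\<bar> powr p)"
        using C by (intro mult_mono spow_Young p) auto
      then show "norm (w z * (spow p (jump f z) * jump g z)) \<le> norm (C * (\<bar>jump f z\<bar> powr p + \<bar>jump g z\<bar> powr p))"
        using C(1) by (simp add: abs_mult)
    qed
  qed
qed

lemma T_self: "T n w f f = (\<integral>z. w z * \<bar>jump f z\<bar> powr p \<partial>kernel_measure n)"
  by (simp add: T_def spow_mult_self)

lemma T_one_self: "T n (\<lambda>z. 1) f f = (\<integral>z. \<bar>jump f z\<bar> powr p \<partial>kernel_measure n)"
  by (simp add: T_self)

lemma T_add_weight:
  assumes "bounded_borel v" "bounded_borel w" "f \<in> B" "g \<in> B"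
  shows "T n (\<lambda>z. v z + w z) f g = T n v f g + T n w f g"
  unfolding T_def distrib_right by (intro Bochner_Integration.integral_add T_integrable assms)

lemma T_cmult_weight: "T n (\<lambda>z. c * w z) f g = c * T n w f g"
  by (simp add: T_def mult.assoc)

lemma T_nonneg: "(\<And>z. 0 \<le> w z) \<Longrightarrow> 0 \<le> T n w f f"
  unfolding T_self by (intro integral_nonneg_AE) auto

lemma T_mono:
  assumes "bounded_borel v" "bounded_borel w" "f \<in> B" "\<And>z. v z \<le> w z"
  shows "T n v f f \<le> T n w f f"
  unfolding T_self using T_integrable[OF assms(1,3,3), of n] T_integrable[OF assms(2,3,3), of n] assms(4)
  by (intro integral_mono) (auto simp: spow_mult_self intro!: mult_right_mono)

text \<open>The weighted, integrated Young inequality. It makes the polarized functional dominated by the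
  diagonal ones, which later produces finite measures.\<close>
lemma T_Young:
  assumes w: "bounded_borel w" "\<And>z. 0 \<le> w z" and f: "f \<in> B" and g: "g \<in> B"
  shows "\<bar>T n w f g\<bar> \<le> T n w f f + T n w g g"
proof -
  have "\<bar>T n w f g\<bar> \<le> (\<integral>z. \<bar>w z * (spow p (jump f z) * jump g z)\<bar> \<partial>kernel_measure n)"
    unfolding T_def by (rule integral_abs_bound)
  also have "\<dots> \<le> (\<integral>z. w z * (spow p (jump f z) * jump f z) + w z * (spow p (jump g z) * jump g z) \<partial>kernel_measure n)"
  proof (intro integral_mono integrable_abs Bochner_Integration.integrable_add T_integrable w f g)
    fix z
    show "\<bar>w z * (spow p (jump f z) * jump g z)\<bar> \<le> w z * (spow p (jump f z) * jump f z) + w z * (spow p (jump g z) * jump g z)"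
      using w(2)[of z] spow_Young[OF p, of "jump f z" "jump g z"]
      by (simp add: abs_mult spow_mult_self mult_left_mono flip: distrib_left)
  qed
  also have "\<dots> = T n w f f + T n w g g"
    unfolding T_def by (intro Bochner_Integration.integral_add T_integrable w f g)
  finally show ?thesis .
qed

lemma jump_add_cmult: "jump (\<lambda>x. f x + t * g x) z = jump f z + t * jump g z"
  by (simp add: jump_def algebra_simps)

lemma T_uniform_derivative:
  assumes \<epsilon>: "0 < \<epsilon>"
  obtains \<delta> where "0 < \<delta>"
    "\<And>t n w f g. \<bar>t\<bar> \<le> \<delta> \<Longrightarrow> bounded_borel w \<Longrightarrow> (\<And>z. 0 \<le> w z) \<Longrightarrow> f \<in> B \<Longrightarrow> g \<in> B \<Longrightarrow>
       \<bar>T n w (\<lambda>x. f x + t * g x) (\<lambda>x. f x + t * g x) - T n w f f - t * (p * T n w f g)\<bar>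
         \<le> \<epsilon> * \<bar>t\<bar> * (T n w f f + T n w g g)"
proof -
  obtain \<delta> where \<delta>: "0 < \<delta>"
    "\<And>t a b. \<bar>t\<bar> \<le> \<delta> \<Longrightarrow>
       \<bar>\<bar>a + t * b\<bar> powr p - \<bar>a\<bar> powr p - t * (p * (spow p a * b))\<bar> \<le> \<epsilon> * \<bar>t\<bar> * (\<bar>a\<bar> powr p + \<bar>b\<bar> powr p)"
    by (rule powr_uniform_derivative[OF p \<epsilon>]) blast
  show ?thesis
  proof (rule that[OF \<delta>(1)])
    fix t n f g and w :: "'a \<times> 'a \<Rightarrow> real"
    assume t: "\<bar>t\<bar> \<le> \<delta>" and w: "bounded_borel w" "\<And>z. 0 \<le> w z" and f: "f \<in> B" and g: "g \<in> B"
    let ?h = "\<lambda>x. f x + t * g x"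
    have h: "?h \<in> B" using f g by (rule B_add_cmult)
    let ?E = "\<lambda>z :: 'a \<times> 'a. w z * (spow p (jump ?h z) * jump ?h z) - w z * (spow p (jump f z) * jump f z) - (t * p) * (w z * (spow p (jump f z) * jump g z))"
    note i1 = T_integrable[OF w(1) h h, of n] and i2 = T_integrable[OF w(1) f f, of n]
      and i4 = T_integrable[OF w(1) g g, of n] and i3 = integrable_mult_right[OF T_integrable[OF w(1) f g, of n], of "t * p"]
    note i12 = Bochner_Integration.integrable_diff[OF i1 i2] and i24 = Bochner_Integration.integrable_add[OF i2 i4]
    have int: "integrable (kernel_measure n) ?E"
      by (rule Bochner_Integration.integrable_diff[OF i12 i3])
    have "(\<integral>z. ?E z \<partial>kernel_measure n) = T n w ?h ?h - T n w f f - (t * p) * T n w f g"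
      unfolding Bochner_Integration.integral_diff[OF i12 i3] Bochner_Integration.integral_diff[OF i1 i2] T_def
      by (simp only: integral_mult_right_zero)
    then have "T n w ?h ?h - T n w f f - t * (p * T n w f g) = (\<integral>z. ?E z \<partial>kernel_measure n)"
      by (simp only: mult.assoc)
    then have "\<bar>T n w ?h ?h - T n w f f - t * (p * T n w f g)\<bar> \<le> (\<integral>z. \<bar>?E z\<bar> \<partial>kernel_measure n)"
      using integral_abs_bound by simp
    also have "\<dots> \<le> (\<integral>z. \<epsilon> * \<bar>t\<bar> * (w z * (spow p (jump f z) * jump f z) + w z * (spow p (jump g z) * jump g z)) \<partial>kernel_measure n)"
    proof (rule integral_mono)
      show "integrable (kernel_measure n) (\<lambda>z. \<bar>?E z\<bar>)" using int by (rule integrable_abs)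
      show "integrable (kernel_measure n) (\<lambda>z. \<epsilon> * \<bar>t\<bar> * (w z * (spow p (jump f z) * jump f z) + w z * (spow p (jump g z) * jump g z)))"
        by (rule integrable_mult_right[OF i24])
      fix z
      have "?E z = w z * (\<bar>jump f z + t * jump g z\<bar> powr p - \<bar>jump f z\<bar> powr p - t * (p * (spow p (jump f z) * jump g z)))"
        unfolding jump_add_cmult spow_mult_self by (simp add: algebra_simps)
      then have "\<bar>?E z\<bar> = w z * \<bar>\<bar>jump f z + t * jump g z\<bar> powr p - \<bar>jump f z\<bar> powr p - t * (p * (spow p (jump f z) * jump g z))\<bar>"
        using w(2)[of z] by (simp add: abs_mult)
      also have "\<dots> \<le> w z * (\<epsilon> * \<bar>t\<bar> * (\<bar>jump f z\<bar> powr p + \<bar>jump g z\<bar> powr p))"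
        using w(2)[of z] by (intro mult_left_mono \<delta>(2) t)
      also have "\<dots> = \<epsilon> * \<bar>t\<bar> * (w z * (spow p (jump f z) * jump f z) + w z * (spow p (jump g z) * jump g z))"
        unfolding spow_mult_self by (simp add: algebra_simps)
      finally show "\<bar>?E z\<bar> \<le> \<epsilon> * \<bar>t\<bar> * (w z * (spow p (jump f z) * jump f z) + w z * (spow p (jump g z) * jump g z))" .
    qed
    also have "\<dots> = \<epsilon> * \<bar>t\<bar> * (T n w f f + T n w g g)"
      unfolding T_def by (simp only: integral_mult_right_zero Bochner_Integration.integral_add[OF i2 i4])
    finally show "\<bar>T n w ?h ?h - T n w f f - t * (p * T n w f g)\<bar> \<le> \<epsilon> * \<bar>t\<bar> * (T n w f f + T n w g g)" .
  qed
qed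

lemma T_self_bound:
  assumes "f \<in> B"
  obtains K where "0 < K" "\<And>n w c. bounded_borel w \<Longrightarrow> (\<And>z. w z \<le> c) \<Longrightarrow> 0 \<le> c \<Longrightarrow> T n w f f \<le> c * K"
proof -
  obtain K where K: "0 < K" "\<And>n. (\<integral>z. \<bar>jump f z\<bar> powr p \<partial>kernel_measure n) \<le> K"
    using jump_integral_bound[OF assms] by blast
  have "T n w f f \<le> c * K" if w: "bounded_borel w" "\<And>z. w z \<le> c" "0 \<le> c" for n w c
  proof -
    have "T n w f f \<le> T n (\<lambda>z. c * 1) f f"
    proof (rule T_mono[OF w(1) _ assms])
      show "bounded_borel (\<lambda>z :: 'a \<times> 'a. c * 1)" by (rule bounded_borel_const)
      show "w z \<le> c * 1" for z using w(2) by simp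
    qed
    also have "\<dots> = c * T n (\<lambda>z. 1) f f" by (rule T_cmult_weight)
    also have "\<dots> \<le> c * K" unfolding T_one_self using K(2) w(3) by (intro mult_left_mono)
    finally show ?thesis .
  qed
  then show ?thesis using that[OF K(1)] by blast
qed

text \<open>The bound of \<open>T_uniform_derivative\<close> is uniform in \<open>n\<close> because the energies are bounded in \<open>n\<close>.\<close>
lemma T_polarized_limit:
  assumes w: "bounded_borel w" "\<And>z. 0 \<le> w z" and f: "f \<in> B" and g: "g \<in> B"
    and lim: "\<And>t. (\<lambda>n. T n w (\<lambda>x. f x + t * g x) (\<lambda>x. f x + t * g x)) \<longlonglongrightarrow> A t"
  shows "(\<lambda>n. T n w f g) \<longlonglongrightarrow> 1 / p * deriv A 0"
proof -
  obtain c where c: "0 < c" "\<And>z. \<bar>w z\<bar> \<le> c"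
    using bounded_borelE[OF w(1)] by blast
  obtain K where K: "0 < K" "\<And>n w c. bounded_borel w \<Longrightarrow> (\<And>z. w z \<le> c) \<Longrightarrow> 0 \<le> c \<Longrightarrow> T n w f f \<le> c * K"
    by (rule T_self_bound[OF f]) blast
  obtain L where L: "0 < L" "\<And>n w c. bounded_borel w \<Longrightarrow> (\<And>z. w z \<le> c) \<Longrightarrow> 0 \<le> c \<Longrightarrow> T n w g g \<le> c * L"
    by (rule T_self_bound[OF g]) blast
  have cw: "w z \<le> c" for z using c(2)[of z] by simp
  obtain D where D: "(\<lambda>n. p * T n w f g) \<longlonglongrightarrow> D" "(A has_real_derivative D) (at 0)"
  proof (rule difference_quotient_limit[OF lim])
    fix \<epsilon> :: real assume "0 < \<epsilon>"
    define \<epsilon>' where "\<epsilon>' = \<epsilon> / (c * K + c * L)"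
    have pos: "0 < c * K + c * L" using c K L by (simp add: add_pos_pos)
    then have "0 < \<epsilon>'" using \<open>0 < \<epsilon>\<close> by (simp add: \<epsilon>'_def)
    obtain \<delta> where \<delta>: "0 < \<delta>"
      "\<And>t n w f g. \<bar>t\<bar> \<le> \<delta> \<Longrightarrow> bounded_borel w \<Longrightarrow> (\<And>z. 0 \<le> w z) \<Longrightarrow> f \<in> B \<Longrightarrow> g \<in> B \<Longrightarrow>
       \<bar>T n w (\<lambda>x. f x + t * g x) (\<lambda>x. f x + t * g x) - T n w f f - t * (p * T n w f g)\<bar>
         \<le> \<epsilon>' * \<bar>t\<bar> * (T n w f f + T n w g g)"
      by (rule T_uniform_derivative[OF \<open>0 < \<epsilon>'\<close>]) blast
    have "\<bar>T n w (\<lambda>x. f x + t * g x) (\<lambda>x. f x + t * g x) - T n w (\<lambda>x. f x + 0 * g x) (\<lambda>x. f x + 0 * g x) - t * (p * T n w f g)\<bar> \<le> \<epsilon> * \<bar>t\<bar>"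
      if t: "\<bar>t\<bar> \<le> \<delta>" for t n
    proof -
      have "T n w f f + T n w g g \<le> c * K + c * L"
        using K(2)[OF w(1) cw, of n] L(2)[OF w(1) cw, of n] c(1) by (intro add_mono) auto
      then have "\<epsilon>' * \<bar>t\<bar> * (T n w f f + T n w g g) \<le> \<epsilon>' * \<bar>t\<bar> * (c * K + c * L)"
        using \<open>0 < \<epsilon>'\<close> by (intro mult_left_mono) auto
      also have "\<dots> = \<epsilon> * \<bar>t\<bar>"
        using pos by (simp add: \<epsilon>'_def)
      finally show ?thesis
        using \<delta>(2)[OF t w f g, of n] by simp
    qed
    then show "\<exists>\<delta>>0. \<forall>t n. \<bar>t\<bar> \<le> \<delta> \<longrightarrow> \<bar>T n w (\<lambda>x. f x + t * g x) (\<lambda>x. f x + t * g x) - T n w (\<lambda>x. f x + 0 * g x) (\<lambda>x. f x + 0 * g x) - t * (p * T n w f g)\<bar> \<le> \<epsilon> * \<bar>t\<bar>"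
      using \<delta>(1) by blast
  qed blast
  have "(\<lambda>n. 1 / p * (p * T n w f g)) \<longlonglongrightarrow> 1 / p * D"
    by (intro tendsto_mult tendsto_const D)
  then show ?thesis
    using p DERIV_imp_deriv[OF D(2)] by simp
qed

lemma p_energy2_limit:
  assumes "f \<in> B" "g \<in> B"
  shows "(\<lambda>n. T n (\<lambda>z. 1) f g) \<longlonglongrightarrow> p_energy2 m p k \<rho> f g"
  unfolding p_energy2_def
  by (rule T_polarized_limit) (auto simp: T_one_self assms intro!: bounded_borel_intros jump_integral_lim B_add_cmult)

section \<open>Locality\<close>

text \<open>Asymptotic locality in the form used below: the radii \<open>\<delta> r\<close> eventually drop below any fixed \<open>\<eta>\<close>.\<close>
lemma kernel_off_diagonal:
  assumes \<eta>: "0 < \<eta>"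
  shows "(\<lambda>n. emeasure (kernel_measure n) {z. \<eta> \<le> dist (fst z) (snd z)}) \<longlonglongrightarrow> 0"
proof -
  obtain \<delta> where \<delta>: "\<And>r. 0 < r \<Longrightarrow> 0 < \<delta> r" "(\<delta> \<longlongrightarrow> 0) (at_right 0)"
    "((\<lambda>r. \<integral>\<^sup>+x. (\<integral>\<^sup>+y\<in>UNIV - ball x (\<delta> r). k r (x, y) \<partial>m) \<partial>m) \<longlongrightarrow> 0) (at_right 0)"
    using local unfolding asymptotically_local_def by blast
  have \<rho>: "filterlim \<rho> (at_right 0) sequentially"
    unfolding filterlim_at using \<rho>_lim \<rho>_pos by (auto simp: less_imp_neq[THEN not_sym])
  define q where "q n = (\<integral>\<^sup>+x. (\<integral>\<^sup>+y\<in>UNIV - ball x (\<delta> (\<rho> n)). k (\<rho> n) (x, y) \<partial>m) \<partial>m)" for n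
  have q: "q \<longlonglongrightarrow> 0"
    unfolding q_def using filterlim_compose[OF \<delta>(3) \<rho>] .
  have "(\<lambda>n. \<delta> (\<rho> n)) \<longlonglongrightarrow> 0"
    using filterlim_compose[OF \<delta>(2) \<rho>] .
  then have ev: "\<forall>\<^sub>F n in sequentially. \<delta> (\<rho> n) < \<eta>"
    using \<eta> by (rule order_tendstoD(2))
  let ?A = "{z :: 'a \<times> 'a. \<eta> \<le> dist (fst z) (snd z)}"
  have A: "?A \<in> sets borel"
    by (intro borel_closed closed_Collect_le continuous_intros)
  have le: "emeasure (kernel_measure n) ?A \<le> q n" if "\<delta> (\<rho> n) < \<eta>" for n
  proof -
    have "emeasure (kernel_measure n) ?A = (\<integral>\<^sup>+z. indicator ?A z \<partial>kernel_measure n)"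
      using A by (simp add: sets_kernel_measure)
    also have "\<dots> = (\<integral>\<^sup>+z. indicator ?A z * k (\<rho> n) z \<partial>(m \<Otimes>\<^sub>M m))"
      by (rule nn_integral_kernel_measure) (rule borel_measurable_indicator[OF A])
    also have "\<dots> = (\<integral>\<^sup>+x. (\<integral>\<^sup>+y. indicator ?A (x, y) * k (\<rho> n) (x, y) \<partial>m) \<partial>m)"
      by (rule iterated_integral_kernel[symmetric, OF \<rho>_pos]) (rule borel_measurable_indicator[OF A])
    also have "\<dots> \<le> q n"
      unfolding q_def using that by (intro nn_integral_mono) (auto simp: indicator_def)
    finally show ?thesis .
  qed
  show ?thesis
  proof (rule tendsto_sandwich[OF _ _ tendsto_const q])
    show "\<forall>\<^sub>F n in sequentially. emeasure (kernel_measure n) ?A \<le> q n"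
      using ev by eventually_elim (rule le)
  qed simp
qed

text \<open>Near the diagonal the integral is small because of \<open>near\<close>; away from it \<open>R\<close> is bounded and the mass of the
  kernel measures tends to 0.\<close>
lemma localization:
  assumes R: "bounded_borel R"
    and W: "\<And>z. 0 \<le> W z" "\<And>n. integrable (kernel_measure n) W" "\<And>n. (\<integral>z. W z \<partial>kernel_measure n) \<le> C"
    and near: "\<And>\<epsilon>. 0 < \<epsilon> \<Longrightarrow> \<exists>\<eta>>0. \<forall>z. dist (fst z) (snd z) < \<eta> \<longrightarrow> \<bar>R z\<bar> \<le> \<epsilon> * W z"
  shows "(\<lambda>n. \<integral>z. R z \<partial>kernel_measure n) \<longlonglongrightarrow> 0"
proof (rule LIMSEQ_I)
  fix e :: real assume e: "0 < e"
  obtain K where K: "0 < K" "\<And>z. \<bar>R z\<bar> \<le> K" "R \<in> borel_measurable borel"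
    using bounded_borelE[OF R] by blast
  have C0: "0 \<le> C"
  proof -
    have "0 \<le> (\<integral>z. W z \<partial>kernel_measure 0)"
      using W(1) by (intro integral_nonneg_AE) simp
    then show ?thesis using W(3)[of 0] by linarith
  qed
  define \<epsilon> where "\<epsilon> = e / (2 * (C + 1))"
  have \<epsilon>: "0 < \<epsilon>" "\<epsilon> * C \<le> e / 2" using e C0 by (auto simp: \<epsilon>_def field_simps)
  obtain \<eta> where \<eta>: "0 < \<eta>" "\<And>z. dist (fst z) (snd z) < \<eta> \<Longrightarrow> \<bar>R z\<bar> \<le> \<epsilon> * W z"
    using near[OF \<epsilon>(1)] by blast
  let ?A = "{z :: 'a \<times> 'a. \<eta> \<le> dist (fst z) (snd z)}"
  have A: "?A \<in> sets borel"
    by (intro borel_closed closed_Collect_le continuous_intros)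
  have "0 < ennreal (e / (4 * K))" using e K by simp
  then have "\<forall>\<^sub>F n in sequentially. emeasure (kernel_measure n) ?A < ennreal (e / (4 * K))"
    by (rule order_tendstoD(2)[OF kernel_off_diagonal[OF \<eta>(1)]])
  then obtain N where N: "\<And>n. n \<ge> N \<Longrightarrow> emeasure (kernel_measure n) ?A < ennreal (e / (4 * K))"
    by (auto simp: eventually_sequentially)
  have "norm ((\<integral>z. R z \<partial>kernel_measure n) - 0) < e" if n: "n \<ge> N" for n
  proof (cases "integrable (kernel_measure n) R")
    case True
    have "ennreal (norm (\<integral>z. R z \<partial>kernel_measure n)) \<le> (\<integral>\<^sup>+z. norm (R z) \<partial>kernel_measure n)"
      using True by (rule integral_norm_bound_ennreal)
    also have "\<dots> \<le> (\<integral>\<^sup>+z. ennreal (\<epsilon> * W z) + ennreal K * indicator ?A z \<partial>kernel_measure n)"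
    proof (rule nn_integral_mono)
      fix z
      show "ennreal (norm (R z)) \<le> ennreal (\<epsilon> * W z) + ennreal K * indicator ?A z"
      proof (cases "z \<in> ?A")
        case True
        then show ?thesis using K(2)[of z] by (simp add: add_increasing ennreal_leI)
      next
        case False
        then show ?thesis using \<eta>(2)[of z] by (simp add: ennreal_leI)
      qed
    qed
    also have "\<dots> = ennreal (\<epsilon> * (\<integral>z. W z \<partial>kernel_measure n)) + ennreal K * emeasure (kernel_measure n) ?A"
    proof -
      have "(\<integral>\<^sup>+z. ennreal (\<epsilon> * W z) \<partial>kernel_measure n) = ennreal (\<integral>z. \<epsilon> * W z \<partial>kernel_measure n)"
        using W \<epsilon>(1) by (intro nn_integral_eq_integral) auto
      moreover have "(\<lambda>z. ennreal (\<epsilon> * W z)) \<in> borel_measurable (kernel_measure n)"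
        using W(2)[of n] by measurable
      ultimately show ?thesis
        using A by (subst nn_integral_add) (auto simp: sets_kernel_measure nn_integral_cmult_indicator)
    qed
    also have "\<dots> \<le> ennreal (e / 2) + ennreal K * ennreal (e / (4 * K))"
    proof (intro add_mono mult_left_mono ennreal_leI)
      have "\<epsilon> * (\<integral>z. W z \<partial>kernel_measure n) \<le> \<epsilon> * C"
        using W(3) \<epsilon>(1) by (intro mult_left_mono) auto
      then show "\<epsilon> * (\<integral>z. W z \<partial>kernel_measure n) \<le> e / 2" using \<epsilon>(2) by simp
    qed (use N[OF n] in auto)
    also have "\<dots> = ennreal (e / 2 + e / 4)"
      using e K by (simp flip: ennreal_mult ennreal_plus)
    finally have "norm (\<integral>z. R z \<partial>kernel_measure n) \<le> e / 2 + e / 4"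
      using e by (subst (asm) ennreal_le_iff) auto
    then show ?thesis using e by simp
  \<comment> \<open>The integral of a function that is not integrable is 0.\<close>
  qed (use e in \<open>simp add: not_integrable_integral_eq\<close>)
  then show "\<exists>N. \<forall>n\<ge>N. norm ((\<integral>z. R z \<partial>kernel_measure n) - 0) < e" by blast
qed

text \<open>The coefficient may be evaluated at either coordinate, since they are close to each other where the
  kernel measures live. Either choice is used: the second coordinate to match the
  Leibniz rule in \<open>energy_functional_limit\<close>, the first one for the chain rule of the energy measures.\<close>
lemma T_chain_first:
  assumes S: "compact S" and u: "u \<in> B \<inter> Cb" and h: "h \<in> B \<inter> Cb" and F: "C1_function F" "F 0 = 0"
    and w: "bounded_borel w" and supp: "\<And>z. fst z \<notin> S \<Longrightarrow> snd z \<notin> S \<Longrightarrow> w z * jump h z = 0"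
    and \<pi>: "\<pi> = fst \<or> \<pi> = snd"
  shows "(\<lambda>n. T n w (\<lambda>x. F (u x)) h - T n (\<lambda>z. w z * spow p (deriv F (u (\<pi> z)))) u h) \<longlonglongrightarrow> 0"
proof -
  have Fu: "(\<lambda>x. F (u x)) \<in> B \<inter> Cb" using B_C1_compose_real[OF u F] .
  have dF: "continuous_on UNIV (deriv F)" using F by (simp add: C1_real_iff)
  have coef: "(\<lambda>x. spow p (deriv F (u x))) \<in> Cb"
    using u by (intro Cb_compose_real[OF continuous_spow[OF p]] Cb_compose_real[OF dF]) auto
  have coef\<pi>: "bounded_borel (\<lambda>z. spow p (deriv F (u (\<pi> z))))"
    using \<pi> bounded_borel_fst_snd[OF Cb_bounded_borel[OF coef]] by auto
  define R where "R z = w z * jump h z * (spow p (jump (\<lambda>x. F (u x)) z) - spow p (deriv F (u (\<pi> z))) * spow p (jump u z))" for z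
  define W where "W z = \<bar>jump u z\<bar> powr p + \<bar>jump h z\<bar> powr p" for z
  have "(\<lambda>n. \<integral>z. R z \<partial>kernel_measure n) \<longlonglongrightarrow> 0"
  proof -
    obtain K where K: "\<And>n. (\<integral>z. \<bar>jump u z\<bar> powr p \<partial>kernel_measure n) \<le> K"
      using jump_integral_bound u by blast
    obtain L where L: "\<And>n. (\<integral>z. \<bar>jump h z\<bar> powr p \<partial>kernel_measure n) \<le> L"
      using jump_integral_bound h by blast
    show ?thesis
    proof (rule localization)
      show "bounded_borel R"
        unfolding R_def[abs_def] using u h Fu
        by (intro bounded_borel_intros w coef\<pi>) auto
      show "0 \<le> W z" for z by (simp add: W_def)
      show "integrable (kernel_measure n) W" for n
        unfolding W_def[abs_def] using u h by (intro Bochner_Integration.integrable_add B_integrable_jump) auto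
      show "(\<integral>z. W z \<partial>kernel_measure n) \<le> K + L" for n
        unfolding W_def using u h K[of n] L[of n]
        by (subst Bochner_Integration.integral_add) (auto intro: B_integrable_jump add_mono)
      fix \<epsilon> :: real assume \<epsilon>: "0 < \<epsilon>"
      obtain c where c: "0 < c" "\<And>z. \<bar>w z\<bar> \<le> c"
        using bounded_borelE[OF w] by blast
      obtain M where M: "0 < M" "\<And>x. \<bar>u x\<bar> \<le> M"
        using Cb_bound u by blast
      have "0 < \<epsilon> / c" using \<epsilon> c by simp
      obtain \<eta>1 where \<eta>1: "0 < \<eta>1"
        "\<And>a b c'. \<bar>a\<bar> \<le> M \<Longrightarrow> \<bar>b\<bar> \<le> M \<Longrightarrow> \<bar>a - b\<bar> < \<eta>1 \<Longrightarrow> c' = a \<or> c' = b \<Longrightarrow>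
          \<bar>spow p (F a - F b) - spow p (deriv F c') * spow p (a - b)\<bar> \<le> \<epsilon> / c * \<bar>a - b\<bar> powr (p - 1)"
        by (rule spow_C1_increment[OF p F(1) \<open>0 < \<epsilon> / c\<close>]) blast
      have uc: "continuous_on UNIV u" using u by (simp add: Cb_def)
      obtain \<eta> where \<eta>: "0 < \<eta>" "\<And>x y. x \<in> S \<or> y \<in> S \<Longrightarrow> dist x y < \<eta> \<Longrightarrow> dist (u x) (u y) < \<eta>1"
        by (rule uniform_continuity_near_compact[OF S uc \<eta>1(1)]) blast
      have "\<bar>R z\<bar> \<le> \<epsilon> * W z" if d: "dist (fst z) (snd z) < \<eta>" for z
      proof (cases "fst z \<in> S \<or> snd z \<in> S")
        case True
        have "\<bar>u (fst z) - u (snd z)\<bar> < \<eta>1"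
          using \<eta>(2)[OF True d] by (simp add: dist_real_def)
        then have *: "\<bar>spow p (jump (\<lambda>x. F (u x)) z) - spow p (deriv F (u (\<pi> z))) * spow p (jump u z)\<bar> \<le> \<epsilon> / c * \<bar>jump u z\<bar> powr (p - 1)"
          unfolding jump_def using \<pi> M by (intro \<eta>1(2)) auto
        have "\<bar>R z\<bar> \<le> c * \<bar>jump h z\<bar> * (\<epsilon> / c * \<bar>jump u z\<bar> powr (p - 1))"
          unfolding R_def abs_mult using * c by (intro mult_mono) auto
        also have "\<dots> = \<epsilon> * \<bar>spow p (jump u z) * jump h z\<bar>"
          using c by (simp add: abs_mult abs_spow)
        also have "\<dots> \<le> \<epsilon> * W z"
          unfolding W_def using \<epsilon> by (intro mult_left_mono spow_Young p) auto
        finally show ?thesis .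
      next
        case False
        then have "w z * jump h z = 0" using supp by blast
        then have "R z = 0" by (simp only: R_def mult_zero_left)
        then show ?thesis using \<epsilon> by (simp add: W_def)
      qed
      then show "\<exists>\<eta>>0. \<forall>z. dist (fst z) (snd z) < \<eta> \<longrightarrow> \<bar>R z\<bar> \<le> \<epsilon> * W z"
        using \<eta>(1) by blast
    qed
  qed
  moreover have "(\<integral>z. R z \<partial>kernel_measure n) = T n w (\<lambda>x. F (u x)) h - T n (\<lambda>z. w z * spow p (deriv F (u (\<pi> z)))) u h" for n
  proof -
    have i1: "integrable (kernel_measure n) (\<lambda>z. w z * (spow p (jump (\<lambda>x. F (u x)) z) * jump h z))"
      using Fu h by (intro T_integrable[OF w]) auto
    have i2: "integrable (kernel_measure n) (\<lambda>z. (w z * spow p (deriv F (u (\<pi> z)))) * (spow p (jump u z) * jump h z))"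
      using u h by (intro T_integrable[OF bounded_borel_mult[OF w coef\<pi>]]) auto
    show ?thesis
      unfolding T_def Bochner_Integration.integral_diff[OF i1 i2, symmetric] R_def
      by (intro Bochner_Integration.integral_cong refl) (simp add: algebra_simps)
  qed
  ultimately show ?thesis by simp
qed

lemma partial_deriv_blinfun:
  fixes \<Psi> :: "real ^ 'n \<Rightarrow> real"
  assumes "(\<Psi> has_derivative blinfun_apply D) (at x)"
  shows "partial_deriv i \<Psi> x = blinfun_apply D (axis i 1)"
proof -
  have "((\<lambda>t. \<Psi> (x + t *\<^sub>R axis i 1)) has_derivative (\<lambda>t. blinfun_apply D (t *\<^sub>R axis i 1))) (at 0)"
  proof (rule has_derivative_compose[of "\<lambda>t. x + t *\<^sub>R axis i 1" "\<lambda>t. t *\<^sub>R axis i 1"])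
    show "((\<lambda>t. x + t *\<^sub>R axis i 1) has_derivative (\<lambda>t. t *\<^sub>R axis i 1)) (at 0)"
      by (auto intro!: derivative_eq_intros)
  qed (use assms in simp)
  moreover have "(\<lambda>t. blinfun_apply D (t *\<^sub>R axis i 1)) = (*) (blinfun_apply D (axis i 1))"
    by (auto simp: blinfun.scaleR_right)
  ultimately show ?thesis
    unfolding partial_deriv_def by (intro DERIV_imp_deriv) (simp add: has_field_derivative_def)
qed

text \<open>The function \<open>W\<close> dominates \<open>\<bar>D f\<bar> powr (p - 1) * \<bar>D (v i)\<bar>\<close> for every \<open>i\<close> by Young's inequality and has bounded
  integrals.\<close>
lemma T_chain_second:
  fixes v :: "'n::finite \<Rightarrow> 'a \<Rightarrow> real" and \<Psi> :: "real ^ 'n \<Rightarrow> real"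
  assumes S: "compact S" and f: "f \<in> B \<inter> Cb" and v: "\<And>i. v i \<in> B \<inter> Cb" and \<Psi>: "C1_function \<Psi>" "\<Psi> 0 = 0"
    and w: "bounded_borel w" and supp: "\<And>z. fst z \<notin> S \<Longrightarrow> w z = 0"
  shows "(\<lambda>n. T n w f (\<lambda>x. \<Psi> (\<chi> i. v i x)) -
           (\<Sum>i\<in>UNIV. T n (\<lambda>z. w z * partial_deriv i \<Psi> (\<chi> j. v j (fst z))) f (v i))) \<longlonglongrightarrow> 0"
proof -
  define V where "V x = (\<chi> i. v i x)" for x
  have \<Psi>V: "(\<lambda>x. \<Psi> (V x)) \<in> B \<inter> Cb" unfolding V_def using B_C1_compose[OF v \<Psi>] .
  obtain D where D: "\<And>x. (\<Psi> has_derivative blinfun_apply (D x)) (at x)" "continuous_on UNIV D"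
    using C1_derivative[OF \<Psi>(1)] by blast
  have pd: "partial_deriv i \<Psi> = (\<lambda>x. blinfun_apply (D x) (axis i 1))" for i
    by (rule ext) (rule partial_deriv_blinfun[OF D(1)])
  have "continuous_on UNIV (partial_deriv i \<Psi>)" for i
    unfolding pd by (intro continuous_intros D)
  then have pdV: "(\<lambda>x. partial_deriv i \<Psi> (V x)) \<in> Cb" for i
    unfolding V_def by (rule Cb_compose) (use v in auto)
  have coef: "bounded_borel (\<lambda>z :: 'a \<times> 'a. partial_deriv i \<Psi> (V (fst z)))" for i
    by (rule bounded_borel_fst_snd(1)[OF Cb_bounded_borel[OF pdV]])
  define R where "R z = w z * spow p (jump f z) * (jump (\<lambda>x. \<Psi> (V x)) z - (\<Sum>i\<in>UNIV. partial_deriv i \<Psi> (V (fst z)) * jump (v i) z))" for z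
  define W where "W z = (\<Sum>i\<in>UNIV. \<bar>jump f z\<bar> powr p + \<bar>jump (v i) z\<bar> powr p)" for z
  have "(\<lambda>n. \<integral>z. R z \<partial>kernel_measure n) \<longlonglongrightarrow> 0"
  proof -
    obtain K where K: "\<And>n. (\<integral>z. \<bar>jump f z\<bar> powr p \<partial>kernel_measure n) \<le> K"
      using jump_integral_bound f by blast
    have "\<exists>L. \<forall>n. (\<integral>z. \<bar>jump (v i) z\<bar> powr p \<partial>kernel_measure n) \<le> L" for i
      using jump_integral_bound[of "v i"] v[of i] by auto
    then obtain L where L: "\<And>i n. (\<integral>z. \<bar>jump (v i) z\<bar> powr p \<partial>kernel_measure n) \<le> L i"
      by metis
    show ?thesis
    proof (rule localization)
      show "bounded_borel R"
        unfolding R_def[abs_def] using f v \<Psi>V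
        by (intro bounded_borel_intros w coef) auto
      show "0 \<le> W z" for z by (auto simp: W_def intro!: sum_nonneg)
      have intW: "integrable (kernel_measure n) (\<lambda>z. \<bar>jump f z\<bar> powr p + \<bar>jump (v i) z\<bar> powr p)" for n i
        using f v by (intro Bochner_Integration.integrable_add B_integrable_jump) auto
      then show "integrable (kernel_measure n) W" for n
        unfolding W_def[abs_def] by (intro Bochner_Integration.integrable_sum)
      show "(\<integral>z. W z \<partial>kernel_measure n) \<le> (\<Sum>i\<in>UNIV. K + L i)" for n
      proof -
        have "(\<integral>z. W z \<partial>kernel_measure n) = (\<Sum>i\<in>UNIV. \<integral>z. \<bar>jump f z\<bar> powr p + \<bar>jump (v i) z\<bar> powr p \<partial>kernel_measure n)"
          unfolding W_def by (intro Bochner_Integration.integral_sum intW)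
        also have "\<dots> \<le> (\<Sum>i\<in>UNIV. K + L i)"
        proof (rule sum_mono)
          fix i
          show "(\<integral>z. \<bar>jump f z\<bar> powr p + \<bar>jump (v i) z\<bar> powr p \<partial>kernel_measure n) \<le> K + L i"
            using f v[of i] K[of n] L[where i = i and n = n]
            by (subst Bochner_Integration.integral_add) (auto intro: B_integrable_jump add_mono)
        qed
        finally show ?thesis .
      qed
      fix \<epsilon> :: real assume \<epsilon>: "0 < \<epsilon>"
      obtain c where c: "0 < c" "\<And>z. \<bar>w z\<bar> \<le> c"
        using bounded_borelE[OF w] by blast
      have vCb: "v i \<in> Cb" for i using v by simp
      obtain M where nV: "\<And>x. norm (V x) \<le> M"
        unfolding V_def by (rule Cb_vector_bound[of v, OF vCb]) blast
      have "0 < \<epsilon> / c" using \<epsilon> c by simp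
      obtain \<eta>1 where \<eta>1: "0 < \<eta>1"
        "\<And>a b c'. norm a \<le> M \<Longrightarrow> norm b \<le> M \<Longrightarrow> norm (a - b) < \<eta>1 \<Longrightarrow> c' = a \<or> c' = b \<Longrightarrow>
          \<bar>\<Psi> a - \<Psi> b - blinfun_apply (D c') (a - b)\<bar> \<le> \<epsilon> / c * norm (a - b)"
        by (rule C1_uniform_linearization[OF D \<open>0 < \<epsilon> / c\<close>]) blast
      have Vc: "continuous_on UNIV V"
        unfolding V_def using v by (intro continuous_on_vec_lambda) (auto simp: Cb_def)
      obtain \<eta> where \<eta>: "0 < \<eta>" "\<And>x y. x \<in> S \<or> y \<in> S \<Longrightarrow> dist x y < \<eta> \<Longrightarrow> dist (V x) (V y) < \<eta>1"
        by (rule uniform_continuity_near_compact[OF S Vc \<eta>1(1)]) blast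
      have "\<bar>R z\<bar> \<le> \<epsilon> * W z" if d: "dist (fst z) (snd z) < \<eta>" for z
      proof (cases "fst z \<in> S")
        case True
        let ?a = "V (fst z)" and ?b = "V (snd z)"
        have comp: "(?a - ?b) $ i = jump (v i) z" for i
          by (simp add: V_def jump_def)
        have "?a - ?b = (\<Sum>i\<in>UNIV. jump (v i) z *\<^sub>R axis i 1)"
          using basis_expansion[of "?a - ?b"] unfolding comp by (simp add: scalar_mult_eq_scaleR)
        then have lin: "blinfun_apply (D ?a) (?a - ?b) = (\<Sum>i\<in>UNIV. partial_deriv i \<Psi> ?a * jump (v i) z)"
          by (simp add: pd blinfun.sum_right blinfun.scaleR_right mult.commute)
        have "norm (?a - ?b) < \<eta>1"
          using \<eta>(2)[OF disjI1[OF True] d] by (simp add: dist_norm)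
        then have "\<bar>\<Psi> ?a - \<Psi> ?b - blinfun_apply (D ?a) (?a - ?b)\<bar> \<le> \<epsilon> / c * norm (?a - ?b)"
          using nV by (intro \<eta>1(2)) auto
        also have "\<dots> \<le> \<epsilon> / c * (\<Sum>i\<in>UNIV. \<bar>jump (v i) z\<bar>)"
          using norm_le_l1_cart[of "?a - ?b"] \<epsilon> c unfolding comp by (intro mult_left_mono) auto
        finally have *: "\<bar>jump (\<lambda>x. \<Psi> (V x)) z - (\<Sum>i\<in>UNIV. partial_deriv i \<Psi> (V (fst z)) * jump (v i) z)\<bar> \<le> \<epsilon> / c * (\<Sum>i\<in>UNIV. \<bar>jump (v i) z\<bar>)"
          unfolding lin by (simp add: jump_def)
        have "\<bar>R z\<bar> \<le> c * \<bar>spow p (jump f z)\<bar> * (\<epsilon> / c * (\<Sum>i\<in>UNIV. \<bar>jump (v i) z\<bar>))"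
          unfolding R_def abs_mult using * c by (intro mult_mono) auto
        also have "\<dots> = \<epsilon> * (\<Sum>i\<in>UNIV. \<bar>spow p (jump f z) * jump (v i) z\<bar>)"
          using c by (simp add: abs_mult sum_distrib_left mult_ac)
        also have "\<dots> \<le> \<epsilon> * W z"
          unfolding W_def using \<epsilon> by (intro mult_left_mono sum_mono spow_Young p) auto
        finally show ?thesis .
      next
        case False
        then have "R z = 0" using supp by (simp add: R_def)
        moreover have "0 \<le> W z" unfolding W_def by (intro sum_nonneg) simp
        ultimately show ?thesis using \<epsilon> by simp
      qed
      then show "\<exists>\<eta>>0. \<forall>z. dist (fst z) (snd z) < \<eta> \<longrightarrow> \<bar>R z\<bar> \<le> \<epsilon> * W z"
        using \<eta>(1) by blast
    qed
  qed
  moreover have "(\<integral>z. R z \<partial>kernel_measure n) = T n w f (\<lambda>x. \<Psi> (V x)) -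
      (\<Sum>i\<in>UNIV. T n (\<lambda>z. w z * partial_deriv i \<Psi> (V (fst z))) f (v i))" for n
  proof -
    have i: "integrable (kernel_measure n) (\<lambda>z. (w z * partial_deriv i \<Psi> (V (fst z))) * (spow p (jump f z) * jump (v i) z))" for i
      using f v by (intro T_integrable bounded_borel_mult w coef) auto
    have i0: "integrable (kernel_measure n) (\<lambda>z. w z * (spow p (jump f z) * jump (\<lambda>x. \<Psi> (V x)) z))"
      using f \<Psi>V by (intro T_integrable w) auto
    have "(\<integral>z. R z \<partial>kernel_measure n) = (\<integral>z. w z * (spow p (jump f z) * jump (\<lambda>x. \<Psi> (V x)) z) -
       (\<Sum>i\<in>UNIV. (w z * partial_deriv i \<Psi> (V (fst z))) * (spow p (jump f z) * jump (v i) z)) \<partial>kernel_measure n)"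
      unfolding R_def by (intro Bochner_Integration.integral_cong refl) (simp add: right_diff_distrib sum_distrib_left mult_ac)
    also have "\<dots> = T n w f (\<lambda>x. \<Psi> (V x)) - (\<Sum>i\<in>UNIV. T n (\<lambda>z. w z * partial_deriv i \<Psi> (V (fst z))) f (v i))"
      unfolding T_def Bochner_Integration.integral_diff[OF i0 Bochner_Integration.integrable_sum[OF i]]
        Bochner_Integration.integral_sum[OF i] ..
    finally show ?thesis .
  qed
  ultimately show ?thesis by (simp add: V_def)
qed


section \<open>The energy measure of one function\<close>

text \<open>The exponents \<open>p - 1\<close> and \<open>q - 1\<close> are inverse to each other when \<open>q\<close> is conjugate to \<open>p\<close>. This is
  the reason for the exponent and the constant in the definition of the energy measure.\<close>
lemma spow_conjugate:
  assumes "q = p / (p - 1)"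
  shows "((p - 1) / p) powr (p - 1) * spow p (q * spow q s) = s"
proof -
  have q: "0 < q" "(q - 1) * (p - 1) = 1" "(p - 1) / p = 1 / q"
    unfolding assms using p by (simp_all add: field_simps)
  have "spow p (spow q s) = s"
  proof (cases "s = 0")
    case False
    have "spow p (spow q s) = sgn s * (\<bar>s\<bar> powr (q - 1)) powr (p - 1)"
      using False abs_spow[of q s] by (simp add: spow_def[of p]) (simp add: spow_def sgn_mult)
    also have "\<dots> = s"
      by (simp add: powr_powr q(2) mult_sgn_abs)
    finally show ?thesis .
  qed simp
  moreover have "(1 / q) powr (p - 1) * spow p q = 1"
    using q(1) by (simp add: spow_def flip: powr_mult)
  ultimately show ?thesis
    unfolding spow_mult q(3) by (simp flip: mult.assoc)
qed

text \<open>The Leibniz rule \<open>D (u \<phi>) (x, y) = \<phi> x * D u (x, y) + u y * D \<phi> (x, y)\<close> splits the first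
  energy into the wanted limit and a remainder with weight \<open>u\<close> at the second coordinate. The chain rule for
  \<open>|u| powr (p / (p - 1))\<close> shows that the second energy is asymptotically the same remainder.\<close>
lemma energy_functional_limit:
  assumes u: "u \<in> B \<inter> Cb" and \<phi>: "\<phi> \<in> B \<inter> Cc"
  shows "(\<lambda>n. T n (\<lambda>z. \<phi> (fst z)) u u) \<longlonglongrightarrow>
     p_energy2 m p k \<rho> u (\<lambda>x. u x * \<phi> x)
       - ((p - 1) / p) powr (p - 1) * p_energy2 m p k \<rho> (\<lambda>x. \<bar>u x\<bar> powr (p / (p - 1))) \<phi>"
proof -
  define q where "q = p / (p - 1)"
  have q: "1 < q" using p by (simp add: q_def)
  define c where "c = ((p - 1) / p) powr (p - 1)"
  define F :: "real \<Rightarrow> real" where "F s = \<bar>s\<bar> powr q" for s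
  have F: "C1_function F" "F 0 = 0" "deriv F s = q * spow q s" for s
    using C1_abs_powr[OF q] by (auto simp: F_def[abs_def])
  have \<phi>Cb: "\<phi> \<in> B \<inter> Cb" using \<phi> Cc_subset_Cb by blast
  have u\<phi>: "(\<lambda>x. u x * \<phi> x) \<in> B" using u \<phi>Cb by (intro B_mult) auto
  have Fu: "(\<lambda>x. F (u x)) \<in> B" using B_C1_compose_real[OF u F(1,2)] by simp
  obtain S where S: "compact S" "\<And>x. x \<notin> S \<Longrightarrow> \<phi> x = 0"
    using CcE \<phi> by blast
  have bb: "bounded_borel (\<lambda>z :: 'a \<times> 'a. \<phi> (fst z))" "bounded_borel (\<lambda>z :: 'a \<times> 'a. u (snd z))"
    using bounded_borel_fst_snd[OF Cb_bounded_borel] u \<phi>Cb by auto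
  have product: "T n (\<lambda>z. 1) u (\<lambda>x. u x * \<phi> x) = T n (\<lambda>z. \<phi> (fst z)) u u + T n (\<lambda>z. u (snd z)) u \<phi>" for n
  proof -
    have "T n (\<lambda>z. 1) u (\<lambda>x. u x * \<phi> x) = (\<integral>z. \<phi> (fst z) * (spow p (jump u z) * jump u z) + u (snd z) * (spow p (jump u z) * jump \<phi> z) \<partial>kernel_measure n)"
      unfolding T_def by (intro Bochner_Integration.integral_cong refl) (simp add: jump_def algebra_simps)
    also have "\<dots> = T n (\<lambda>z. \<phi> (fst z)) u u + T n (\<lambda>z. u (snd z)) u \<phi>"
      unfolding T_def using u \<phi> by (intro Bochner_Integration.integral_add T_integrable bb) auto
    finally show ?thesis .
  qed
  have "(\<lambda>n. T n (\<lambda>z. 1) (\<lambda>x. F (u x)) \<phi> - T n (\<lambda>z. 1 * spow p (deriv F (u (snd z)))) u \<phi>) \<longlonglongrightarrow> 0"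
    using S by (intro T_chain_first[OF S(1) u \<phi>Cb F(1,2) bounded_borel_const]) (auto simp: jump_def)
  then have "(\<lambda>n. c * (T n (\<lambda>z. 1) (\<lambda>x. F (u x)) \<phi> - T n (\<lambda>z. 1 * spow p (deriv F (u (snd z)))) u \<phi>)) \<longlonglongrightarrow> c * 0"
    by (intro tendsto_mult tendsto_const)
  moreover have "c * T n (\<lambda>z. 1 * spow p (deriv F (u (snd z)))) u \<phi> = T n (\<lambda>z. u (snd z)) u \<phi>" for n
    unfolding T_cmult_weight[symmetric] F(3) using spow_conjugate[OF q_def] by (simp add: c_def)
  ultimately have chain: "(\<lambda>n. c * T n (\<lambda>z. 1) (\<lambda>x. F (u x)) \<phi> - T n (\<lambda>z. u (snd z)) u \<phi>) \<longlonglongrightarrow> 0"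
    by (simp add: right_diff_distrib)
  have "(\<lambda>n. T n (\<lambda>z. 1) u (\<lambda>x. u x * \<phi> x) - c * T n (\<lambda>z. 1) (\<lambda>x. F (u x)) \<phi> +
      (c * T n (\<lambda>z. 1) (\<lambda>x. F (u x)) \<phi> - T n (\<lambda>z. u (snd z)) u \<phi>)) \<longlonglongrightarrow>
      p_energy2 m p k \<rho> u (\<lambda>x. u x * \<phi> x) - c * p_energy2 m p k \<rho> (\<lambda>x. F (u x)) \<phi> + 0"
    using u \<phi> by (intro tendsto_add tendsto_diff tendsto_mult tendsto_const p_energy2_limit chain u\<phi> Fu) auto
  then show ?thesis
    unfolding product c_def F_def q_def by simp
qed

text \<open>Density in the supremum norm gives no control of supports. Composing the approximant with the
  soft threshold that moves every value by at most \<open>\<epsilon>/2\<close> towards 0 forces it to vanish wherever \<open>f\<close> does,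
  and keeps it in \<open>B\<close> because the threshold is a contraction.\<close>
lemma Cc_approximation:
  assumes f: "f \<in> Cc" and \<epsilon>: "0 < \<epsilon>"
  obtains g where "g \<in> B \<inter> Cc" "\<And>x. \<bar>f x - g x\<bar> \<le> \<epsilon>" "\<And>x. f x = 0 \<Longrightarrow> g x = 0"
proof -
  have "0 < \<epsilon> / 2" using \<epsilon> by simp
  then obtain h where h: "h \<in> B \<inter> Cc" "(SUP x. \<bar>f x - h x\<bar>) < \<epsilon> / 2"
    using dense f unfolding sup_dense_in_def by blast
  obtain K where "\<And>x. \<bar>f x - h x\<bar> \<le> K"
    using Cb_bound[of "\<lambda>x. f x - h x"] Cc_diff[OF f, of h] h(1) Cc_subset_Cb by blast
  then have "bdd_above (range (\<lambda>x. \<bar>f x - h x\<bar>))" by (intro bdd_aboveI) auto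
  then have fh: "\<bar>f x - h x\<bar> < \<epsilon> / 2" for x
    using h(2) cSUP_upper[of x UNIV "\<lambda>x. \<bar>f x - h x\<bar>"] by simp
  \<comment> \<open>The soft threshold at level \<open>\<epsilon>/2\<close>.\<close>
  define C where "C s = max (s - \<epsilon> / 2) 0 - max (- s - \<epsilon> / 2) 0" for s :: real
  have C0: "C s = 0" if "\<bar>s\<bar> \<le> \<epsilon> / 2" for s
    using that unfolding C_def by auto
  have C_dist: "\<bar>C s - s\<bar> \<le> \<epsilon> / 2" for s
    using \<epsilon> unfolding C_def by (auto simp: max_def)
  have C_Lip: "\<bar>C s - C t\<bar> \<le> 1 * \<bar>s - t\<bar>" for s t
    using \<epsilon> unfolding C_def by (auto simp: max_def)
  have Ch: "(\<lambda>x. C (h x)) \<in> Cc"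
  proof (rule Cc_support_subset[of _ h])
    show "continuous_on UNIV (\<lambda>x. C (h x))"
      using Cc_continuous[of h] h(1) unfolding C_def by (intro continuous_intros) auto
  qed (use h(1) C0[of 0] \<epsilon> in auto)
  show ?thesis
  proof (rule that[of "\<lambda>x. C (h x)"])
    have "(\<lambda>x. C (h x)) \<in> B"
    proof (rule B_Lipschitz_compose[where F = C and f = h and L = 1])
      show "C 0 = 0" using C0[of 0] \<epsilon> by simp
      show "\<bar>C (h x) - C 0\<bar> \<le> 1 * \<bar>h x\<bar>" for x using C_Lip[of "h x" 0] by simp
    qed (use h(1) C_Lip Cc_borel[OF Ch] in auto)
    then show "(\<lambda>x. C (h x)) \<in> B \<inter> Cc" using Ch by simp
    show "\<bar>f x - C (h x)\<bar> \<le> \<epsilon>" for x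
      using fh[of x] C_dist[of "h x"] by linarith
    show "C (h x) = 0" if "f x = 0" for x
      using fh[of x] that by (intro C0) auto
  qed
qed

lemma Cc_weight: "\<phi> \<in> Cc \<Longrightarrow> bounded_borel (\<lambda>z :: 'a \<times> 'a. \<phi> (fst z))"
  by (rule bounded_borel_fst_snd(1)[OF Cb_bounded_borel]) (use Cc_subset_Cb in blast)

lemma T_Cc_convergent:
  assumes u: "u \<in> B \<inter> Cb" and \<phi>: "\<phi> \<in> Cc"
  shows "convergent (\<lambda>n. T n (\<lambda>z. \<phi> (fst z)) u u)"
proof (rule Cauchy_convergent, rule CauchyI)
  fix e :: real assume e: "0 < e"
  have uB: "u \<in> B" using u by simp
  obtain K where K: "0 < K" "\<And>n w c. bounded_borel w \<Longrightarrow> (\<And>z. w z \<le> c) \<Longrightarrow> 0 \<le> c \<Longrightarrow> T n w u u \<le> c * K"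
    by (rule T_self_bound[OF uB]) blast
  define \<epsilon> where "\<epsilon> = e / (4 * K)"
  have \<epsilon>: "0 < \<epsilon>" "\<epsilon> * K = e / 4" using e K by (auto simp: \<epsilon>_def)
  obtain g where g: "g \<in> B \<inter> Cc" "\<And>x. \<bar>\<phi> x - g x\<bar> \<le> \<epsilon>"
    by (rule Cc_approximation[OF \<phi> \<epsilon>(1)]) blast
  have gCc: "g \<in> Cc" using g by simp
  have close: "\<bar>T n (\<lambda>z. \<phi> (fst z)) u u - T n (\<lambda>z. g (fst z)) u u\<bar> \<le> e / 4" for n
  proof -
    have b: "bounded_borel (\<lambda>z :: 'a \<times> 'a. \<phi> (fst z) - g (fst z))" "bounded_borel (\<lambda>z :: 'a \<times> 'a. g (fst z) - \<phi> (fst z))"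
      by (intro bounded_borel_diff Cc_weight \<phi> gCc)+
    have "T n (\<lambda>z. g (fst z) + (\<phi> (fst z) - g (fst z))) u u = T n (\<lambda>z. g (fst z)) u u + T n (\<lambda>z. \<phi> (fst z) - g (fst z)) u u"
      by (intro T_add_weight b Cc_weight gCc uB)
    moreover have "T n (\<lambda>z. \<phi> (fst z) + (g (fst z) - \<phi> (fst z))) u u = T n (\<lambda>z. \<phi> (fst z)) u u + T n (\<lambda>z. g (fst z) - \<phi> (fst z)) u u"
      by (intro T_add_weight b Cc_weight \<phi> uB)
    moreover have "T n (\<lambda>z. \<phi> (fst z) - g (fst z)) u u \<le> \<epsilon> * K"
    proof (rule K(2)[OF b(1)])
      show "\<phi> (fst z) - g (fst z) \<le> \<epsilon>" for z :: "'a \<times> 'a"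
        using g(2)[of "fst z"] by linarith
    qed (use \<epsilon> in auto)
    moreover have "T n (\<lambda>z. g (fst z) - \<phi> (fst z)) u u \<le> \<epsilon> * K"
    proof (rule K(2)[OF b(2)])
      show "g (fst z) - \<phi> (fst z) \<le> \<epsilon>" for z :: "'a \<times> 'a"
        using g(2)[of "fst z"] by linarith
    qed (use \<epsilon> in auto)
    ultimately show ?thesis using \<epsilon>(2) by (simp add: abs_le_iff)
  qed
  have "Cauchy (\<lambda>n. T n (\<lambda>z. g (fst z)) u u)"
    using energy_functional_limit[OF u g(1)] by (intro convergent_Cauchy convergentI)
  then obtain N where N: "\<And>i j. i \<ge> N \<Longrightarrow> j \<ge> N \<Longrightarrow> \<bar>T i (\<lambda>z. g (fst z)) u u - T j (\<lambda>z. g (fst z)) u u\<bar> < e / 4"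
    using CauchyD[of _ "e / 4"] e by fastforce
  have "norm (T i (\<lambda>z. \<phi> (fst z)) u u - T j (\<lambda>z. \<phi> (fst z)) u u) < e" if "i \<ge> N" "j \<ge> N" for i j
    using N[OF that] close[of i] close[of j] e unfolding real_norm_def by linarith
  then show "\<exists>N. \<forall>i\<ge>N. \<forall>j\<ge>N. norm (T i (\<lambda>z. \<phi> (fst z)) u u - T j (\<lambda>z. \<phi> (fst z)) u u) < e" by blast
qed

text \<open>Approximants supported where \<open>\<phi>\<close> is nonzero change the integral by at most \<open>\<epsilon>\<close> times the measure
  of a fixed compact set.\<close>
lemma radon_measure_eqI_B:
  assumes M: "radon_measure M" and N: "radon_measure N" "finite_measure N"
    and eq: "\<And>\<phi>. \<phi> \<in> B \<inter> Cc \<Longrightarrow> (\<integral>x. \<phi> x \<partial>M) = (\<integral>x. \<phi> x \<partial>N)"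
  shows "M = N"
proof (rule radon_measure_eqI[OF loc M N])
  fix \<phi> :: "'a \<Rightarrow> real" assume \<phi>: "\<phi> \<in> Cc"
  obtain S where S: "compact S" "\<And>x. x \<notin> S \<Longrightarrow> \<phi> x = 0"
    using CcE[OF \<phi>] by blast
  have close: "\<bar>(\<integral>x. \<phi> x \<partial>L) - (\<integral>x. g x \<partial>L)\<bar> \<le> \<epsilon> * measure L S"
    if L: "radon_measure L" and g: "g \<in> Cc" "\<And>x. \<bar>\<phi> x - g x\<bar> \<le> \<epsilon>" "\<And>x. \<phi> x = 0 \<Longrightarrow> g x = 0" for L g \<epsilon>
  proof -
    have S': "S \<in> sets L" "emeasure L S < \<infinity>"
      using L S(1) unfolding radon_measure_def by (auto intro: borel_compact)
    have sp: "S \<inter> space L = S" using sets.sets_into_space[OF S'(1)] by auto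
    have "(\<integral>x. \<phi> x \<partial>L) - (\<integral>x. g x \<partial>L) = (\<integral>x. \<phi> x - g x \<partial>L)"
      by (intro Bochner_Integration.integral_diff[symmetric] radon_integrable_Cc L \<phi> g(1))
    also have "\<bar>\<dots>\<bar> \<le> (\<integral>x. \<bar>\<phi> x - g x\<bar> \<partial>L)" by (rule integral_abs_bound)
    also have "\<dots> \<le> (\<integral>x. \<epsilon> * indicator S x \<partial>L)"
    proof (rule integral_mono)
      show "integrable L (\<lambda>x. \<bar>\<phi> x - g x\<bar>)"
        by (intro integrable_abs Bochner_Integration.integrable_diff radon_integrable_Cc L \<phi> g(1))
      show "integrable L (\<lambda>x. \<epsilon> * indicator S x :: real)"
        using S' by (intro integrable_mult_right integrable_real_indicator) auto
      show "\<bar>\<phi> x - g x\<bar> \<le> \<epsilon> * indicator S x" for x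
        using g(2)[of x] g(3)[of x] S(2)[of x] by (cases "x \<in> S") auto
    qed
    also have "\<dots> = \<epsilon> * measure L S" by (simp add: sp)
    finally show ?thesis .
  qed
  have "\<bar>(\<integral>x. \<phi> x \<partial>M) - (\<integral>x. \<phi> x \<partial>N)\<bar> \<le> 0 + e" if "0 < e" for e
  proof -
    define \<epsilon> where "\<epsilon> = e / (measure M S + measure N S + 1)"
    have pos: "0 < measure M S + measure N S + 1" by (simp add: add_nonneg_pos)
    then have \<epsilon>: "0 < \<epsilon>" using that by (simp add: \<epsilon>_def)
    obtain g where g: "g \<in> B \<inter> Cc" "\<And>x. \<bar>\<phi> x - g x\<bar> \<le> \<epsilon>" "\<And>x. \<phi> x = 0 \<Longrightarrow> g x = 0"
      by (rule Cc_approximation[OF \<phi> \<epsilon>]) blast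
    have "\<bar>(\<integral>x. \<phi> x \<partial>M) - (\<integral>x. \<phi> x \<partial>N)\<bar> \<le> \<epsilon> * measure M S + \<epsilon> * measure N S"
      using close[OF M _ g(2,3)] close[OF N(1) _ g(2,3)] g(1) eq[OF g(1)] by auto
    also have "\<dots> \<le> \<epsilon> * (measure M S + measure N S + 1)"
      using \<epsilon> by (simp add: algebra_simps)
    also have "\<dots> = e" using pos by (simp add: \<epsilon>_def)
    finally show ?thesis by simp
  qed
  then have "\<bar>(\<integral>x. \<phi> x \<partial>M) - (\<integral>x. \<phi> x \<partial>N)\<bar> \<le> 0" by (rule field_le_epsilon)
  then show "(\<integral>x. \<phi> x \<partial>M) = (\<integral>x. \<phi> x \<partial>N)" by simp
qed

abbreviation \<Gamma> :: "('a \<Rightarrow> real) \<Rightarrow> 'a measure" where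
  "\<Gamma> \<equiv> energy_measure m p k \<rho>"

lemma T_Cc_cmult: "T n (\<lambda>z. c * \<phi> (fst z)) f g = c * T n (\<lambda>z. \<phi> (fst z)) f g"
  by (rule T_cmult_weight)

lemma limit_functional_positive:
  assumes lim: "\<And>\<phi>. \<phi> \<in> Cc \<Longrightarrow> (\<lambda>n. F n \<phi>) \<longlonglongrightarrow> \<Lambda> \<phi>"
    and add: "\<And>n \<phi> \<psi>. \<phi> \<in> Cc \<Longrightarrow> \<psi> \<in> Cc \<Longrightarrow> F n (\<lambda>x. \<phi> x + \<psi> x) = F n \<phi> + F n \<psi>"
    and cmult: "\<And>n \<phi> c. \<phi> \<in> Cc \<Longrightarrow> F n (\<lambda>x. c * \<phi> x) = c * F n \<phi>"
    and nonneg: "\<And>n \<phi>. \<phi> \<in> Cc \<Longrightarrow> (\<And>x. 0 \<le> \<phi> x) \<Longrightarrow> 0 \<le> F n \<phi>"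
  shows "positive_Cc_functional (\<Lambda> :: ('a \<Rightarrow> real) \<Rightarrow> real)"
  unfolding positive_Cc_functional_def
proof (intro conjI ballI allI impI)
  fix \<phi> \<psi> :: "'a \<Rightarrow> real" assume \<phi>: "\<phi> \<in> Cc" and \<psi>: "\<psi> \<in> Cc"
  have "(\<lambda>n. F n (\<lambda>x. \<phi> x + \<psi> x)) \<longlonglongrightarrow> \<Lambda> \<phi> + \<Lambda> \<psi>"
    unfolding add[OF \<phi> \<psi>] by (intro tendsto_add lim \<phi> \<psi>)
  then show "\<Lambda> (\<lambda>x. \<phi> x + \<psi> x) = \<Lambda> \<phi> + \<Lambda> \<psi>"
    using lim[OF Cc_add[OF \<phi> \<psi>]] LIMSEQ_unique by blast
next
  fix \<phi> :: "'a \<Rightarrow> real" and c :: real assume \<phi>: "\<phi> \<in> Cc"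
  have "(\<lambda>n. F n (\<lambda>x. c * \<phi> x)) \<longlonglongrightarrow> c * \<Lambda> \<phi>"
    unfolding cmult[OF \<phi>] by (intro tendsto_mult tendsto_const lim \<phi>)
  then show "\<Lambda> (\<lambda>x. c * \<phi> x) = c * \<Lambda> \<phi>"
    using lim[OF Cc_cmult[OF \<phi>]] LIMSEQ_unique by blast
next
  fix \<phi> :: "'a \<Rightarrow> real" assume \<phi>: "\<phi> \<in> Cc" and "\<forall>x. 0 \<le> \<phi> x"
  then show "0 \<le> \<Lambda> \<phi>"
    by (intro LIMSEQ_le_const[OF lim[OF \<phi>]]) (auto intro: nonneg)
qed

lemma T_Cc_add:
  assumes "f \<in> B" "g \<in> B" "\<phi> \<in> Cc" "\<psi> \<in> Cc"
  shows "T n (\<lambda>z. \<phi> (fst z) + \<psi> (fst z)) f g = T n (\<lambda>z. \<phi> (fst z)) f g + T n (\<lambda>z. \<psi> (fst z)) f g"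
  by (intro T_add_weight Cc_weight assms)

text \<open>Existence comes from the Riesz theorem applied to the limit functional, uniqueness from density; so
  the definite description in \<^const>\<open>energy_measure\<close> denotes this measure.\<close>
lemma energy_measure:
  assumes u: "u \<in> B \<inter> Cb"
  shows "sets (\<Gamma> u) = sets borel" "finite_measure (\<Gamma> u)"
    "\<And>\<phi>. \<phi> \<in> Cc \<Longrightarrow> (\<lambda>n. T n (\<lambda>z. \<phi> (fst z)) u u) \<longlonglongrightarrow> (\<integral>x. \<phi> x \<partial>\<Gamma> u)"
proof -
  have uB: "u \<in> B" using u by simp
  define \<Lambda> where "\<Lambda> \<phi> = lim (\<lambda>n. T n (\<lambda>z. \<phi> (fst z)) u u)" for \<phi>
  have lim: "(\<lambda>n. T n (\<lambda>z. \<phi> (fst z)) u u) \<longlonglongrightarrow> \<Lambda> \<phi>" if "\<phi> \<in> Cc" for \<phi>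
    unfolding \<Lambda>_def using T_Cc_convergent[OF u that] by (simp add: convergent_LIMSEQ_iff)
  have \<Lambda>: "positive_Cc_functional \<Lambda>"
    by (rule limit_functional_positive[where F = "\<lambda>n \<phi>. T n (\<lambda>z. \<phi> (fst z)) u u"])
      (auto intro!: lim T_Cc_add T_Cc_cmult T_nonneg uB)
  obtain M where M: "radon_measure M" "\<And>\<phi>. \<phi> \<in> Cc \<Longrightarrow> (\<integral>x. \<phi> x \<partial>M) = \<Lambda> \<phi>"
    by (rule Riesz_Cc[OF loc \<Lambda>]) blast
  obtain K where K: "0 < K" "\<And>n w c. bounded_borel w \<Longrightarrow> (\<And>z. w z \<le> c) \<Longrightarrow> 0 \<le> c \<Longrightarrow> T n w u u \<le> c * K"
    by (rule T_self_bound[OF uB]) blast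
  have finM: "finite_measure M"
  proof (rule finite_radon_measure[OF loc M(1)])
    fix \<phi> :: "'a \<Rightarrow> real" assume \<phi>: "\<phi> \<in> Cc" "\<And>x. 0 \<le> \<phi> x" "\<And>x. \<phi> x \<le> 1"
    have "T n (\<lambda>z. \<phi> (fst z)) u u \<le> 1 * K" for n
      using \<phi> by (intro K(2) Cc_weight) auto
    then show "(\<integral>x. \<phi> x \<partial>M) \<le> 1 * K"
      unfolding M(2)[OF \<phi>(1)] by (intro LIMSEQ_le_const2[OF lim[OF \<phi>(1)]]) auto
  qed
  let ?E = "\<lambda>\<phi>. p_energy2 m p k \<rho> u (\<lambda>x. u x * \<phi> x)
             - ((p - 1) / p) powr (p - 1) * p_energy2 m p k \<rho> (\<lambda>x. \<bar>u x\<bar> powr (p / (p - 1))) \<phi>"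
  have E: "(\<integral>x. \<phi> x \<partial>M) = ?E \<phi>" if "\<phi> \<in> B \<inter> Cc" for \<phi>
    using energy_functional_limit[OF u that] lim[of \<phi>] M(2)[of \<phi>] that LIMSEQ_unique by auto
  have \<Gamma>M: "\<Gamma> u = M"
    unfolding energy_measure_def
  proof (rule the_equality)
    show "radon_measure M \<and> (\<forall>\<phi>\<in>B \<inter> Cc. (\<integral>x. \<phi> x \<partial>M) = ?E \<phi>)"
      using M(1) E by blast
    show "M' = M" if "radon_measure M' \<and> (\<forall>\<phi>\<in>B \<inter> Cc. (\<integral>x. \<phi> x \<partial>M') = ?E \<phi>)" for M'
      using that M(1) E finM by (intro radon_measure_eqI_B) auto
  qed
  show "sets (\<Gamma> u) = sets borel"
    using M(1) by (simp add: \<Gamma>M radon_measure_def)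
  show "(\<lambda>n. T n (\<lambda>z. \<phi> (fst z)) u u) \<longlonglongrightarrow> (\<integral>x. \<phi> x \<partial>\<Gamma> u)" if "\<phi> \<in> Cc" for \<phi>
    using lim[OF that] M(2)[OF that] by (simp add: \<Gamma>M)
  show "finite_measure (\<Gamma> u)" using finM by (simp add: \<Gamma>M)
qed

lemma energy_measure_integrable:
  assumes "u \<in> B \<inter> Cb" "\<phi> \<in> Cc"
  shows "integrable (\<Gamma> u) \<phi>"
  using assms(2) energy_measure[OF assms(1)]
  by (intro radon_integrable_Cc) (auto simp: radon_measure_def finite_measure.emeasure_finite less_top[symmetric])

section \<open>The energy measure of two functions\<close>

lemma B_Cb_add_cmult: "f \<in> B \<inter> Cb \<Longrightarrow> g \<in> B \<inter> Cb \<Longrightarrow> (\<lambda>x. f x + t * g x) \<in> B \<inter> Cb"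
  using B_add_cmult Cb_add_cmult by blast

lemma T_Cc_polarized_convergent:
  assumes u: "u \<in> B \<inter> Cb" and v: "v \<in> B \<inter> Cb" and \<phi>: "\<phi> \<in> Cc"
  shows "convergent (\<lambda>n. T n (\<lambda>z. \<phi> (fst z)) u v)"
proof -
  have pos: "convergent (\<lambda>n. T n (\<lambda>z. \<psi> (fst z)) u v)" if \<psi>: "\<psi> \<in> Cc" "\<And>x. 0 \<le> \<psi> x" for \<psi>
  proof (rule convergentI, rule T_polarized_limit)
    show "(\<lambda>n. T n (\<lambda>z. \<psi> (fst z)) (\<lambda>x. u x + t * v x) (\<lambda>x. u x + t * v x)) \<longlonglongrightarrow> (\<integral>x. \<psi> x \<partial>\<Gamma> (\<lambda>x. u x + t * v x))" for t
      by (rule energy_measure(3)[OF B_Cb_add_cmult[OF u v] \<psi>(1)])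
  qed (use u v \<psi> in \<open>auto intro: Cc_weight\<close>)
  define a b where ab: "a = (\<lambda>x. max (\<phi> x) 0)" "b = (\<lambda>x. max (0 - \<phi> x) 0)"
  have Cc: "a \<in> Cc" "b \<in> Cc" unfolding ab by (intro Cc_intros \<phi>)+
  have "T n (\<lambda>z. \<phi> (fst z)) u v = T n (\<lambda>z. a (fst z)) u v + (- 1) * T n (\<lambda>z. b (fst z)) u v" for n
  proof -
    have "T n (\<lambda>z. a (fst z) + (- 1) * b (fst z)) u v = T n (\<lambda>z. a (fst z)) u v + T n (\<lambda>z. (- 1) * b (fst z)) u v"
      using u v by (intro T_Cc_add Cc Cc_cmult) auto
    moreover have "(\<lambda>z :: 'a \<times> 'a. \<phi> (fst z)) = (\<lambda>z. a (fst z) + (- 1) * b (fst z))"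
      by (auto simp: ab)
    ultimately show ?thesis unfolding T_Cc_cmult by simp
  qed
  then show ?thesis
    using pos[of a] pos[of b] Cc by (auto simp: ab intro!: convergent_diff)
qed

text \<open>The limit functional \<open>L\<close> need not be positive, but \<open>L + S\<close> and \<open>S\<close> are, where \<open>S\<close> is the sum of the
  functionals of \<open>u\<close> and \<open>v\<close>; \<open>P\<close> and \<open>N\<close> represent these two. The uniform Taylor bound holds for the integrals of
  nonnegative test functions, hence on Borel sets, and says that \<open>P - N\<close> is the derivative of
  \<open>t \<mapsto> \<Gamma>\<langle>u + t v\<rangle> / p\<close> at 0, set by set.\<close>
lemma energy_measure2_representation:
  assumes u: "u \<in> B \<inter> Cb" and v: "v \<in> B \<inter> Cb"
  obtains P N where
    "finite_measure P" "sets P = sets borel" "finite_measure N" "sets N = sets borel"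
    "\<And>A. A \<in> sets borel \<Longrightarrow> energy_measure2 m p k \<rho> u v A = measure P A - measure N A"
    "\<And>\<phi>. \<phi> \<in> Cc \<Longrightarrow> (\<lambda>n. T n (\<lambda>z. \<phi> (fst z)) u v) \<longlonglongrightarrow> (\<integral>x. \<phi> x \<partial>P) - (\<integral>x. \<phi> x \<partial>N)"
proof -
  have uB: "u \<in> B" "v \<in> B" using u v by auto
  let ?G = "\<lambda>t. \<Gamma> (\<lambda>x. u x + t * v x)"
  note Gt = energy_measure[OF B_Cb_add_cmult[OF u v]]
  note Gu = energy_measure[OF u] and Gv = energy_measure[OF v]
  define L where "L \<phi> = lim (\<lambda>n. T n (\<lambda>z. \<phi> (fst z)) u v)" for \<phi>
  have L: "(\<lambda>n. T n (\<lambda>z. \<phi> (fst z)) u v) \<longlonglongrightarrow> L \<phi>" if "\<phi> \<in> Cc" for \<phi>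
    unfolding L_def using T_Cc_polarized_convergent[OF u v that] by (simp add: convergent_LIMSEQ_iff)
  define S where "S \<phi> = (\<integral>x. \<phi> x \<partial>\<Gamma> u) + (\<integral>x. \<phi> x \<partial>\<Gamma> v)" for \<phi> :: "'a \<Rightarrow> real"
  have S: "(\<lambda>n. T n (\<lambda>z. \<phi> (fst z)) u u + T n (\<lambda>z. \<phi> (fst z)) v v) \<longlonglongrightarrow> S \<phi>" if "\<phi> \<in> Cc" for \<phi>
    unfolding S_def by (intro tendsto_add Gu(3) Gv(3) that)
  have Spos: "positive_Cc_functional S"
    by (rule limit_functional_positive[where F = "\<lambda>n \<phi>. T n (\<lambda>z. \<phi> (fst z)) u u + T n (\<lambda>z. \<phi> (fst z)) v v"])
      (auto simp: T_Cc_add T_Cc_cmult uB distrib_left intro!: S add_nonneg_nonneg T_nonneg)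
  have LSpos: "positive_Cc_functional (\<lambda>\<phi>. L \<phi> + S \<phi>)"
  proof (rule limit_functional_positive[where F = "\<lambda>n \<phi>. T n (\<lambda>z. \<phi> (fst z)) u v + (T n (\<lambda>z. \<phi> (fst z)) u u + T n (\<lambda>z. \<phi> (fst z)) v v)"])
    show "0 \<le> T n (\<lambda>z. \<phi> (fst z)) u v + (T n (\<lambda>z. \<phi> (fst z)) u u + T n (\<lambda>z. \<phi> (fst z)) v v)"
      if "\<phi> \<in> Cc" "\<And>x. 0 \<le> \<phi> x" for n \<phi>
      using T_Young[OF Cc_weight[OF that(1)] that(2) uB, of n] by linarith
  qed (auto simp: T_Cc_add T_Cc_cmult uB distrib_left intro!: L S tendsto_add)
  obtain N where N: "radon_measure N" "\<And>\<phi>. \<phi> \<in> Cc \<Longrightarrow> (\<integral>x. \<phi> x \<partial>N) = S \<phi>"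
    by (rule Riesz_Cc[OF loc Spos]) blast
  obtain P where P: "radon_measure P" "\<And>\<phi>. \<phi> \<in> Cc \<Longrightarrow> (\<integral>x. \<phi> x \<partial>P) = L \<phi> + S \<phi>"
    by (rule Riesz_Cc[OF loc LSpos]) blast
  have Sbd: "S \<phi> \<le> measure (\<Gamma> u) (space (\<Gamma> u)) + measure (\<Gamma> v) (space (\<Gamma> v))"
    if \<phi>: "\<phi> \<in> Cc" "\<And>x. \<phi> x \<le> 1" for \<phi>
  proof -
    have "(\<integral>x. \<phi> x \<partial>\<Gamma> w) \<le> measure (\<Gamma> w) (space (\<Gamma> w))" if w: "w \<in> B \<inter> Cb" for w
    proof -
      interpret finite_measure "\<Gamma> w" by (rule energy_measure(2)[OF w])
      have "(\<integral>x. \<phi> x \<partial>\<Gamma> w) \<le> (\<integral>x. 1 \<partial>\<Gamma> w)"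
        using \<phi>(2) by (intro integral_mono energy_measure_integrable[OF w \<phi>(1)]) auto
      then show ?thesis by simp
    qed
    then show ?thesis unfolding S_def using u v by (intro add_mono) auto
  qed
  have finN: "finite_measure N"
    by (rule finite_radon_measure[OF loc N(1)]) (use N(2) Sbd in auto)
  have LS: "L \<phi> \<le> S \<phi>" if \<phi>: "\<phi> \<in> Cc" "\<And>x. 0 \<le> \<phi> x" for \<phi>
  proof (rule LIMSEQ_le[OF L[OF \<phi>(1)] S[OF \<phi>(1)]])
    have "T n (\<lambda>z. \<phi> (fst z)) u v \<le> T n (\<lambda>z. \<phi> (fst z)) u u + T n (\<lambda>z. \<phi> (fst z)) v v" for n
      using T_Young[OF Cc_weight[OF \<phi>(1)] \<phi>(2) uB, of n] by linarith
    then show "\<exists>N. \<forall>n\<ge>N. T n (\<lambda>z. \<phi> (fst z)) u v \<le> T n (\<lambda>z. \<phi> (fst z)) u u + T n (\<lambda>z. \<phi> (fst z)) v v"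
      by blast
  qed
  have finP: "finite_measure P"
  proof (rule finite_radon_measure[OF loc P(1)])
    fix \<phi> :: "'a \<Rightarrow> real" assume \<phi>: "\<phi> \<in> Cc" "\<And>x. 0 \<le> \<phi> x" "\<And>x. \<phi> x \<le> 1"
    show "(\<integral>x. \<phi> x \<partial>P) \<le> 2 * (measure (\<Gamma> u) (space (\<Gamma> u)) + measure (\<Gamma> v) (space (\<Gamma> v)))"
      unfolding P(2)[OF \<phi>(1)] mult_2
      using Sbd[OF \<phi>(1,3)] order_trans[OF LS[OF \<phi>(1,2)] Sbd[OF \<phi>(1,3)]] by (intro add_mono)
  qed
  have setsPN: "sets P = sets borel" "sets N = sets borel"
    using P(1) N(1) by (auto simp: radon_measure_def)
  have estimate: "\<exists>\<delta>>0. \<forall>t. \<bar>t\<bar> \<le> \<delta> \<longrightarrow>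
      \<bar>measure (?G t) A - measure (\<Gamma> u) A - t * (p * (measure P A - measure N A))\<bar>
        \<le> \<epsilon> * \<bar>t\<bar> * (measure (\<Gamma> u) A + measure (\<Gamma> v) A)"
    if A: "A \<in> sets borel" and \<epsilon>: "0 < \<epsilon>" for A \<epsilon>
  proof -
    obtain \<delta> where \<delta>: "0 < \<delta>"
      "\<And>t n w f g. \<bar>t\<bar> \<le> \<delta> \<Longrightarrow> bounded_borel w \<Longrightarrow> (\<And>z. 0 \<le> w z) \<Longrightarrow> f \<in> B \<Longrightarrow> g \<in> B \<Longrightarrow>
       \<bar>T n w (\<lambda>x. f x + t * g x) (\<lambda>x. f x + t * g x) - T n w f f - t * (p * T n w f g)\<bar>
         \<le> \<epsilon> * \<bar>t\<bar> * (T n w f f + T n w g g)"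
      by (rule T_uniform_derivative[OF \<epsilon>]) blast
    have "\<bar>measure (?G t) A - measure (\<Gamma> u) A - t * (p * (measure P A - measure N A))\<bar>
        \<le> \<epsilon> * \<bar>t\<bar> * (measure (\<Gamma> u) A + measure (\<Gamma> v) A)" if t: "\<bar>t\<bar> \<le> \<delta>" for t
    proof -
      have on_Cc: "\<bar>(\<integral>x. \<phi> x \<partial>?G t) - (\<integral>x. \<phi> x \<partial>\<Gamma> u) - t * (p * ((\<integral>x. \<phi> x \<partial>P) - (\<integral>x. \<phi> x \<partial>N)))\<bar>
          \<le> \<epsilon> * \<bar>t\<bar> * ((\<integral>x. \<phi> x \<partial>\<Gamma> u) + (\<integral>x. \<phi> x \<partial>\<Gamma> v))"
        if \<phi>: "\<phi> \<in> Cc" "\<And>x. 0 \<le> \<phi> x" for \<phi>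
      proof -
        let ?T = "\<lambda>n f g. T n (\<lambda>z. \<phi> (fst z)) f g"
        have "(\<lambda>n. \<bar>?T n (\<lambda>x. u x + t * v x) (\<lambda>x. u x + t * v x) - ?T n u u - t * (p * ?T n u v)\<bar>)
          \<longlonglongrightarrow> \<bar>(\<integral>x. \<phi> x \<partial>?G t) - (\<integral>x. \<phi> x \<partial>\<Gamma> u) - t * (p * L \<phi>)\<bar>"
          by (intro tendsto_intros Gt(3) Gu(3) L \<phi>)
        moreover have "(\<lambda>n. \<epsilon> * \<bar>t\<bar> * (?T n u u + ?T n v v)) \<longlonglongrightarrow> \<epsilon> * \<bar>t\<bar> * ((\<integral>x. \<phi> x \<partial>\<Gamma> u) + (\<integral>x. \<phi> x \<partial>\<Gamma> v))"
          by (intro tendsto_intros Gu(3) Gv(3) \<phi>)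
        ultimately have "\<bar>(\<integral>x. \<phi> x \<partial>?G t) - (\<integral>x. \<phi> x \<partial>\<Gamma> u) - t * (p * L \<phi>)\<bar>
          \<le> \<epsilon> * \<bar>t\<bar> * ((\<integral>x. \<phi> x \<partial>\<Gamma> u) + (\<integral>x. \<phi> x \<partial>\<Gamma> v))"
          by (rule LIMSEQ_le) (use \<delta>(2)[OF t Cc_weight[OF \<phi>(1)] \<phi>(2) uB] in auto)
        then show ?thesis using P(2)[OF \<phi>(1)] N(2)[OF \<phi>(1)] by simp
      qed
      \<comment> \<open>The two one-sided estimates, for \<open>\<sigma> = 1\<close> and \<open>\<sigma> = -1\<close>, say that a combination of five measures is nonnegative.\<close>
      define M where "M i = [?G t, \<Gamma> u, \<Gamma> v, P, N] ! i" for i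
      define c where "c \<sigma> i = [- \<sigma>, \<sigma> + \<epsilon> * \<bar>t\<bar>, \<epsilon> * \<bar>t\<bar>, \<sigma> * t * p, - \<sigma> * t * p] ! i" for \<sigma> :: real and i
      have five: "{..<5 :: nat} = {0, 1, 2, 3, 4}" by auto
      have "0 \<le> (\<Sum>i<5. c \<sigma> i * measure (M i) A)" if \<sigma>: "\<sigma> = 1 \<or> \<sigma> = -1" for \<sigma>
      proof (rule signed_Cc_nonneg_measure[OF loc _ _ _ _ A])
        show "finite_measure (M i)" "sets (M i) = sets borel" if "i \<in> {..<5}" for i
          using that Gt(1,2) Gu(1,2) Gv(1,2) finP finN setsPN unfolding five M_def by auto
        show "0 \<le> (\<Sum>i<5. c \<sigma> i * (\<integral>x. \<phi> x \<partial>M i))" if \<phi>: "\<phi> \<in> Cc" "\<And>x. 0 \<le> \<phi> x" for \<phi>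
          using on_Cc[OF \<phi>] \<sigma> unfolding five M_def c_def by (auto simp: algebra_simps abs_le_iff)
      qed simp
      from this[of 1] this[of "-1"] show ?thesis
        unfolding five M_def c_def by (simp add: algebra_simps abs_le_iff)
    qed
    then show ?thesis using \<delta>(1) by blast
  qed
  have repr: "energy_measure2 m p k \<rho> u v A = measure P A - measure N A" if A: "A \<in> sets borel" for A
  proof -
    obtain D where D: "(\<lambda>n::nat. p * (measure P A - measure N A)) \<longlonglongrightarrow> D"
      "((\<lambda>t. measure (?G t) A) has_real_derivative D) (at 0)"
    \<comment> \<open>Applied to sequences that are constant in \<open>n\<close>, the principle turns the estimate into a derivative.\<close>
    proof (rule difference_quotient_limit[of "\<lambda>n t. measure (?G t) A" "\<lambda>t. measure (?G t) A" "\<lambda>n. p * (measure P A - measure N A)"])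
      fix e :: real assume e: "0 < e"
      define K where "K = measure (\<Gamma> u) A + measure (\<Gamma> v) A"
      have K: "0 \<le> K" by (simp add: K_def)
      define \<epsilon> where "\<epsilon> = e / (K + 1)"
      have \<epsilon>: "0 < \<epsilon>" "\<epsilon> * K \<le> e" using e K by (auto simp: \<epsilon>_def field_simps)
      obtain \<delta> where \<delta>: "0 < \<delta>" "\<And>t. \<bar>t\<bar> \<le> \<delta> \<Longrightarrow>
        \<bar>measure (?G t) A - measure (\<Gamma> u) A - t * (p * (measure P A - measure N A))\<bar> \<le> \<epsilon> * \<bar>t\<bar> * K"
        using estimate[OF A \<epsilon>(1)] unfolding K_def by blast
      have "\<bar>measure (?G t) A - measure (?G 0) A - t * (p * (measure P A - measure N A))\<bar> \<le> e * \<bar>t\<bar>"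
        if "\<bar>t\<bar> \<le> \<delta>" for t
      proof -
        have "\<epsilon> * \<bar>t\<bar> * K = (\<epsilon> * K) * \<bar>t\<bar>" by simp
        also have "\<dots> \<le> e * \<bar>t\<bar>" using \<epsilon>(2) by (rule mult_right_mono) simp
        finally show ?thesis using \<delta>(2)[OF that] by simp
      qed
      then show "\<exists>\<delta>>0. \<forall>t n. \<bar>t\<bar> \<le> \<delta> \<longrightarrow> \<bar>measure (?G t) A - measure (?G 0) A - t * (p * (measure P A - measure N A))\<bar> \<le> e * \<bar>t\<bar>"
        using \<delta>(1) by blast
    qed auto
    have "D = p * (measure P A - measure N A)"
      using D(1) by (simp add: LIMSEQ_const_iff)
    then show ?thesis
      using DERIV_imp_deriv[OF D(2)] p by (simp add: energy_measure2_def)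
  qed
  show ?thesis
  proof (rule that[OF finP setsPN(1) finN setsPN(2) repr])
    show "(\<lambda>n. T n (\<lambda>z. \<phi> (fst z)) u v) \<longlonglongrightarrow> (\<integral>x. \<phi> x \<partial>P) - (\<integral>x. \<phi> x \<partial>N)" if "\<phi> \<in> Cc" for \<phi>
      using L[OF that] P(2)[OF that] N(2)[OF that] by simp
  qed
qed

section \<open>The chain rule\<close>

lemma sum_option_bool:
  fixes F :: "'n::finite option \<times> bool \<Rightarrow> real"
  shows "(\<Sum>j\<in>UNIV. F j) = F (None, True) + F (None, False) + (\<Sum>i\<in>UNIV. F (Some i, True) + F (Some i, False))"
proof -
  have "(\<Sum>j\<in>UNIV. F j) = (\<Sum>i\<in>UNIV. \<Sum>b\<in>UNIV. F (i, b))"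
    by (simp add: sum.cartesian_product flip: UNIV_Times_UNIV)
  also have "\<dots> = (\<Sum>i\<in>UNIV. F (i, True) + F (i, False))"
    by (simp add: UNIV_bool add.commute)
  finally show ?thesis
    by (simp add: UNIV_option_conv sum.reindex)
qed

text \<open>Both sides are combinations of finite measures with bounded continuous weights. Their integrals of
  a test function agree by the two chain rules for \<open>T\<close>, so they agree on Borel sets. The combination is
  indexed by pairs: \<open>None\<close> stands for the left-hand side, \<open>Some i\<close> for the ith summand, and the
  Boolean distinguishes positive and negative parts.\<close>
lemma energy_measure2_chain_rule:
  fixes v :: "'n::finite \<Rightarrow> 'a \<Rightarrow> real" and \<Psi> :: "real ^ 'n \<Rightarrow> real"
  assumes u: "u \<in> B \<inter> Cb" and v: "\<And>i. v i \<in> B \<inter> Cb"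
    and \<Phi>: "C1_function \<Phi>" "\<Phi> 0 = 0" and \<Psi>: "C1_function \<Psi>" "\<Psi> 0 = 0"
    and A: "A \<in> sets borel"
  shows "energy_measure2 m p k \<rho> (\<lambda>x. \<Phi> (u x)) (\<lambda>x. \<Psi> (\<chi> i. v i x)) A =
            (\<Sum>i\<in>UNIV. signed_set_integral (energy_measure2 m p k \<rho> u (v i)) A
               (\<lambda>x. spow p (deriv \<Phi> (u x)) * partial_deriv i \<Psi> (\<chi> j. v j x)))"
proof -
  have \<Phi>u: "(\<lambda>x. \<Phi> (u x)) \<in> B \<inter> Cb" by (rule B_C1_compose_real[OF u \<Phi>])
  have \<Psi>v: "(\<lambda>x. \<Psi> (\<chi> i. v i x)) \<in> B \<inter> Cb" by (rule B_C1_compose[OF v \<Psi>])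
  define c where "c x = spow p (deriv \<Phi> (u x))" for x
  define d where "d i x = partial_deriv i \<Psi> (\<chi> j. v j x)" for i x
  have d\<Phi>: "continuous_on UNIV (deriv \<Phi>)" using \<Phi> by (simp add: C1_real_iff)
  have uCb: "u \<in> Cb" using u by simp
  have cCb: "c \<in> Cb"
    unfolding c_def[abs_def] by (rule Cb_compose_real[OF continuous_spow[OF p] Cb_compose_real[OF d\<Phi> uCb]])
  have dCb: "d i \<in> Cb" for i
  proof -
    obtain D where D: "\<And>x. (\<Psi> has_derivative blinfun_apply (D x)) (at x)" "continuous_on UNIV D"
      using C1_derivative[OF \<Psi>(1)] by blast
    have "partial_deriv i \<Psi> = (\<lambda>x. blinfun_apply (D x) (axis i 1))"
      by (rule ext) (rule partial_deriv_blinfun[OF D(1)])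
    then have "continuous_on UNIV (partial_deriv i \<Psi>)"
      using D(2) by (simp add: continuous_intros)
    then show ?thesis
      unfolding d_def by (rule Cb_compose) (use v in auto)
  qed
  have wCb: "(\<lambda>x. c x * d i x) \<in> Cb" for i by (rule Cb_mult[OF cCb dCb])
  obtain P0 N0 where 0: "finite_measure P0" "sets P0 = sets borel" "finite_measure N0" "sets N0 = sets borel"
    "\<And>A. A \<in> sets borel \<Longrightarrow> energy_measure2 m p k \<rho> (\<lambda>x. \<Phi> (u x)) (\<lambda>x. \<Psi> (\<chi> i. v i x)) A = measure P0 A - measure N0 A"
    "\<And>\<phi>. \<phi> \<in> Cc \<Longrightarrow> (\<lambda>n. T n (\<lambda>z. \<phi> (fst z)) (\<lambda>x. \<Phi> (u x)) (\<lambda>x. \<Psi> (\<chi> i. v i x))) \<longlonglongrightarrow> (\<integral>x. \<phi> x \<partial>P0) - (\<integral>x. \<phi> x \<partial>N0)"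
    by (rule energy_measure2_representation[OF \<Phi>u \<Psi>v]) blast
  have "\<forall>i. \<exists>P N. finite_measure P \<and> sets P = sets borel \<and> finite_measure N \<and> sets N = sets borel \<and>
    (\<forall>A\<in>sets borel. energy_measure2 m p k \<rho> u (v i) A = measure P A - measure N A) \<and>
    (\<forall>\<phi>\<in>Cc. (\<lambda>n. T n (\<lambda>z. \<phi> (fst z)) u (v i)) \<longlonglongrightarrow> (\<integral>x. \<phi> x \<partial>P) - (\<integral>x. \<phi> x \<partial>N))" (is "\<forall>i. ?Q i")
  proof
    fix i
    show "?Q i"
      by (rule energy_measure2_representation[OF u v, of i]) blast
  qed
  then obtain P N where PN: "\<And>i. finite_measure (P i)" "\<And>i. sets (P i) = sets borel"
    "\<And>i. finite_measure (N i)" "\<And>i. sets (N i) = sets borel"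
    "\<And>i A. A \<in> sets borel \<Longrightarrow> energy_measure2 m p k \<rho> u (v i) A = measure (P i) A - measure (N i) A"
    "\<And>i \<phi>. \<phi> \<in> Cc \<Longrightarrow> (\<lambda>n. T n (\<lambda>z. \<phi> (fst z)) u (v i)) \<longlonglongrightarrow> (\<integral>x. \<phi> x \<partial>P i) - (\<integral>x. \<phi> x \<partial>N i)"
    by metis
  have on_Cc: "(\<integral>x. \<phi> x \<partial>P0) - (\<integral>x. \<phi> x \<partial>N0) =
      (\<Sum>i\<in>UNIV. (\<integral>x. \<phi> x * (c x * d i x) \<partial>P i) - (\<integral>x. \<phi> x * (c x * d i x) \<partial>N i))"
    if \<phi>: "\<phi> \<in> Cc" for \<phi>
  proof -
    obtain S where S: "compact S" "\<And>x. x \<notin> S \<Longrightarrow> \<phi> x = 0"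
      using CcE[OF \<phi>] by blast
    have cc: "continuous_on UNIV c" "continuous_on UNIV (\<lambda>x. c x * d i x)" for i
      using cCb wCb by (auto simp: Cb_def)
    have \<phi>c: "(\<lambda>x. \<phi> x * c x) \<in> Cc" by (rule Cc_mult_continuous[OF \<phi> cc(1)])
    let ?T0 = "\<lambda>n. T n (\<lambda>z. \<phi> (fst z)) (\<lambda>x. \<Phi> (u x)) (\<lambda>x. \<Psi> (\<chi> i. v i x))"
    let ?T1 = "\<lambda>n. T n (\<lambda>z. \<phi> (fst z) * c (fst z)) u (\<lambda>x. \<Psi> (\<chi> i. v i x))"
    let ?T2 = "\<lambda>n. \<Sum>i\<in>UNIV. T n (\<lambda>z. \<phi> (fst z) * (c (fst z) * d i (fst z))) u (v i)"
    have "(\<lambda>n. ?T0 n - ?T1 n) \<longlonglongrightarrow> 0"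
      unfolding c_def by (rule T_chain_first[OF S(1) u \<Psi>v \<Phi> Cc_weight[OF \<phi>]]) (auto simp: S(2))
    moreover have "(\<lambda>n. ?T1 n - (\<Sum>i\<in>UNIV. T n (\<lambda>z. (\<phi> (fst z) * c (fst z)) * partial_deriv i \<Psi> (\<chi> j. v j (fst z))) u (v i))) \<longlonglongrightarrow> 0"
      by (rule T_chain_second[OF S(1) u v \<Psi> Cc_weight[OF \<phi>c]]) (auto simp: S(2))
    then have "(\<lambda>n. ?T1 n - ?T2 n) \<longlonglongrightarrow> 0"
      by (simp add: d_def mult.assoc)
    moreover have "?T2 \<longlonglongrightarrow> (\<Sum>i\<in>UNIV. (\<integral>x. \<phi> x * (c x * d i x) \<partial>P i) - (\<integral>x. \<phi> x * (c x * d i x) \<partial>N i))"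
      by (intro tendsto_sum PN(6) Cc_mult_continuous[OF \<phi> cc(2)])
    ultimately have "(\<lambda>n. (?T0 n - ?T1 n) + ((?T1 n - ?T2 n) + ?T2 n)) \<longlonglongrightarrow>
        0 + (0 + (\<Sum>i\<in>UNIV. (\<integral>x. \<phi> x * (c x * d i x) \<partial>P i) - (\<integral>x. \<phi> x * (c x * d i x) \<partial>N i)))"
      by (intro tendsto_add)
    then have "?T0 \<longlonglongrightarrow> (\<Sum>i\<in>UNIV. (\<integral>x. \<phi> x * (c x * d i x) \<partial>P i) - (\<integral>x. \<phi> x * (c x * d i x) \<partial>N i))"
      by simp
    then show ?thesis using 0(6)[OF \<phi>] LIMSEQ_unique by blast
  qed
  define M where "M j = (case j of (None, b) \<Rightarrow> if b then P0 else N0 | (Some i, b) \<Rightarrow> if b then P i else N i)" for j :: "'n option \<times> bool"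
  define h where "h j x = (case j of (None, b) \<Rightarrow> if b then 1 else - 1 | (Some i, b) \<Rightarrow> if b then - (c x * d i x) else c x * d i x)"
    for j :: "'n option \<times> bool" and x
  have "\<exists>K. \<forall>x. \<bar>c x * d i x\<bar> \<le> K" for i
    by (rule Cb_bound[OF wCb[of i]]) blast
  then obtain K where K: "\<And>i x. \<bar>c x * d i x\<bar> \<le> K i" by metis
  have K': "\<bar>c x * d i x\<bar> \<le> 1 + (\<Sum>i\<in>UNIV. \<bar>K i\<bar>)" for i x
    using K[of x i] member_le_sum[of i UNIV "\<lambda>i. \<bar>K i\<bar>"] by fastforce
  have "(\<Sum>j\<in>UNIV. \<integral>x. indicator A x * h j x \<partial>M j) = 0"
  proof (rule signed_Cc_determines[OF loc _ _ _ _ _ _ A])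
    fix j :: "'n option \<times> bool"
    obtain i b where j: "j = (i, b)" by (cases j)
    show "finite_measure (M j)" "sets (M j) = sets borel"
      unfolding j M_def using 0 PN by (auto split: option.split)
    show "h j \<in> borel_measurable borel"
      unfolding j h_def[abs_def] using Cb_borel[OF wCb] by (cases i; cases b) auto
    show "\<bar>h j x\<bar> \<le> 1 + (\<Sum>i\<in>UNIV. \<bar>K i\<bar>)" for x
      unfolding j h_def using K'[where x = x] by (cases i; cases b) (auto intro!: sum_nonneg)
  next
    show "(\<Sum>j\<in>UNIV. \<integral>x. \<phi> x * h j x \<partial>M j) = 0" if "\<phi> \<in> Cc" for \<phi>
      using on_Cc[OF that] unfolding sum_option_bool by (simp add: M_def h_def sum_negf sum.distrib sum_subtractf)
  qed auto
  then have "measure P0 A - measure N0 A =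
      (\<Sum>i\<in>UNIV. (\<integral>x. indicator A x * (c x * d i x) \<partial>P i) - (\<integral>x. indicator A x * (c x * d i x) \<partial>N i))"
    using sets_eq_imp_space_eq[OF 0(2)] sets_eq_imp_space_eq[OF 0(4)]
    unfolding sum_option_bool by (simp add: M_def h_def sum_negf sum.distrib sum_subtractf)
  also have "\<dots> = (\<Sum>i\<in>UNIV. signed_set_integral (energy_measure2 m p k \<rho> u (v i)) A (\<lambda>x. c x * d i x))"
    by (intro sum.cong refl signed_set_integral_difference[OF PN(1-5) A Cb_borel[OF wCb] K, symmetric])
  finally show ?thesis
    using 0(5)[OF A] by (simp add: c_def d_def)
qed

end

theorem theorem4p9:
  fixes p :: real
    and m :: "'a::{metric_space, second_countable_topology} measure"
    and k :: "real \<Rightarrow> 'a \<times> 'a \<Rightarrow> ennreal"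
    and \<rho> :: "nat \<Rightarrow> real"
    and u :: "'a \<Rightarrow> real"
    and v :: "'n::finite \<Rightarrow> 'a \<Rightarrow> real"
    and \<Phi> :: "real \<Rightarrow> real"
    and \<Psi> :: "real ^ 'n \<Rightarrow> real"
  assumes "1 < p"
    and "locally compact (UNIV :: 'a set)"
    and "\<exists>x y :: 'a. x \<noteq> y"
    and "sets m = sets borel"
    and "sigma_finite_measure m"
    and "\<And>U. open U \<Longrightarrow> U \<noteq> {} \<Longrightarrow> 0 < emeasure m U"
    and "\<And>r. 0 < r \<Longrightarrow> k r \<in> borel_measurable borel"
    and "weak_monotonicity m p k"
    and "asymptotically_local m k"
    and "sup_dense_in (B_space m p k \<inter> Cc) Cc"
    and "\<And>n. 0 < \<rho> n"
    and "\<rho> \<longlonglongrightarrow> 0"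
    and "\<And>f. f \<in> B_space m p k \<Longrightarrow>
           \<exists>l::real. 0 \<le> l \<and> (\<lambda>n. J_energy m p k (\<rho> n) f) \<longlonglongrightarrow> ennreal l"
    and "u \<in> B_space m p k \<inter> Cb"
    and "\<And>i. v i \<in> B_space m p k \<inter> Cb"
    and "C1_function \<Phi>"
    and "C1_function \<Psi>"
    and "\<Phi> 0 = 0"
    and "\<Psi> 0 = 0"
  shows "(\<lambda>x. \<Phi> (u x)) \<in> B_space m p k \<inter> Cb \<and>
         (\<lambda>x. \<Psi> (\<chi> i. v i x)) \<in> B_space m p k \<inter> Cb \<and>
         (\<forall>A \<in> sets borel.
            energy_measure2 m p k \<rho> (\<lambda>x. \<Phi> (u x)) (\<lambda>x. \<Psi> (\<chi> i. v i x)) A =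
            (\<Sum>i\<in>UNIV. signed_set_integral (energy_measure2 m p k \<rho> u (v i)) A
               (\<lambda>x. sgn (deriv \<Phi> (u x)) * \<bar>deriv \<Phi> (u x)\<bar> powr (p - 1)
                      * partial_deriv i \<Psi> (\<chi> j. v j x))))"
proof -
  interpret p_energy_setting p m k \<rho>
    by (rule p_energy_setting.intro) (fact assms)+
  show ?thesis
  proof (intro conjI ballI)
    show "(\<lambda>x. \<Phi> (u x)) \<in> B_space m p k \<inter> Cb"
      by (rule B_C1_compose_real[OF assms(14,16,18)])
    show "(\<lambda>x. \<Psi> (\<chi> i. v i x)) \<in> B_space m p k \<inter> Cb"
      by (rule B_C1_compose[OF assms(15,17,19)])
  qed (rule energy_measure2_chain_rule[OF assms(14,15,16,18,17,19), unfolded spow_def])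
qed

end
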